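(* Let $S$ be a spray on a smooth manifold $M$ with canonical connection $\Gamma_S$, and let $\nabla$ be a lift of $\Gamma_S$ whose torsion satisfies ${\rm T}(S,Y)=0$ for all $Y\in\mathfrak{X}(TM\setminus 0)$. Let $H:(-\varepsilon,\varepsilon)\times I\to M$ be a smooth map such that each curve $t\mapsto H(s,t)$ is regular (nowhere vanishing velocity), and put $\lambda(t)=H(0,t)$, $T=\partial H/\partial t$, $U=\partial H/\partial s$. Let $D^T/dt$ and $D^T/ds$ denote the covariant derivatives along the curves $t\mapsto H(s,t)$ and $s\mapsto H(s,t)$, respectively, corresponding to $T$. If $\lambda$ is a geodesic of $S$, then at every point $(0,t)$, $$\frac{D^T}{ds}\frac{D^TT}{dt}-\frac{D^T}{dt}\frac{D^TT}{ds}={\bf R}_T(U).$$ In particular, if all curves $t\mapsto H(s,t)$ are geodesics of $S$, then $J(t)=U(0,t)$ satisfies the Jacobi equation $$\frac{(D^{\dot\lambda})^2J}{dt^2}+{\bf R}_{\dot\lambda}(J)=0.$$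
   Context: Let $\pi:TM\setminus 0\to M$ be the tangent bundle with the zero section removed, $\mathscr{V}TM=\ker({\rm d}\pi)\subset T(TM\setminus 0)$ the vertical bundle, regarded as a vector bundle over $TM\setminus 0$. For $w\in TM\setminus 0$, $i_w:T_{\pi(w)}M\to\mathscr{V}_wTM$, $i_w(u)=\frac{d}{dt}|_{t=0}(w+tu)$. The canonical vector field is $C(w)=i_w(w)$, and $\mathscr{J}(X)=i_w({\rm d}\pi(X))$ for $X\in T_w(TM\setminus 0)$. A spray is a smooth vector field $S$ on $TM\setminus 0$ with $\mathscr{J}(S)=C$ and $[C,S]=S$; its geodesics are the curves $\gamma$ in $M$ such that $t\mapsto\dot\gamma(t)$ is an integral curve of $S$. Its canonical connection is $\Gamma_S=-[S,\mathscr{J}]$, i.e. $\Gamma_S(Y)=\mathscr{J}[S,Y]-[S,\mathscr{J}(Y)]$; it satisfies $\Gamma_S^2={\bf I}$ and $\ker(\Gamma_S+{\bf I})=\mathscr{V}TM$. With $\mathscr{H}TM=\ker(\Gamma_S-{\bf I})$ (horizontal vectors) one has $T(TM\setminus 0)=\mathscr{H}TM\oplus\mathscr{V}TM$, with projections denoted $\mathscr{H},\mathscr{V}$; $S$ is horizontal. $u^{\mathfrak h}$ denotes the horizontal lift at $w$ of $u\in T_{\pi(w)}M$. A linear connection $\nabla$ on the vector bundle $\mathscr{V}TM\to TM\setminus 0$ is a lift of $\Gamma_S$ if $\nabla_XC=\mathscr{V}X$ for all $X\in T(TM\setminus 0)$. Its torsion is ${\rm T}(X,Y)=\nabla_X\mathscr{J}(Y)-\nabla_Y\mathscr{J}(X)-\mathscr{J}[X,Y]$,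 and its curvature is $\mathcal{R}(X,Y)\mathscr{J}(Z)=\nabla_{[X,Y]}\mathscr{J}(Z)-[\nabla_X,\nabla_Y]\mathscr{J}(Z)$. The curvature endomorphism in the direction $w$ is ${\bf R}_w:T_{\pi(w)}M\to T_{\pi(w)}M$, ${\bf R}_w(u)=i_w^{-1}\mathcal{R}(S,u^{\mathfrak h})C$ (evaluated at $w$). Affine connections: for $w\in T_xM\setminus 0$, $u\in T_xM$, and $V$ a vector field near $x$, $D^w_uV=i_w^{-1}\nabla_{u^{\mathfrak h}}V^{\mathfrak v}$, where $V^{\mathfrak v}(z)=i_z(V(\pi(z)))$. If $\lambda$ is a curve with $\lambda(t_0)=\pi(w)$ and $V$ is a vector field along $\lambda$, $\frac{D^wV}{dt}=i_w^{-1}\bigl(\frac{\nabla V^{\mathfrak v}}{dt}\bigr)(t_0)$, where $V^{\mathfrak v}$ is the vertical lift of $V$ along the horizontal lift of $\lambda$ through $w$ at $t=t_0$. For a nowhere null vector field $W$ along $\lambda$, $\frac{D^WV}{dt}(t_0)=\frac{D^{W(t_0)}V}{dt}$. *)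

theory Defs
  imports "HOL-Analysis.Analysis" "HOL-Library.Function_Algebras"
begin

text \<open>
  Tangent vectors below are families of components, one for each chart of an atlas. They form
  function types, on which the vector space operations are pointwise.
\<close>

instantiation "fun" :: (type, real_vector) real_vector
begin

definition scaleR_fun :: "real \<Rightarrow> ('a \<Rightarrow> 'b) \<Rightarrow> 'a \<Rightarrow> 'b"
  where "scaleR_fun r f = (\<lambda>x. r *\<^sub>R f x)"

instance
  by standard (simp_all add: scaleR_fun_def fun_eq_iff scaleR_add_right scaleR_add_left)

end


section \<open>Smooth maps between subsets of Euclidean spaces\<close>

text \<open>To be used on open sets \<open>A\<close>.\<close>

primrec C_k_on :: "nat \<Rightarrow> ('x::euclidean_space \<Rightarrow> 'y::real_normed_vector) \<Rightarrow> 'x set \<Rightarrow> bool"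
  where
    "C_k_on 0 f A \<longleftrightarrow> continuous_on A f"
  | "C_k_on (Suc k) f A \<longleftrightarrow>
       (\<forall>x\<in>A. f differentiable (at x)) \<and> (\<forall>v. C_k_on k (\<lambda>x. frechet_derivative f (at x) v) A)"

text \<open>
  On an arbitrary set, smoothness means that there are local smooth extensions to open sets.
\<close>

definition smooth_on :: "'x::euclidean_space set \<Rightarrow> ('x \<Rightarrow> 'y::real_normed_vector) \<Rightarrow> bool"
  where "smooth_on S f \<longleftrightarrow>
    (\<forall>x\<in>S. \<exists>A g. open A \<and> x \<in> A \<and> (\<forall>k. C_k_on k g A) \<and> (\<forall>y\<in>S \<inter> A. f y = g y))"


section \<open>Smooth manifolds\<close>

text \<open>
  A manifold is given by its set of points and an indexed atlas: the coordinate maps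
  \<open>crd i\<close> are defined on the sets \<open>dom i\<close>, for the indices \<open>i \<in> idx\<close>. The topology is the one
  induced by the atlas.
\<close>

record ('a, 'i, 'e) mfd =
  pts :: "'a set"
  idx :: "'i set"
  dom :: "'i \<Rightarrow> 'a set"
  crd :: "'i \<Rightarrow> 'a \<Rightarrow> 'e"

definition crd_inv :: "('a, 'i, 'e) mfd \<Rightarrow> 'i \<Rightarrow> 'e \<Rightarrow> 'a"
  where "crd_inv M i = inv_into (dom M i) (crd M i)"

definition transition :: "('a, 'i, 'e) mfd \<Rightarrow> 'i \<Rightarrow> 'i \<Rightarrow> 'e \<Rightarrow> 'e"
  where "transition M i j = crd M j \<circ> crd_inv M i"

definition mfd_topology :: "('a, 'i, 'e::euclidean_space) mfd \<Rightarrow> 'a topology"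
  where "mfd_topology M =
    topology (\<lambda>A. A \<subseteq> pts M \<and> (\<forall>i\<in>idx M. open (crd M i ` (A \<inter> dom M i))))"

definition smooth_manifold :: "('a, 'i, 'e::euclidean_space) mfd \<Rightarrow> bool"
  where "smooth_manifold M \<longleftrightarrow>
    (\<Union>i\<in>idx M. dom M i) = pts M \<and>
    (\<forall>i\<in>idx M. inj_on (crd M i) (dom M i)) \<and>
    (\<forall>i\<in>idx M. \<forall>j\<in>idx M.
       open (crd M i ` (dom M i \<inter> dom M j)) \<and>
       smooth_on (crd M i ` (dom M i \<inter> dom M j)) (transition M i j)) \<and>
    Hausdorff_space (mfd_topology M) \<and>
    second_countable (mfd_topology M)"

definition smooth_fun :: "('a, 'i, 'e::euclidean_space) mfd \<Rightarrow> ('a \<Rightarrow> real) \<Rightarrow> bool"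
  where "smooth_fun M f \<longleftrightarrow> (\<forall>i\<in>idx M. smooth_on (crd M i ` dom M i) (f \<circ> crd_inv M i))"

text \<open>Smooth maps from a subset of a Euclidean space to a manifold.\<close>

definition smooth_into ::
    "('a, 'i, 'e::euclidean_space) mfd \<Rightarrow> 'x::euclidean_space set \<Rightarrow> ('x \<Rightarrow> 'a) \<Rightarrow> bool"
  where "smooth_into M S F \<longleftrightarrow>
    F ` S \<subseteq> pts M \<and>
    (\<forall>x\<in>S. \<forall>i\<in>idx M. F x \<in> dom M i \<longrightarrow>
       (\<exists>A. open A \<and> x \<in> A \<and> F ` (S \<inter> A) \<subseteq> dom M i \<and> smooth_on (S \<inter> A) (crd M i \<circ> F)))"


section \<open>Tangent vectors and vector fields\<close>

text \<open>
  A tangent vector at \<open>p\<close> assigns components to each chart around \<open>p\<close>, which transform by the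
  derivatives of the chart changes. By convention, components in charts not containing
  \<open>p\<close> vanish.
\<close>

definition tangent_space :: "('a, 'i, 'e::euclidean_space) mfd \<Rightarrow> 'a \<Rightarrow> ('i \<Rightarrow> 'e) set"
  where "tangent_space M p = {v.
    (\<forall>i. \<not> (i \<in> idx M \<and> p \<in> dom M i) \<longrightarrow> v i = 0) \<and>
    (\<forall>i\<in>idx M. \<forall>j\<in>idx M. p \<in> dom M i \<and> p \<in> dom M j \<longrightarrow>
       v j = frechet_derivative (transition M i j) (at (crd M i p)) (v i))}"

text \<open>
  The velocity of a curve defined on an interval \<open>J\<close> (one-sided at end points belonging to \<open>J\<close>).
\<close>

definition velocity ::
    "('a, 'i, 'e::euclidean_space) mfd \<Rightarrow> real set \<Rightarrow> (real \<Rightarrow> 'a) \<Rightarrow> real \<Rightarrow> 'i \<Rightarrow> 'e"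
  where "velocity M J c t = (\<lambda>i.
    if i \<in> idx M \<and> c t \<in> dom M i then vector_derivative (crd M i \<circ> c) (at t within J) else 0)"

definition some_chart :: "('a, 'i, 'e) mfd \<Rightarrow> 'a \<Rightarrow> 'i"
  where "some_chart M p = (SOME i. i \<in> idx M \<and> p \<in> dom M i)"

definition tangent_map ::
    "('a, 'i, 'e::euclidean_space) mfd \<Rightarrow> ('b, 'j, 'f::euclidean_space) mfd \<Rightarrow> ('a \<Rightarrow> 'b) \<Rightarrow>
     'a \<Rightarrow> ('i \<Rightarrow> 'e) \<Rightarrow> 'j \<Rightarrow> 'f"
  where "tangent_map M N F p v = (\<lambda>j.
    if j \<in> idx N \<and> F p \<in> dom N j then
      (let i = some_chart M p in
        frechet_derivative (crd N j \<circ> F \<circ> crd_inv M i) (at (crd M i p)) (v i))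
    else 0)"

definition dir_deriv ::
    "('a, 'i, 'e::euclidean_space) mfd \<Rightarrow> 'a \<Rightarrow> ('i \<Rightarrow> 'e) \<Rightarrow> ('a \<Rightarrow> real) \<Rightarrow> real"
  where "dir_deriv M p v f =
    (let i = some_chart M p in frechet_derivative (f \<circ> crd_inv M i) (at (crd M i p)) (v i))"

definition field_rep :: "('a, 'i, 'e) mfd \<Rightarrow> 'i \<Rightarrow> ('a \<Rightarrow> 'i \<Rightarrow> 'e) \<Rightarrow> 'e \<Rightarrow> 'e"
  where "field_rep M i X = (\<lambda>y. X (crd_inv M i y) i)"

text \<open>Smooth vector fields, as total functions, are required to vanish outside the manifold.\<close>

definition vector_fields :: "('a, 'i, 'e::euclidean_space) mfd \<Rightarrow> ('a \<Rightarrow> 'i \<Rightarrow> 'e) set"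
  where "vector_fields M = {X.
    (\<forall>p\<in>pts M. X p \<in> tangent_space M p) \<and> (\<forall>p. p \<notin> pts M \<longrightarrow> X p = 0) \<and>
    (\<forall>i\<in>idx M. smooth_on (crd M i ` dom M i) (field_rep M i X))}"

definition lie_bracket ::
    "('a, 'i, 'e::euclidean_space) mfd \<Rightarrow> ('a \<Rightarrow> 'i \<Rightarrow> 'e) \<Rightarrow> ('a \<Rightarrow> 'i \<Rightarrow> 'e) \<Rightarrow> 'a \<Rightarrow> 'i \<Rightarrow> 'e"
  where "lie_bracket M X Y = (\<lambda>p i.
    if i \<in> idx M \<and> p \<in> dom M i then
      frechet_derivative (field_rep M i Y) (at (crd M i p)) (X p i)
      - frechet_derivative (field_rep M i X) (at (crd M i p)) (Y p i)
    else 0)"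

text \<open>
  The value on a single tangent vector \<open>v\<close> at \<open>p\<close> of an operator \<open>L\<close> on vector fields which is
  linear over the smooth functions: extend \<open>v\<close> to a vector field, apply \<open>L\<close> and evaluate at \<open>p\<close>.
\<close>

definition tensor_at ::
    "('a, 'i, 'e::euclidean_space) mfd \<Rightarrow> (('a \<Rightarrow> 'i \<Rightarrow> 'e) \<Rightarrow> 'a \<Rightarrow> 'i \<Rightarrow> 'e) \<Rightarrow>
     'a \<Rightarrow> ('i \<Rightarrow> 'e) \<Rightarrow> 'i \<Rightarrow> 'e"
  where "tensor_at M L p v = (THE u. \<exists>X\<in>vector_fields M. X p = v \<and> L X p = u)"


section \<open>The slit tangent bundle\<close>

definition slit_tangent ::
    "('a, 'i, 'e::euclidean_space) mfd \<Rightarrow> ('a \<times> ('i \<Rightarrow> 'e), 'i, 'e \<times> 'e) mfd"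
  where "slit_tangent M = \<lparr>
    pts = {(p, v). p \<in> pts M \<and> v \<in> tangent_space M p \<and> v \<noteq> 0},
    idx = idx M,
    dom = (\<lambda>i. {(p, v). p \<in> dom M i \<and> v \<in> tangent_space M p \<and> v \<noteq> 0}),
    crd = (\<lambda>i (p, v). (crd M i p, v i))\<rparr>"

type_synonym ('a, 'i, 'e) slit_field = "'a \<times> ('i \<Rightarrow> 'e) \<Rightarrow> 'i \<Rightarrow> 'e \<times> 'e"

definition dproj ::
    "('a, 'i, 'e::euclidean_space) mfd \<Rightarrow> 'a \<times> ('i \<Rightarrow> 'e) \<Rightarrow> ('i \<Rightarrow> 'e \<times> 'e) \<Rightarrow> 'i \<Rightarrow> 'e"
  where "dproj M w \<xi> = tangent_map (slit_tangent M) M fst w \<xi>"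

definition vertical_space ::
    "('a, 'i, 'e::euclidean_space) mfd \<Rightarrow> 'a \<times> ('i \<Rightarrow> 'e) \<Rightarrow> ('i \<Rightarrow> 'e \<times> 'e) set"
  where "vertical_space M w = {\<xi> \<in> tangent_space (slit_tangent M) w. dproj M w \<xi> = 0}"

text \<open>The isomorphism \<open>i\<^sub>w\<close> of \<open>T\<^bsub>\<pi>(w)\<^esub>M\<close> onto the vertical space at \<open>w\<close>.\<close>

definition vert ::
    "('a, 'i, 'e::euclidean_space) mfd \<Rightarrow> 'a \<times> ('i \<Rightarrow> 'e) \<Rightarrow> ('i \<Rightarrow> 'e) \<Rightarrow> 'i \<Rightarrow> 'e \<times> 'e"
  where "vert M w u = velocity (slit_tangent M) UNIV (\<lambda>t. (fst w, snd w + t *\<^sub>R u)) 0"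

definition vert_inv ::
    "('a, 'i, 'e::euclidean_space) mfd \<Rightarrow> 'a \<times> ('i \<Rightarrow> 'e) \<Rightarrow> ('i \<Rightarrow> 'e \<times> 'e) \<Rightarrow> 'i \<Rightarrow> 'e"
  where "vert_inv M w = inv_into (tangent_space M (fst w)) (vert M w)"

definition canonical_field :: "('a, 'i, 'e::euclidean_space) mfd \<Rightarrow> ('a, 'i, 'e) slit_field"
  where "canonical_field M = (\<lambda>w. vert M w (snd w))"

definition tangent_structure ::
    "('a, 'i, 'e::euclidean_space) mfd \<Rightarrow> ('a, 'i, 'e) slit_field \<Rightarrow> ('a, 'i, 'e) slit_field"
  where "tangent_structure M X = (\<lambda>w. vert M w (dproj M w (X w)))"


section \<open>Sprays and their canonical connections\<close>

definition spray :: "('a, 'i, 'e::euclidean_space) mfd \<Rightarrow> ('a, 'i, 'e) slit_field \<Rightarrow> bool"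
  where "spray M S \<longleftrightarrow>
    S \<in> vector_fields (slit_tangent M) \<and>
    tangent_structure M S = canonical_field M \<and>
    lie_bracket (slit_tangent M) (canonical_field M) S = S"

definition geodesic ::
    "('a, 'i, 'e::euclidean_space) mfd \<Rightarrow> ('a, 'i, 'e) slit_field \<Rightarrow> real set \<Rightarrow>
     (real \<Rightarrow> 'a) \<Rightarrow> bool"
  where "geodesic M S J \<gamma> \<longleftrightarrow>
    smooth_into M J \<gamma> \<and>
    (\<forall>t\<in>J. (\<gamma> t, velocity M J \<gamma> t) \<in> pts (slit_tangent M) \<and>
       velocity (slit_tangent M) J (\<lambda>\<tau>. (\<gamma> \<tau>, velocity M J \<gamma> \<tau>)) t = S (\<gamma> t, velocity M J \<gamma> t))"

definition spray_connection ::
    "('a, 'i, 'e::euclidean_space) mfd \<Rightarrow> ('a, 'i, 'e) slit_field \<Rightarrow>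
     ('a, 'i, 'e) slit_field \<Rightarrow> ('a, 'i, 'e) slit_field"
  where "spray_connection M S Y =
    tangent_structure M (lie_bracket (slit_tangent M) S Y)
    - lie_bracket (slit_tangent M) S (tangent_structure M Y)"

definition horizontal_space ::
    "('a, 'i, 'e::euclidean_space) mfd \<Rightarrow> ('a, 'i, 'e) slit_field \<Rightarrow> 'a \<times> ('i \<Rightarrow> 'e) \<Rightarrow>
     ('i \<Rightarrow> 'e \<times> 'e) set"
  where "horizontal_space M S w = {\<xi> \<in> tangent_space (slit_tangent M) w.
    tensor_at (slit_tangent M) (spray_connection M S) w \<xi> = \<xi>}"

definition vertical_part ::
    "('a, 'i, 'e::euclidean_space) mfd \<Rightarrow> ('a, 'i, 'e) slit_field \<Rightarrow> 'a \<times> ('i \<Rightarrow> 'e) \<Rightarrow>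
     ('i \<Rightarrow> 'e \<times> 'e) \<Rightarrow> 'i \<Rightarrow> 'e \<times> 'e"
  where "vertical_part M S w \<xi> =
    (THE \<eta>. \<eta> \<in> vertical_space M w \<and> \<xi> - \<eta> \<in> horizontal_space M S w)"

definition horizontal_lift ::
    "('a, 'i, 'e::euclidean_space) mfd \<Rightarrow> ('a, 'i, 'e) slit_field \<Rightarrow> 'a \<times> ('i \<Rightarrow> 'e) \<Rightarrow>
     ('i \<Rightarrow> 'e) \<Rightarrow> 'i \<Rightarrow> 'e \<times> 'e"
  where "horizontal_lift M S w u = (THE \<xi>. \<xi> \<in> horizontal_space M S w \<and> dproj M w \<xi> = u)"

definition horizontal_lift_curve ::
    "('a, 'i, 'e::euclidean_space) mfd \<Rightarrow> ('a, 'i, 'e) slit_field \<Rightarrow> real set \<Rightarrow>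
     (real \<Rightarrow> 'a) \<Rightarrow> (real \<Rightarrow> 'a \<times> ('i \<Rightarrow> 'e)) \<Rightarrow> bool"
  where "horizontal_lift_curve M S J \<gamma> c \<longleftrightarrow>
    smooth_into (slit_tangent M) J c \<and>
    (\<forall>t\<in>J. fst (c t) = \<gamma> t \<and> velocity (slit_tangent M) J c t \<in> horizontal_space M S (c t))"


section \<open>Linear connections on the vertical bundle\<close>

definition vertical_fields ::
    "('a, 'i, 'e::euclidean_space) mfd \<Rightarrow> ('a, 'i, 'e) slit_field set"
  where "vertical_fields M =
    {\<sigma> \<in> vector_fields (slit_tangent M). \<forall>w\<in>pts (slit_tangent M). \<sigma> w \<in> vertical_space M w}"

type_synonym ('a, 'i, 'e) connection =
  "('a, 'i, 'e) slit_field \<Rightarrow> ('a, 'i, 'e) slit_field \<Rightarrow> ('a, 'i, 'e) slit_field"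

definition linear_connection ::
    "('a, 'i, 'e::euclidean_space) mfd \<Rightarrow> ('a, 'i, 'e) connection \<Rightarrow> bool"
  where "linear_connection M nabla \<longleftrightarrow>
    (\<forall>X\<in>vector_fields (slit_tangent M). \<forall>\<sigma>\<in>vertical_fields M.
       nabla X \<sigma> \<in> vertical_fields M \<and>
       (\<forall>Y\<in>vector_fields (slit_tangent M). nabla (X + Y) \<sigma> = nabla X \<sigma> + nabla Y \<sigma>) \<and>
       (\<forall>\<tau>\<in>vertical_fields M. nabla X (\<sigma> + \<tau>) = nabla X \<sigma> + nabla X \<tau>) \<and>
       (\<forall>f. smooth_fun (slit_tangent M) f \<longrightarrow>
          nabla (\<lambda>w. f w *\<^sub>R X w) \<sigma> = (\<lambda>w. f w *\<^sub>R nabla X \<sigma> w) \<and>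
          nabla X (\<lambda>w. f w *\<^sub>R \<sigma> w) =
            (\<lambda>w. dir_deriv (slit_tangent M) w (X w) f *\<^sub>R \<sigma> w + f w *\<^sub>R nabla X \<sigma> w)))"

definition lift_of_spray_connection ::
    "('a, 'i, 'e::euclidean_space) mfd \<Rightarrow> ('a, 'i, 'e) slit_field \<Rightarrow>
     ('a, 'i, 'e) connection \<Rightarrow> bool"
  where "lift_of_spray_connection M S nabla \<longleftrightarrow>
    linear_connection M nabla \<and>
    (\<forall>X\<in>vector_fields (slit_tangent M). \<forall>w\<in>pts (slit_tangent M).
       nabla X (canonical_field M) w = vertical_part M S w (X w))"

definition torsion ::
    "('a, 'i, 'e::euclidean_space) mfd \<Rightarrow> ('a, 'i, 'e) connection \<Rightarrow>
     ('a, 'i, 'e) slit_field \<Rightarrow> ('a, 'i, 'e) slit_field \<Rightarrow> ('a, 'i, 'e) slit_field"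
  where "torsion M nabla X Y =
    nabla X (tangent_structure M Y) - nabla Y (tangent_structure M X)
    - tangent_structure M (lie_bracket (slit_tangent M) X Y)"

text \<open>Note the sign, which is the opposite of the most common one.\<close>

definition curvature ::
    "('a, 'i, 'e::euclidean_space) mfd \<Rightarrow> ('a, 'i, 'e) connection \<Rightarrow>
     ('a, 'i, 'e) slit_field \<Rightarrow> ('a, 'i, 'e) slit_field \<Rightarrow>
     ('a, 'i, 'e) slit_field \<Rightarrow> ('a, 'i, 'e) slit_field"
  where "curvature M nabla X Y \<sigma> =
    nabla (lie_bracket (slit_tangent M) X Y) \<sigma> - (nabla X (nabla Y \<sigma>) - nabla Y (nabla X \<sigma>))"

definition curvature_endo ::
    "('a, 'i, 'e::euclidean_space) mfd \<Rightarrow> ('a, 'i, 'e) slit_field \<Rightarrow> ('a, 'i, 'e) connection \<Rightarrow>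
     'a \<times> ('i \<Rightarrow> 'e) \<Rightarrow> ('i \<Rightarrow> 'e) \<Rightarrow> 'i \<Rightarrow> 'e"
  where "curvature_endo M S nabla w u =
    vert_inv M w (tensor_at (slit_tangent M) (\<lambda>Y. curvature M nabla S Y (canonical_field M)) w
      (horizontal_lift M S w u))"


section \<open>Covariant derivatives along curves\<close>

text \<open>
  The covariant derivative at \<open>t0\<close> of a section \<open>\<sigma>\<close> of the vertical bundle along a curve
  \<open>c\<close> in the slit tangent bundle is determined by additivity, the Leibniz rule and
  \<open>\<nabla>(E \<circ> c)/dt = \<nabla>\<^bsub>c'\<^esub> E\<close>: near \<open>t0\<close>, write \<open>\<sigma>\<close> as a linear combination
  \<open>\<Sum>\<^sub>k f k (E k \<circ> c)\<close> of restrictions of global sections; the result does not depend on the choices.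
\<close>

definition cov_deriv_vertical ::
    "('a, 'i, 'e::euclidean_space) mfd \<Rightarrow> ('a, 'i, 'e) connection \<Rightarrow> real set \<Rightarrow>
     (real \<Rightarrow> 'a \<times> ('i \<Rightarrow> 'e)) \<Rightarrow> (real \<Rightarrow> 'i \<Rightarrow> 'e \<times> 'e) \<Rightarrow> real \<Rightarrow> 'i \<Rightarrow> 'e \<times> 'e"
  where "cov_deriv_vertical M nabla J c \<sigma> t0 = (THE \<eta>.
    \<exists>(n::nat) (f :: nat \<Rightarrow> real \<Rightarrow> real) f' E A.
      (\<forall>k<n. E k \<in> vertical_fields M \<and> (f k has_real_derivative f' k) (at t0 within J)) \<and>
      open A \<and> t0 \<in> A \<and> (\<forall>t\<in>J \<inter> A. \<sigma> t = (\<Sum>k<n. f k t *\<^sub>R E k (c t))) \<and>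
      \<eta> = (\<Sum>k<n. f' k *\<^sub>R E k (c t0)
        + f k t0 *\<^sub>R tensor_at (slit_tangent M) (\<lambda>X. nabla X (E k)) (c t0)
            (velocity (slit_tangent M) J c t0)))"

text \<open>
  The covariant derivative at \<open>t0\<close>, with reference vector \<open>W t0\<close>, of a vector field \<open>V\<close> along a
  curve \<open>\<gamma>\<close> in the base manifold defined on the interval \<open>J\<close>. The horizontal lift of \<open>\<gamma>\<close> through
  \<open>W t0\<close> is in general only defined near \<open>t0\<close>. The values \<open>V t\<close> and \<open>W t\<close> are tangent vectors
  at \<open>\<gamma> t\<close>.
\<close>

definition cov_deriv ::
    "('a, 'i, 'e::euclidean_space) mfd \<Rightarrow> ('a, 'i, 'e) slit_field \<Rightarrow> ('a, 'i, 'e) connection \<Rightarrow>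
     real set \<Rightarrow> (real \<Rightarrow> 'a) \<Rightarrow> (real \<Rightarrow> 'i \<Rightarrow> 'e) \<Rightarrow> (real \<Rightarrow> 'i \<Rightarrow> 'e) \<Rightarrow> real \<Rightarrow> 'i \<Rightarrow> 'e"
  where "cov_deriv M S nabla J \<gamma> W V t0 =
    vert_inv M (\<gamma> t0, W t0) (THE \<eta>.
      \<exists>\<delta>>0. \<exists>c. horizontal_lift_curve M S (J \<inter> ball t0 \<delta>) \<gamma> c \<and> c t0 = (\<gamma> t0, W t0) \<and>
        \<eta> = cov_deriv_vertical M nabla (J \<inter> ball t0 \<delta>) c (\<lambda>t. vert M (c t) (V t)) t0)"

end

theory Submission
  imports Defs
begin

text \<open>
  In a chart write \<open>S = (y, \<sigma>(x, y))\<close> and \<open>N a = -D\<^sub>y\<sigma> a / 2\<close>. Horizontal vectors are \<open>(a, - N a)\<close>, and Euler's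
  relation \<open>[C, S] = S\<close> reads \<open>N y = -\<sigma>\<close>. At a fixed point \<open>\<nabla>\<close> is \<open>dZ(X) + B(X, Z)\<close> with \<open>B\<close> bilinear;
  the lift condition says \<open>B(X, y) = N(d\<pi> X)\<close>, and \<open>T(S, \<cdot>) = 0\<close> says \<open>B(S, Z) = N Z\<close>. No other value of \<open>B\<close>
  matters: in \<open>D\<^sup>T/ds (D\<^sup>TT/dt)\<close> the unknown Christoffel term is multiplied by \<open>D\<^sup>TT/dt\<close>, which vanishes
  along the geodesic \<open>\<lambda>\<close>. Both sides of the identity then become
  \<open>- D\<^sub>x\<sigma> U - (D N U)(S) - N N U\<close>. Horizontal lifts of curves, needed for the covariant
  derivatives to be defined at all, are solutions of an ordinary differential equation.
\<close>

section \<open>Calculus of smooth maps\<close>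

text \<open>Tensor values, horizontal lifts and both covariant derivatives are definite descriptions
  over global fields or over all local lifts. Each needs an existence half and an independence half.
  Existence comes from cutoffs: data given in one chart are multiplied by a bump function and
  extended by zero. Independence comes from a chart formula in which only values at the point
  survive. The connection acts on global fields, so localising it also goes through cutoffs; their
  value 1 and derivative 0 at the point make the Leibniz correction vanish.

  A first covariant derivative can be differentiated again only if it is known along a whole curve.
  So \<open>Dt T\<close>, \<open>Dt U\<close> and \<open>Ds T\<close> are expressed at every
  \<open>(s, t)\<close> through N alone, which is smooth, whereas the Christoffel symbols are chosen
  separately at each point.

  The interval \<open>I\<close> may contain end points. A chart expression of \<open>H\<close> is
  therefore handled through a smooth extension \<open>g\<close> to an open subset of the plane:
  one-sided derivatives become partial derivatives of \<open>g\<close>, and mixed partials of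
  \<open>g\<close> commute.\<close>

abbreviation fder :: "('x::euclidean_space \<Rightarrow> 'y::real_normed_vector) \<Rightarrow> 'x \<Rightarrow> 'x \<Rightarrow> 'y"
  where "fder f x \<equiv> frechet_derivative f (at x)"

lemma has_derivative_fder: "f differentiable (at x) \<Longrightarrow> (f has_derivative fder f x) (at x)"
  using frechet_derivative_works by blast

lemma fder_eqI: "(f has_derivative f') (at x) \<Longrightarrow> fder f x = f'"
  using frechet_derivative_at by metis

lemma C_k_on_cong:
  assumes "open A" "\<And>x. x \<in> A \<Longrightarrow> f x = g x" "C_k_on k f A"
  shows "C_k_on k g A"
  using assms(2,3)
proof (induction k arbitrary: f g)
  case 0
  then show ?case using continuous_on_cong by force
next
  case (Suc k)
  have "f differentiable (at x) \<Longrightarrow> g differentiable (at x)" if "x \<in> A" for x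
    using Suc.prems(1) has_derivative_transform_within_open[OF _ assms(1) that]
    unfolding differentiable_def by blast
  moreover have "fder f x = fder g x" if "x \<in> A" for x
    using frechet_derivative_transform_within_open[of f x A g] assms(1) Suc.prems that by auto
  ultimately show ?case using Suc.prems(2)
    by (auto intro: Suc.IH[of "\<lambda>x. fder f x v" for v])
qed

lemma C_k_on_subset: "C_k_on k f A \<Longrightarrow> B \<subseteq> A \<Longrightarrow> C_k_on k f B"
  by (induction k arbitrary: f) (auto intro: continuous_on_subset)

lemma C_k_on_SucD: "C_k_on (Suc k) f A \<Longrightarrow> C_k_on k f A"
proof (induction k arbitrary: f)
  case 0
  then show ?case
    by (simp add: continuous_at_imp_continuous_on differentiable_imp_continuous_within)
qed simp

lemma C_k_on_const [simp]: "C_k_on k (\<lambda>x. c) A"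
  by (induction k arbitrary: c) auto

lemma C_k_on_local:
  assumes "\<And>x. x \<in> A \<Longrightarrow> \<exists>U. open U \<and> x \<in> U \<and> C_k_on k f U"
  shows "C_k_on k f A"
  using assms
proof (induction k arbitrary: f)
  case 0
  have "continuous (at x) f" if "x \<in> A" for x
    using 0[OF that] continuous_on_eq_continuous_at by auto
  then show ?case by (simp add: continuous_at_imp_continuous_on)
next
  case (Suc k)
  have "f differentiable (at x)" if "x \<in> A" for x using Suc.prems[OF that] by auto
  moreover have "C_k_on k (\<lambda>x. fder f x v) A" for v
  proof (rule Suc.IH)
    fix x assume "x \<in> A"
    then obtain U where "open U" "x \<in> U" "C_k_on (Suc k) f U" using Suc.prems by blast
    then show "\<exists>U. open U \<and> x \<in> U \<and> C_k_on k (\<lambda>x. fder f x v) U" by auto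
  qed
  ultimately show ?case by simp
qed

lemma C_k_on_add:
  "C_k_on k f A \<Longrightarrow> C_k_on k g A \<Longrightarrow> open A \<Longrightarrow> C_k_on k (\<lambda>x. f x + g x) A"
proof (induction k arbitrary: f g)
  case 0
  then show ?case by (auto intro: continuous_intros)
next
  case (Suc k)
  have d: "((\<lambda>x. f x + g x) has_derivative (\<lambda>v. fder f x v + fder g x v)) (at x)" if "x \<in> A" for x
    using Suc.prems that by (auto intro!: has_derivative_add has_derivative_fder)
  have "C_k_on k (\<lambda>x. fder (\<lambda>x. f x + g x) x v) A" for v
  proof (rule C_k_on_cong[OF \<open>open A\<close>])
    show "C_k_on k (\<lambda>x. fder f x v + fder g x v) A"
      by (rule Suc.IH) (use Suc.prems in auto)
  qed (simp add: fder_eqI[OF d])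
  then show ?case using d by (auto simp: differentiable_def)
qed

lemma C_k_on_bounded_linear:
  assumes L: "bounded_linear L" and "open A"
  shows "C_k_on k f A \<Longrightarrow> C_k_on k (\<lambda>x. L (f x)) A"
proof (induction k arbitrary: f)
  case 0
  then show ?case by (auto intro: bounded_linear.continuous_on[OF L])
next
  case (Suc k)
  have d: "((\<lambda>x. L (f x)) has_derivative (\<lambda>v. L (fder f x v))) (at x)" if "x \<in> A" for x
    using Suc.prems that by (auto intro!: bounded_linear.has_derivative[OF L] has_derivative_fder)
  have "C_k_on k (\<lambda>x. fder (\<lambda>x. L (f x)) x v) A" for v
  proof (rule C_k_on_cong[OF \<open>open A\<close>])
    show "C_k_on k (\<lambda>x. L (fder f x v)) A"
      by (rule Suc.IH) (use Suc.prems in auto)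
  qed (simp add: fder_eqI[OF d])
  then show ?case using d by (auto simp: differentiable_def)
qed

text \<open>The Leibniz rule leaves one factor underived, so the induction step first lowers the
  order of that factor by \<open>C_k_on_SucD\<close>.\<close>

lemma C_k_on_bilinear:
  assumes L: "bounded_bilinear L" and "open A"
  shows "C_k_on k f A \<Longrightarrow> C_k_on k g A \<Longrightarrow> C_k_on k (\<lambda>x. L (f x) (g x)) A"
proof (induction k arbitrary: f g)
  case 0
  then show ?case by (auto intro: bounded_bilinear.continuous_on[OF L])
next
  case (Suc k)
  have d: "((\<lambda>x. L (f x) (g x)) has_derivative (\<lambda>v. L (f x) (fder g x v) + L (fder f x v) (g x))) (at x)"
    if "x \<in> A" for x
    using Suc.prems that by (auto intro!: bounded_bilinear.FDERIV[OF L] has_derivative_fder)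
  have "C_k_on k (\<lambda>x. fder (\<lambda>x. L (f x) (g x)) x v) A" for v
  proof (rule C_k_on_cong[OF \<open>open A\<close>])
    show "C_k_on k (\<lambda>x. L (f x) (fder g x v) + L (fder f x v) (g x)) A"
      using C_k_on_SucD[OF Suc.prems(1)] C_k_on_SucD[OF Suc.prems(2)] Suc.prems \<open>open A\<close>
      by (intro C_k_on_add Suc.IH) simp_all
  qed (simp add: fder_eqI[OF d])
  then show ?case using d by (auto simp: differentiable_def)
qed

lemma C_k_on_sum:
  "(\<And>b. b \<in> B \<Longrightarrow> C_k_on k (f b) A) \<Longrightarrow> open A \<Longrightarrow> C_k_on k (\<lambda>x. \<Sum>b\<in>B. f b x) A"
  by (induction B rule: infinite_finite_induct) (auto intro: C_k_on_add)

lemma C_k_on_Pair: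
  assumes "C_k_on k f A" "C_k_on k g A" "open A"
  shows "C_k_on k (\<lambda>x. (f x, g x)) A"
proof -
  have "bounded_linear (\<lambda>x. (x, 0))" "bounded_linear (\<lambda>x. (0, x))"
    by (auto intro!: bounded_linear_Pair bounded_linear_ident bounded_linear_zero)
  from C_k_on_add[OF C_k_on_bounded_linear[OF this(1) assms(3,1)]
      C_k_on_bounded_linear[OF this(2) assms(3,2)] assms(3)]
  show ?thesis by simp
qed

lemma C_k_on_linear: "bounded_linear f \<Longrightarrow> C_k_on k f A"
proof (cases k)
  case (Suc n)
  assume "bounded_linear f"
  then have d: "(f has_derivative f) (at x)" for x by (rule bounded_linear_imp_has_derivative)
  then show ?thesis using Suc by (auto simp: fder_eqI[OF d] differentiable_def)
qed (simp add: linear_continuous_on)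

text \<open>\<open>C_k_on\<close> speaks of derivatives in a fixed direction only. This expansion
  reduces a direction that varies with the point to finitely many fixed ones.\<close>

lemma fder_Basis_sum:
  assumes "f differentiable (at x)"
  shows "fder f x v = (\<Sum>b\<in>Basis. (v \<bullet> b) *\<^sub>R fder f x b)"
proof -
  have "linear (fder f x)" by (rule linear_frechet_derivative[OF assms])
  then have "fder f x (\<Sum>b\<in>Basis. (v \<bullet> b) *\<^sub>R b) = (\<Sum>b\<in>Basis. (v \<bullet> b) *\<^sub>R fder f x b)"
    by (simp add: linear_sum linear_cmul)
  then show ?thesis by (simp add: euclidean_representation)
qed

text \<open>The chain rule, expanded in a basis, is a sum of products of a derivative of
  \<open>g\<close> with a partial derivative of \<open>f\<close> composed with the same
  \<open>g\<close>. Hence the induction varies \<open>f\<close> only.\<close>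

lemma C_k_on_compose:
  assumes "open A" "open B" "g ` A \<subseteq> B"
  shows "C_k_on k g A \<Longrightarrow> C_k_on k f B \<Longrightarrow> C_k_on k (\<lambda>x. f (g x)) A"
proof (induction k arbitrary: f)
  case 0
  then show ?case using assms by (auto intro: continuous_on_compose2)
next
  case (Suc k)
  have gB: "g x \<in> B" if "x \<in> A" for x using assms that by auto
  have d: "((\<lambda>x. f (g x)) has_derivative (\<lambda>v. fder f (g x) (fder g x v))) (at x)" if "x \<in> A" for x
    using Suc.prems that gB
    by (auto intro!: has_derivative_compose[of g "fder g x" x UNIV f "fder f (g x)"] has_derivative_fder)
  have "C_k_on k (\<lambda>x. fder (\<lambda>x. f (g x)) x v) A" for v
  proof (rule C_k_on_cong[OF assms(1)])
    show "(\<Sum>b\<in>Basis. (fder g x v \<bullet> b) *\<^sub>R fder f (g x) b) = fder (\<lambda>x. f (g x)) x v" if "x \<in> A" for x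
      using Suc.prems gB[OF that] unfolding fder_eqI[OF d[OF that]]
      by (intro fder_Basis_sum[symmetric]) simp
    show "C_k_on k (\<lambda>x. \<Sum>b\<in>Basis. (fder g x v \<bullet> b) *\<^sub>R fder f (g x) b) A"
    proof (intro C_k_on_sum C_k_on_bilinear[OF bounded_bilinear_scaleR] assms)
      show "C_k_on k (\<lambda>x. fder g x v \<bullet> b) A" for b
        using Suc.prems by (intro C_k_on_bounded_linear[OF bounded_linear_inner_left] assms) simp
      show "C_k_on k (\<lambda>x. fder f (g x) b) A" for b
        by (rule Suc.IH) (use Suc.prems C_k_on_SucD[OF Suc.prems(1)] in auto)
    qed
  qed
  then show ?case using d by (auto simp: differentiable_def)
qed

definition C_inf_on :: "('x::euclidean_space \<Rightarrow> 'y::real_normed_vector) \<Rightarrow> 'x set \<Rightarrow> bool"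
  where "C_inf_on f A \<longleftrightarrow> (\<forall>k. C_k_on k f A)"

lemma C_inf_on_cong:
  "C_inf_on f A \<Longrightarrow> open A \<Longrightarrow> (\<And>x. x \<in> A \<Longrightarrow> f x = g x) \<Longrightarrow> C_inf_on g A"
  unfolding C_inf_on_def using C_k_on_cong by blast

lemma C_inf_on_subset: "C_inf_on f A \<Longrightarrow> B \<subseteq> A \<Longrightarrow> C_inf_on f B"
  unfolding C_inf_on_def using C_k_on_subset by blast

lemma C_inf_on_const [simp]: "C_inf_on (\<lambda>x. c) A"
  by (simp add: C_inf_on_def)

lemma C_inf_on_local:
  "(\<And>x. x \<in> A \<Longrightarrow> \<exists>U. open U \<and> x \<in> U \<and> C_inf_on f U) \<Longrightarrow> C_inf_on f A"
  unfolding C_inf_on_def by (meson C_k_on_local)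

lemma C_inf_on_add: "C_inf_on f A \<Longrightarrow> C_inf_on g A \<Longrightarrow> open A \<Longrightarrow> C_inf_on (\<lambda>x. f x + g x) A"
  by (simp add: C_inf_on_def C_k_on_add)

lemma C_inf_on_bounded_linear:
  "bounded_linear L \<Longrightarrow> C_inf_on f A \<Longrightarrow> open A \<Longrightarrow> C_inf_on (\<lambda>x. L (f x)) A"
  by (simp add: C_inf_on_def C_k_on_bounded_linear)

lemma C_inf_on_bilinear:
  "bounded_bilinear L \<Longrightarrow> C_inf_on f A \<Longrightarrow> C_inf_on g A \<Longrightarrow> open A \<Longrightarrow> C_inf_on (\<lambda>x. L (f x) (g x)) A"
  by (simp add: C_inf_on_def C_k_on_bilinear)

lemmas C_inf_on_scaleR = C_inf_on_bilinear[OF bounded_bilinear_scaleR]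
lemmas C_inf_on_mult = C_inf_on_bilinear[OF bounded_bilinear_mult]
lemmas C_inf_on_fst = C_inf_on_bounded_linear[OF bounded_linear_fst]
lemmas C_inf_on_snd = C_inf_on_bounded_linear[OF bounded_linear_snd]
lemmas C_inf_on_inner_left = C_inf_on_bounded_linear[OF bounded_linear_inner_left]
lemmas C_inf_on_uminus = C_inf_on_bounded_linear[OF bounded_linear_minus[OF bounded_linear_ident]]

lemma C_inf_on_diff: "C_inf_on f A \<Longrightarrow> C_inf_on g A \<Longrightarrow> open A \<Longrightarrow> C_inf_on (\<lambda>x. f x - g x) A"
  using C_inf_on_add[OF _ C_inf_on_uminus, of f A g] by simp

lemma C_inf_on_sum:
  "(\<And>b. b \<in> B \<Longrightarrow> C_inf_on (f b) A) \<Longrightarrow> open A \<Longrightarrow> C_inf_on (\<lambda>x. \<Sum>b\<in>B. f b x) A"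
  by (simp add: C_inf_on_def C_k_on_sum)

lemma C_inf_on_linear: "bounded_linear f \<Longrightarrow> C_inf_on f A"
  by (simp add: C_inf_on_def C_k_on_linear)

lemma C_inf_on_ident [simp]: "C_inf_on (\<lambda>x. x) A"
  by (simp add: C_inf_on_linear)

lemma C_inf_on_fst' [simp]: "C_inf_on fst A" and C_inf_on_snd' [simp]: "C_inf_on snd A"
  by (simp_all add: C_inf_on_linear bounded_linear_fst bounded_linear_snd)

lemma C_inf_on_compose:
  "C_inf_on f B \<Longrightarrow> C_inf_on g A \<Longrightarrow> open A \<Longrightarrow> open B \<Longrightarrow> g ` A \<subseteq> B \<Longrightarrow> C_inf_on (\<lambda>x. f (g x)) A"
  by (simp add: C_inf_on_def C_k_on_compose)

lemma C_inf_on_Pair: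
  "C_inf_on f A \<Longrightarrow> C_inf_on g A \<Longrightarrow> open A \<Longrightarrow> C_inf_on (\<lambda>x. (f x, g x)) A"
  by (simp add: C_inf_on_def C_k_on_Pair)

lemma C_inf_on_differentiable: "C_inf_on f A \<Longrightarrow> x \<in> A \<Longrightarrow> f differentiable (at x)"
  unfolding C_inf_on_def by (meson C_k_on.simps(2))

lemma C_inf_on_has_derivative: "C_inf_on f A \<Longrightarrow> x \<in> A \<Longrightarrow> (f has_derivative fder f x) (at x)"
  by (simp add: C_inf_on_differentiable has_derivative_fder)

lemma C_inf_on_fder: "C_inf_on f A \<Longrightarrow> C_inf_on (\<lambda>x. fder f x v) A"
  unfolding C_inf_on_def using C_k_on.simps(2) by blast

lemma C_inf_on_continuous_on: "C_inf_on f A \<Longrightarrow> continuous_on A f"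
  unfolding C_inf_on_def by (meson C_k_on.simps(1))

lemma C_inf_on_fder_apply:
  assumes "C_inf_on f B" "C_inf_on g A" "C_inf_on u A" "open A" "open B" "g ` A \<subseteq> B"
  shows "C_inf_on (\<lambda>x. fder f (g x) (u x)) A"
proof (rule C_inf_on_cong)
  show "C_inf_on (\<lambda>x. \<Sum>b\<in>Basis. (u x \<bullet> b) *\<^sub>R fder f (g x) b) A"
    by (intro C_inf_on_sum C_inf_on_scaleR C_inf_on_inner_left assms
        C_inf_on_compose[OF C_inf_on_fder[OF assms(1)]])
  show "(\<Sum>b\<in>Basis. (u x \<bullet> b) *\<^sub>R fder f (g x) b) = fder f (g x) (u x)" if "x \<in> A" for x
    using C_inf_on_differentiable[OF assms(1), of "g x"] assms(6) that
    by (intro fder_Basis_sum[symmetric]) blast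
qed fact

text \<open>On an open set the local extensions coincide with \<open>f\<close> near each point, so
  they have the same derivatives. Chart images and overlaps are open, which gives access to the
  calculus of \<open>C_inf_on\<close>.\<close>

lemma smooth_on_open_iff:
  assumes "open S"
  shows "smooth_on S f \<longleftrightarrow> C_inf_on f S"
proof
  assume s: "smooth_on S f"
  show "C_inf_on f S"
  proof (rule C_inf_on_local)
    fix x assume "x \<in> S"
    then obtain A g where A: "open A" "x \<in> A" "C_inf_on g A" "\<forall>y\<in>S \<inter> A. f y = g y"
      using s unfolding smooth_on_def C_inf_on_def by blast
    have "C_inf_on f (S \<inter> A)"
      by (rule C_inf_on_cong[OF C_inf_on_subset[OF A(3)]]) (use A assms in auto)
    then show "\<exists>U. open U \<and> x \<in> U \<and> C_inf_on f U"
      using A \<open>x \<in> S\<close> assms by blast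
  qed
next
  assume "C_inf_on f S"
  then show "smooth_on S f" unfolding smooth_on_def C_inf_on_def using assms by blast
qed

text \<open>The induction step for functions whose derivative is expressed by functions already
  known to be smooth of lower order: the family \<open>flat\<close> and solutions of differential
  equations.\<close>

lemma C_k_on_real_SucI:
  fixes f :: "real \<Rightarrow> 'y::real_normed_vector"
  assumes "\<And>x. x \<in> A \<Longrightarrow> (f has_vector_derivative f' x) (at x)" "C_k_on k f' A" "open A"
  shows "C_k_on (Suc k) f A"
proof -
  have "(\<lambda>r. r *\<^sub>R f' x) = fder f x" if "x \<in> A" for x
    using fder_eqI assms(1)[OF that] unfolding has_vector_derivative_def by metis
  then have "r *\<^sub>R f' x = fder f x r" if "x \<in> A" for x r using that by metis
  then have "C_k_on k (\<lambda>x. fder f x r) A" for r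
    by (intro C_k_on_cong[OF assms(3) _ C_k_on_bounded_linear[OF bounded_linear_scaleR_right assms(3,2)]])
  moreover have "f differentiable (at x)" if "x \<in> A" for x
    using assms(1)[OF that] by (auto simp: has_vector_derivative_def differentiable_def)
  ultimately show ?thesis by simp
qed

lemma C_inf_on_vector_derivative:
  assumes "C_inf_on f A" "x + r *\<^sub>R u \<in> A"
  shows "((\<lambda>r. f (x + r *\<^sub>R u)) has_vector_derivative fder f (x + r *\<^sub>R u) u) (at r within J)"
proof -
  have "((\<lambda>r. x + r *\<^sub>R u) has_derivative (\<lambda>h. h *\<^sub>R u)) (at r within J)"
    by (auto intro!: derivative_eq_intros)
  from has_derivative_compose[OF this C_inf_on_has_derivative[OF assms]]
  have "((\<lambda>r. f (x + r *\<^sub>R u)) has_derivative (\<lambda>h. fder f (x + r *\<^sub>R u) (h *\<^sub>R u))) (at r within J)" .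
  moreover have "linear (fder f (x + r *\<^sub>R u))"
    by (rule linear_frechet_derivative[OF C_inf_on_differentiable[OF assms]])
  ultimately show ?thesis unfolding has_vector_derivative_def by (simp add: linear_cmul)
qed

section \<open>Symmetry of second derivatives\<close>

text \<open>Two applications of the mean value theorem, one in each direction. The bound on
  \<open>s\<close> keeps the whole parallelogram inside the ball. The second difference is symmetric
  in \<open>u\<close> and \<open>v\<close>, the right-hand side is not visibly so.\<close>

lemma second_difference_mean_value:
  fixes f :: "'x::euclidean_space \<Rightarrow> real"
  assumes f: "C_inf_on f (ball x d)" and s: "0 < s" "s * (norm u + norm v) < d"
  obtains y where "norm (y - x) \<le> s * (norm u + norm v)"
    "f (x + s *\<^sub>R u + s *\<^sub>R v) - f (x + s *\<^sub>R u) - f (x + s *\<^sub>R v) + f x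
      = s\<^sup>2 * fder (\<lambda>z. fder f z u) y v"
proof -
  have n: "norm (a *\<^sub>R u + b *\<^sub>R v) \<le> s * (norm u + norm v)" if "0 \<le> a" "a \<le> s" "0 \<le> b" "b \<le> s" for a b
  proof -
    have "norm (a *\<^sub>R u + b *\<^sub>R v) \<le> a * norm u + b * norm v"
      using norm_triangle_ineq[of "a *\<^sub>R u" "b *\<^sub>R v"] that by simp
    also have "\<dots> \<le> s * (norm u + norm v)"
      using that by (simp add: distrib_left add_mono mult_right_mono)
    finally show ?thesis .
  qed
  have inb: "x + a *\<^sub>R u + b *\<^sub>R v \<in> ball x d" if "0 \<le> a" "a \<le> s" "0 \<le> b" "b \<le> s" for a b
  proof -
    have "dist x (x + a *\<^sub>R u + b *\<^sub>R v) = norm (a *\<^sub>R u + b *\<^sub>R v)"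
      by (metis add.assoc add_diff_cancel_left' dist_commute dist_norm)
    then show ?thesis using n[OF that] s by simp
  qed
  \<comment> \<open>\<open>g s - g 0\<close> is the second difference. The mean value theorem in
    direction \<open>u\<close> turns it into a first difference of the derivative along
    \<open>u\<close>; \<open>h\<close> below repeats this in direction \<open>v\<close>.\<close>
  define g where "g = (\<lambda>r. f (x + s *\<^sub>R v + r *\<^sub>R u) - f (x + r *\<^sub>R u))"
  have "\<exists>z. 0 < z \<and> z < s \<and>
     g s - g 0 = (s - 0) * (fder f (x + s *\<^sub>R v + z *\<^sub>R u) u - fder f (x + z *\<^sub>R u) u)"
  proof (rule MVT2)
    fix r :: real assume "0 \<le> r" "r \<le> s"
    then have "x + s *\<^sub>R v + r *\<^sub>R u \<in> ball x d" "x + r *\<^sub>R u \<in> ball x d"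
      using inb[of r s] inb[of r 0] s by (simp_all add: algebra_simps)
    from this[THEN C_inf_on_vector_derivative[OF f]]
    show "(g has_real_derivative
       (fder f (x + s *\<^sub>R v + r *\<^sub>R u) u - fder f (x + r *\<^sub>R u) u)) (at r)"
      unfolding g_def has_real_derivative_iff_has_vector_derivative
      by (rule has_vector_derivative_diff)
  qed (use s in auto)
  then obtain z where z: "0 < z" "z < s"
    "g s - g 0 = s * (fder f (x + s *\<^sub>R v + z *\<^sub>R u) u - fder f (x + z *\<^sub>R u) u)" by auto
  define h where "h = (\<lambda>r. fder f (x + z *\<^sub>R u + r *\<^sub>R v) u)"
  have "\<exists>w. 0 < w \<and> w < s \<and>
     h s - h 0 = (s - 0) * fder (\<lambda>z. fder f z u) (x + z *\<^sub>R u + w *\<^sub>R v) v"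
  proof (rule MVT2)
    fix r :: real assume "0 \<le> r" "r \<le> s"
    then have "x + z *\<^sub>R u + r *\<^sub>R v \<in> ball x d" using inb[of z r] z by auto
    from C_inf_on_vector_derivative[OF C_inf_on_fder[OF f] this]
    show "(h has_real_derivative fder (\<lambda>z. fder f z u) (x + z *\<^sub>R u + r *\<^sub>R v) v) (at r)"
      unfolding h_def has_real_derivative_iff_has_vector_derivative .
  qed (use s in auto)
  then obtain w where w: "0 < w" "w < s"
    "h s - h 0 = s * fder (\<lambda>z. fder f z u) (x + z *\<^sub>R u + w *\<^sub>R v) v" by auto
  show thesis
  proof
    show "norm (x + z *\<^sub>R u + w *\<^sub>R v - x) \<le> s * (norm u + norm v)"
      using n[of z w] z w by (simp add: algebra_simps)
    show "f (x + s *\<^sub>R u + s *\<^sub>R v) - f (x + s *\<^sub>R u) - f (x + s *\<^sub>R v) + f x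
      = s\<^sup>2 * fder (\<lambda>z. fder f z u) (x + z *\<^sub>R u + w *\<^sub>R v) v"
      using z(3) w(3) by (simp add: g_def h_def power2_eq_square algebra_simps)
  qed
qed

lemma fder_inner:
  assumes "f differentiable (at x)"
  shows "fder (\<lambda>z. f z \<bullet> b) x v = fder f x v \<bullet> b"
  using fder_eqI[OF has_derivative_inner_left[OF has_derivative_fder[OF assms], of b]] by simp

text \<open>Schwarz's theorem. The same second difference yields values of the two mixed derivatives
  at nearby points \<open>y\<close> and \<open>z\<close> that are equal, while by continuity they
  are close to the two supposedly different values at \<open>x\<close>.\<close>

lemma second_derivative_symmetric_real:
  fixes f :: "'x::euclidean_space \<Rightarrow> real"
  assumes f: "C_inf_on f A" and A: "open A" "x \<in> A"
  shows "fder (\<lambda>z. fder f z u) x v = fder (\<lambda>z. fder f z v) x u"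
proof (rule ccontr)
  \<comment> \<open>Half the gap: a number closer than \<open>e\<close> to both values would
    contradict the size of the gap.\<close>
  define e where "e = \<bar>fder (\<lambda>z. fder f z u) x v - fder (\<lambda>z. fder f z v) x u\<bar> / 2"
  assume "fder (\<lambda>z. fder f z u) x v \<noteq> fder (\<lambda>z. fder f z v) x u"
  then have e: "e > 0" by (simp add: e_def)
  have cont: "\<exists>d>0. \<forall>y. dist y x < d \<longrightarrow> dist (fder (\<lambda>z. fder f z a) y b) (fder (\<lambda>z. fder f z a) x b) < e" for a b
  proof -
    have "continuous_on A (\<lambda>y. fder (\<lambda>z. fder f z a) y b)"
      by (intro C_inf_on_continuous_on C_inf_on_fder f)
    then have "isCont (\<lambda>y. fder (\<lambda>z. fder f z a) y b) x"
      using A continuous_on_eq_continuous_at by blast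
    then show ?thesis using e unfolding continuous_at_eps_delta by blast
  qed
  obtain d0 where d0: "d0 > 0" "ball x d0 \<subseteq> A" using A open_contains_ball by blast
  obtain d1 where d1: "d1 > 0"
    "\<And>y. dist y x < d1 \<Longrightarrow> dist (fder (\<lambda>z. fder f z u) y v) (fder (\<lambda>z. fder f z u) x v) < e"
    using cont by blast
  obtain d2 where d2: "d2 > 0"
    "\<And>y. dist y x < d2 \<Longrightarrow> dist (fder (\<lambda>z. fder f z v) y u) (fder (\<lambda>z. fder f z v) x u) < e"
    using cont by blast
  define d where "d = min d0 (min d1 d2)"
  \<comment> \<open>The \<open>+ 1\<close> keeps the denominator positive when \<open>u\<close> and
    \<open>v\<close> both vanish.\<close>
  define s where "s = d / (2 * (norm u + norm v + 1))"
  have d: "d > 0" using d0 d1 d2 by (simp add: d_def)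
  have p: "0 \<le> norm u + norm v" by simp
  have s: "s > 0" using d p unfolding s_def by (simp add: add_nonneg_pos)
  have "s * (norm u + norm v) \<le> s * (norm u + norm v + 1)" using s by simp
  also have "\<dots> = d / 2"
  proof -
    have *: "d / (2 * c) * c = d / 2" if "c > 0" for c :: real using that by simp
    show ?thesis unfolding s_def by (rule *) (use p in linarith)
  qed
  also have "\<dots> < d" using d by simp
  finally have sd: "s * (norm u + norm v) < d" .
  have fb: "C_inf_on f (ball x d)" by (rule C_inf_on_subset[OF f]) (use d0 d_def in auto)
  obtain y where y: "norm (y - x) \<le> s * (norm u + norm v)"
    "f (x + s *\<^sub>R u + s *\<^sub>R v) - f (x + s *\<^sub>R u) - f (x + s *\<^sub>R v) + f x
      = s\<^sup>2 * fder (\<lambda>z. fder f z u) y v"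
    using second_difference_mean_value[OF fb s sd] by blast
  have sd': "s * (norm v + norm u) < d" using sd by (simp add: add.commute)
  obtain z where z: "norm (z - x) \<le> s * (norm v + norm u)"
    "f (x + s *\<^sub>R v + s *\<^sub>R u) - f (x + s *\<^sub>R v) - f (x + s *\<^sub>R u) + f x
      = s\<^sup>2 * fder (\<lambda>z. fder f z v) z u"
    using second_difference_mean_value[OF fb s sd'] by blast
  have "s\<^sup>2 * fder (\<lambda>z. fder f z u) y v = s\<^sup>2 * fder (\<lambda>z. fder f z v) z u"
    using y(2) z(2) by (simp add: algebra_simps)
  then have "fder (\<lambda>z. fder f z u) y v = fder (\<lambda>z. fder f z v) z u" using s by simp
  moreover have "dist (fder (\<lambda>z. fder f z u) y v) (fder (\<lambda>z. fder f z u) x v) < e"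
    by (rule d1(2)) (use y(1) sd in \<open>simp add: dist_norm d_def\<close>)
  moreover have "dist (fder (\<lambda>z. fder f z v) z u) (fder (\<lambda>z. fder f z v) x u) < e"
    by (rule d2(2)) (use z(1) sd' in \<open>simp add: dist_norm d_def\<close>)
  ultimately show False unfolding dist_real_def e_def by (simp add: abs_if split: if_splits)
qed

lemma second_derivative_symmetric:
  fixes f :: "'x::euclidean_space \<Rightarrow> 'y::euclidean_space"
  assumes f: "C_inf_on f A" and A: "open A" "x \<in> A"
  shows "fder (\<lambda>z. fder f z u) x v = fder (\<lambda>z. fder f z v) x u"
proof (rule euclidean_eqI)
  fix b :: 'y assume "b \<in> Basis"
  have i: "C_inf_on (\<lambda>z. f z \<bullet> b) A" by (rule C_inf_on_inner_left[OF f A(1)])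
  have eq: "fder (\<lambda>z. fder f z u) x v \<bullet> b = fder (\<lambda>z. fder (\<lambda>z. f z \<bullet> b) z u) x v" for u v
  proof -
    have "fder (\<lambda>z. fder f z u) x v \<bullet> b = fder (\<lambda>z. fder f z u \<bullet> b) x v"
      using fder_inner[OF C_inf_on_differentiable[OF C_inf_on_fder[OF f] A(2)]] by metis
    also have "fder (\<lambda>z. fder f z u \<bullet> b) x = fder (\<lambda>z. fder (\<lambda>z. f z \<bullet> b) z u) x"
    proof (rule frechet_derivative_transform_within_open[OF _ A])
      show "(\<lambda>z. fder f z u \<bullet> b) differentiable at x"
        by (rule C_inf_on_differentiable[OF C_inf_on_inner_left[OF C_inf_on_fder[OF f] A(1)] A(2)])
      show "fder f z u \<bullet> b = fder (\<lambda>z. f z \<bullet> b) z u" if "z \<in> A" for z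
        using fder_inner[OF C_inf_on_differentiable[OF f that]] by metis
    qed
    finally show ?thesis .
  qed
  show "fder (\<lambda>z. fder f z u) x v \<bullet> b = fder (\<lambda>z. fder f z v) x u \<bullet> b"
    unfolding eq by (rule second_derivative_symmetric_real[OF i A])
qed

text \<open>Product rule for a derivative whose base point and direction both vary. The directions
  are expanded in a basis, so that only fixed directions are differentiated, and the sum is put
  together again.\<close>

lemma has_derivative_fder_apply:
  fixes f :: "'x::euclidean_space \<Rightarrow> 'y::euclidean_space"
  assumes f: "C_inf_on f A" and A: "open A" "g x \<in> A" and "x \<in> J"
    and g: "(g has_derivative g') (at x within J)" and u: "(u has_derivative u') (at x within J)"
  shows "((\<lambda>z. fder f (g z) (u z)) has_derivative
      (\<lambda>h. fder (\<lambda>y. fder f y (u x)) (g x) (g' h) + fder f (g x) (u' h))) (at x within J)"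
proof -
  have "continuous (at x within J) g" using g has_derivative_continuous by blast
  then have ev: "eventually (\<lambda>z. g z \<in> A) (at x within J)"
    unfolding continuous_within using A topological_tendstoD by blast
  have fb: "C_inf_on (\<lambda>y. fder f y b) A" for b by (rule C_inf_on_fder[OF f])
  have "((\<lambda>z. \<Sum>b\<in>Basis. (u z \<bullet> b) *\<^sub>R fder f (g z) b) has_derivative
     (\<lambda>h. \<Sum>b\<in>Basis. (u x \<bullet> b) *\<^sub>R fder (\<lambda>y. fder f y b) (g x) (g' h) + (u' h \<bullet> b) *\<^sub>R fder f (g x) b))
     (at x within J)"
    by (intro has_derivative_sum has_derivative_scaleR has_derivative_inner_left u
        has_derivative_compose[OF g] C_inf_on_has_derivative[OF fb] A)
  moreover have "(\<Sum>b\<in>Basis. (u x \<bullet> b) *\<^sub>R fder (\<lambda>y. fder f y b) (g x) (g' h) + (u' h \<bullet> b) *\<^sub>R fder f (g x) b)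
     = fder (\<lambda>y. fder f y (u x)) (g x) (g' h) + fder f (g x) (u' h)" for h
  proof -
    \<comment> \<open>\<open>fder_Basis_sum\<close> expands the outer direction. So
      \<open>u x\<close> is first moved outwards by symmetry, and the basis vectors are moved back
      inwards afterwards.\<close>
    have "fder (\<lambda>y. fder f y (u x)) (g x) (g' h) = fder (\<lambda>y. fder f y (g' h)) (g x) (u x)"
      by (rule second_derivative_symmetric[OF f A])
    also have "\<dots> = (\<Sum>b\<in>Basis. (u x \<bullet> b) *\<^sub>R fder (\<lambda>y. fder f y (g' h)) (g x) b)"
      by (rule fder_Basis_sum[OF C_inf_on_differentiable[OF fb A(2)]])
    also have "\<dots> = (\<Sum>b\<in>Basis. (u x \<bullet> b) *\<^sub>R fder (\<lambda>y. fder f y b) (g x) (g' h))"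
      using second_derivative_symmetric[OF f A] by simp
    finally show ?thesis
      using fder_Basis_sum[OF C_inf_on_differentiable[OF f A(2)], of "u' h"] by (simp add: sum.distrib)
  qed
  moreover have "eventually (\<lambda>z. (\<Sum>b\<in>Basis. (u z \<bullet> b) *\<^sub>R fder f (g z) b) = fder f (g z) (u z)) (at x within J)"
    using ev by eventually_elim (metis fder_Basis_sum[OF C_inf_on_differentiable[OF f]])
  ultimately have "((\<lambda>z. \<Sum>b\<in>Basis. (u z \<bullet> b) *\<^sub>R fder f (g z) b) has_derivative
     (\<lambda>h. fder (\<lambda>y. fder f y (u x)) (g x) (g' h) + fder f (g x) (u' h))) (at x within J)"
    and "eventually (\<lambda>z. (\<Sum>b\<in>Basis. (u z \<bullet> b) *\<^sub>R fder f (g z) b) = fder f (g z) (u z)) (at x within J)"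
    by simp_all
  then show ?thesis
    by (rule has_derivative_transform_eventually)
      (use fder_Basis_sum[OF C_inf_on_differentiable[OF f A(2)], of "u x"] \<open>x \<in> J\<close> in simp_all)
qed

section \<open>Smooth bump functions\<close>

text \<open>The case \<open>k = 0\<close> is the classical function exp(-1/r). The powers of 1/r are
  included because they make the span of the family closed under differentiation, so smoothness
  follows by one induction for all \<open>k\<close>.\<close>

definition flat :: "nat \<Rightarrow> real \<Rightarrow> real"
  where "flat k r = (if r > 0 then inverse r ^ k * exp (- inverse r) else 0)"

text \<open>From the right, substitute the inverse of \<open>r\<close>: the exponential beats every
  power. From the left the function is zero.\<close>

lemma flat_tendsto_0: "(flat k \<longlongrightarrow> 0) (at 0)"
proof -
  have "((\<lambda>r. inverse r ^ k / exp (inverse r)) \<longlongrightarrow> 0) (at_right (0::real))"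
    by (rule filterlim_compose[OF tendsto_power_div_exp_0 filterlim_inverse_at_top_right])
  then have "(flat k \<longlongrightarrow> 0) (at_right 0)"
    by (rule tendsto_cong[THEN iffD1, rotated])
      (auto simp: flat_def eventually_at_filter exp_minus divide_inverse)
  moreover have "(flat k \<longlongrightarrow> 0) (at_left 0)"
    by (rule tendsto_eventually) (auto simp: flat_def eventually_at_filter)
  ultimately show ?thesis by (simp add: filterlim_split_at)
qed

lemma has_derivative_flat:
  "(flat k has_real_derivative flat (k + 2) r - of_nat k * flat (k + 1) r) (at r)"
proof -
  consider "r > 0" | "r = 0" | "r < 0" by linarith
  then show ?thesis
  proof cases
    case 1
    have "((\<lambda>u. u ^ k * exp (- u)) has_real_derivative
        of_nat k * u ^ (k - 1) * exp (- u) - u ^ k * exp (- u)) (at u)" for u :: real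
      by (auto intro!: derivative_eq_intros simp: algebra_simps)
    from DERIV_chain2[OF this DERIV_inverse]
    have "((\<lambda>r. inverse r ^ k * exp (- inverse r)) has_real_derivative
        (of_nat k * inverse r ^ (k - 1) * exp (- inverse r) - inverse r ^ k * exp (- inverse r)) *
        - (inverse r ^ Suc (Suc 0))) (at r)"
      using 1 by simp
    also have "(of_nat k * inverse r ^ (k - 1) * exp (- inverse r) - inverse r ^ k * exp (- inverse r)) *
        - (inverse r ^ Suc (Suc 0)) = flat (k + 2) r - of_nat k * flat (k + 1) r"
      using 1 by (cases k) (simp_all add: flat_def algebra_simps)
    finally have "((\<lambda>r. inverse r ^ k * exp (- inverse r)) has_real_derivative
        flat (k + 2) r - of_nat k * flat (k + 1) r) (at r)" .
    then show ?thesis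
      by (rule has_field_derivative_transform_within_open[of _ _ _ "{0<..}"]) (use 1 in \<open>auto simp: flat_def\<close>)
  next
    case 2
    \<comment> \<open>Away from 0 the difference quotient at 0 is \<open>flat (k + 1)\<close>
      itself.\<close>
    have "((\<lambda>h. (flat k h - flat k 0) / (h - 0)) \<longlongrightarrow> 0) (at 0)"
      by (rule tendsto_cong[THEN iffD1, OF _ flat_tendsto_0[of "k + 1"]])
        (auto simp: flat_def eventually_at_filter field_simps)
    then show ?thesis using 2 by (simp add: has_field_derivative_iff flat_def)
  next
    case 3
    have "((\<lambda>r. 0) has_real_derivative flat (k + 2) r - of_nat k * flat (k + 1) r) (at r)"
      using 3 by (simp add: flat_def)
    then show ?thesis
      by (rule has_field_derivative_transform_within_open[of _ _ _ "{..<0}"]) (use 3 in \<open>auto simp: flat_def\<close>)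
  qed
qed

lemma C_k_on_flat: "C_k_on n (flat k) UNIV"
proof (induction n arbitrary: k)
  case 0
  show ?case using DERIV_continuous_on[OF has_field_derivative_at_within[OF has_derivative_flat]] by simp
next
  case (Suc n)
  have "C_k_on n (\<lambda>r. flat (k + 2) r - of_nat k * flat (k + 1) r) UNIV"
    using C_k_on_add[OF Suc.IH[of "k + 2"] C_k_on_bounded_linear[OF bounded_linear_mult_right _ Suc.IH,
          of "- of_nat k" "k + 1"]] by simp
  then show ?case
    using has_derivative_flat
    by (intro C_k_on_real_SucI) (auto simp: has_real_derivative_iff_has_vector_derivative[symmetric])
qed

text \<open>The centre is a critical point of \<open>q\<close>, whence the vanishing derivative.
  That clause later lets a cutoff multiply a field without changing its first derivatives at the
  point.\<close>

lemma bump_function: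
  fixes x0 :: "'x::euclidean_space" and r :: real
  assumes "r > 0"
  obtains \<phi> :: "'x \<Rightarrow> real" where "C_inf_on \<phi> UNIV" "\<phi> x0 = 1" "fder \<phi> x0 = (\<lambda>v. 0)"
    "\<And>x. x \<in> ball x0 r \<Longrightarrow> \<phi> x > 0" "\<And>x. x \<notin> ball x0 r \<Longrightarrow> \<phi> x = 0"
proof
  define q where "q = (\<lambda>x. r\<^sup>2 - (x - x0) \<bullet> (x - x0))"
  define \<phi> where "\<phi> = (\<lambda>x. flat 0 (q x) / flat 0 (r\<^sup>2))"
  have f: "C_inf_on (flat 0) UNIV" by (simp add: C_inf_on_def C_k_on_flat)
  have "C_inf_on q UNIV"
    unfolding q_def by (intro C_inf_on_diff C_inf_on_bilinear[OF bounded_bilinear_inner]) auto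
  from C_inf_on_bounded_linear[OF bounded_linear_mult_left C_inf_on_compose[OF f this]]
  show "C_inf_on \<phi> UNIV" unfolding \<phi>_def divide_inverse by simp
  have q0: "q x0 = r\<^sup>2" by (simp add: q_def)
  have "(q has_derivative (\<lambda>v. 0)) (at x0)"
    unfolding q_def by (auto intro!: derivative_eq_intros)
  from has_derivative_compose[OF this C_inf_on_has_derivative[OF f]]
  have "((\<lambda>x. flat 0 (q x)) has_derivative (\<lambda>v. fder (flat 0) (q x0) 0)) (at x0)" by simp
  moreover have "fder (flat 0) y 0 = 0" for y
    by (rule linear_0[OF linear_frechet_derivative[OF C_inf_on_differentiable[OF f]]]) simp
  ultimately have "((\<lambda>x. flat 0 (q x)) has_derivative (\<lambda>v. 0)) (at x0)" by simp
  from bounded_linear.has_derivative[OF bounded_linear_divide this]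
  have "(\<phi> has_derivative (\<lambda>v. 0)) (at x0)" by (simp add: \<phi>_def)
  then show "fder \<phi> x0 = (\<lambda>v. 0)" by (rule fder_eqI)
  have p: "flat 0 (r\<^sup>2) > 0" using assms by (simp add: flat_def)
  then show "\<phi> x0 = 1" by (simp add: \<phi>_def q0)
  have q: "q x > 0 \<longleftrightarrow> x \<in> ball x0 r" for x
  proof -
    have "q x = r\<^sup>2 - (norm (x - x0))\<^sup>2" by (simp add: q_def power2_norm_eq_inner)
    moreover have "(norm (x - x0))\<^sup>2 < r\<^sup>2 \<longleftrightarrow> norm (x - x0) < r"
      using assms by (meson less_imp_le norm_ge_zero power2_less_imp_less power_strict_mono zero_less_numeral)
    ultimately show ?thesis by (simp add: dist_norm norm_minus_commute)
  qed
  show "\<phi> x > 0" if "x \<in> ball x0 r" for x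
    using p q that by (simp add: \<phi>_def flat_def)
  show "\<phi> x = 0" if "x \<notin> ball x0 r" for x
    using q that by (simp add: \<phi>_def flat_def)
qed


section \<open>Local solutions of ordinary differential equations\<close>

text \<open>Compactness bounds the partial derivatives, and convexity of \<open>K\<close> allows the
  mean value inequality in the second variable.\<close>

lemma C_inf_on_Lipschitz_snd:
  fixes F :: "'a::euclidean_space \<times> 'b::euclidean_space \<Rightarrow> 'c::euclidean_space"
  assumes F: "C_inf_on F A" and K: "compact (I \<times> K)" "convex K" "I \<times> K \<subseteq> A"
  obtains L where "L \<ge> 0" "\<And>t y z. t \<in> I \<Longrightarrow> y \<in> K \<Longrightarrow> z \<in> K \<Longrightarrow> norm (F (t, y) - F (t, z)) \<le> L * norm (y - z)"
proof -
  have "\<exists>C. \<forall>p\<in>I \<times> K. norm (fder F p b) \<le> C" for b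
  proof -
    have "continuous_on (I \<times> K) (\<lambda>p. fder F p b)"
      by (rule continuous_on_subset[OF C_inf_on_continuous_on[OF C_inf_on_fder[OF F]] K(3)])
    then have "bounded ((\<lambda>p. fder F p b) ` (I \<times> K))"
      by (rule compact_imp_bounded[OF compact_continuous_image[OF _ K(1)]])
    then show ?thesis unfolding bounded_iff by blast
  qed
  then obtain C where C: "\<And>b p. p \<in> I \<times> K \<Longrightarrow> norm (fder F p b) \<le> C b" by metis
  \<comment> \<open>Every coordinate of \<open>(0, v)\<close> is at most the norm of
    \<open>v\<close>, so the bounds on the partial derivatives simply add up.\<close>
  define L where "L = (\<Sum>b\<in>Basis. \<bar>C b\<bar>)"
  show thesis
  proof
    show "L \<ge> 0" unfolding L_def by (rule sum_nonneg) simp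
    fix t y z assume t: "t \<in> I" and yz: "y \<in> K" "z \<in> K"
    have d: "((\<lambda>y. F (t, y)) has_derivative (\<lambda>v. fder F (t, x) (0, v))) (at x within K)" if "x \<in> K" for x
    proof (rule has_derivative_compose[of "\<lambda>y. (t, y)"])
      show "((\<lambda>y. (t, y)) has_derivative (\<lambda>v. (0, v))) (at x within K)"
        by (auto intro!: derivative_eq_intros)
      show "(F has_derivative fder F (t, x)) (at (t, x))"
        using C_inf_on_has_derivative[OF F] K t that by blast
    qed
    show "norm (F (t, y) - F (t, z)) \<le> L * norm (y - z)"
    proof (rule differentiable_bound[OF K(2) d _ yz])
      fix x assume x: "x \<in> K"
      show "onorm (\<lambda>v. fder F (t, x) (0, v)) \<le> L"
      proof (rule onorm_le)
        fix v
        have "norm (fder F (t, x) (0, v)) = norm (\<Sum>b\<in>Basis. ((0, v) \<bullet> b) *\<^sub>R fder F (t, x) b)"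
          using fder_Basis_sum[OF C_inf_on_differentiable[OF F], of "(t, x)" "(0, v)"] K t x by auto
        also have "\<dots> \<le> (\<Sum>b\<in>Basis. norm (((0, v) \<bullet> b) *\<^sub>R fder F (t, x) b))" by (rule norm_sum)
        also have "\<dots> \<le> (\<Sum>b\<in>Basis. norm v * \<bar>C b\<bar>)"
        proof (rule sum_mono)
          fix b :: "'a \<times> 'b" assume b: "b \<in> Basis"
          have "\<bar>(0, v) \<bullet> b\<bar> \<le> norm v" using Basis_le_norm[OF b, of "(0, v)"] by simp
          moreover have "norm (fder F (t, x) b) \<le> \<bar>C b\<bar>" using C[of "(t, x)" b] t x by force
          ultimately show "norm (((0, v) \<bullet> b) *\<^sub>R fder F (t, x) b) \<le> norm v * \<bar>C b\<bar>"
            by (simp add: mult_mono)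
        qed
        finally show "norm (fder F (t, x) (0, v)) \<le> L * norm v"
          by (simp add: L_def sum_distrib_left mult.commute)
      qed
    qed
  qed
qed

text \<open>Banach's fixed point theorem in the complete space of bounded continuous functions on
  the real line. Since \<open>G\<close> is bounded and Lipschitz in all of space, the integral
  operator maps the whole function space to itself.\<close>

lemma Picard_local_solution:
  fixes G :: "real \<Rightarrow> 'e::euclidean_space \<Rightarrow> 'e"
  assumes d: "\<delta> > 0" "4 * L * \<delta> < 1" "L \<ge> 0"
    and cont: "\<And>u. continuous_on UNIV u \<Longrightarrow> continuous_on {t0 - \<delta>..t0 + \<delta>} (\<lambda>s. G s (u s))"
    and lip: "\<And>s y z. s \<in> {t0 - \<delta>..t0 + \<delta>} \<Longrightarrow> norm (G s y - G s z) \<le> L * norm (y - z)"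
    and bound: "\<And>s y. s \<in> {t0 - \<delta>..t0 + \<delta>} \<Longrightarrow> norm (G s y) \<le> B"
  obtains u where "u t0 = y0"
    "\<And>t. t \<in> ball t0 \<delta> \<Longrightarrow> (u has_vector_derivative G t (u t)) (at t)"
    "\<And>t. t \<in> ball t0 \<delta> \<Longrightarrow> norm (u t - y0) \<le> 4 * \<delta> * B"
proof -
  define a where "a = t0 - \<delta>"
  define b where "b = t0 + \<delta>"
  have ab: "a \<le> b" "t0 \<in> {a..b}" "b - a = 2 * \<delta>" using d by (auto simp: a_def b_def)
  \<comment> \<open>Freezing time outside the interval makes the integral operator produce functions
    on the whole line, bounded and continuous there.\<close>
  define clip where "clip = (\<lambda>t. max a (min b t))"
  have clip: "clip t \<in> {a..b}" for t using ab by (auto simp: clip_def)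
  \<comment> \<open>The integral from \<open>t0\<close> to \<open>clip t\<close>, written as a
    difference of integrals from \<open>a\<close> so that it also makes sense for t < t0. Each of
    the two is bounded by 2 \<delta> C, which is the origin of the factor 4 in the
    hypotheses.\<close>
  define In where "In = (\<lambda>(f :: real \<Rightarrow> 'e) t. integral {a..clip t} f - integral {a..t0} f)"
  have In_bound: "norm (In f t) \<le> 4 * \<delta> * C"
    if f: "continuous_on {a..b} f" "\<And>s. s \<in> {a..b} \<Longrightarrow> norm (f s) \<le> C" for f C t
  proof -
    have "C \<ge> 0" using f(2)[OF ab(2)] norm_ge_zero order_trans by blast
    have *: "norm (integral {a..r} f) \<le> 2 * \<delta> * C" if r: "r \<in> {a..b}" for r
    proof -
      have "norm (integral {a..r} f) \<le> C * (r - a)"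
        by (rule integral_bound) (use r f continuous_on_subset[OF f(1)] in auto)
      also have "\<dots> \<le> C * (2 * \<delta>)" using r ab \<open>C \<ge> 0\<close> by (intro mult_left_mono) auto
      finally show ?thesis by (simp add: mult.commute)
    qed
    have "norm (In f t) \<le> norm (integral {a..clip t} f) + norm (integral {a..t0} f)"
      unfolding In_def by (rule norm_triangle_ineq4)
    then show ?thesis using *[OF clip[of t]] *[OF ab(2)] by simp
  qed
  have In_cont: "continuous_on UNIV (In f)" if "continuous_on {a..b} f" for f
  proof -
    have "continuous_on {a..b} (\<lambda>x. integral {a..x} f)"
      by (rule indefinite_integral_continuous_1[OF integrable_continuous_real[OF that]])
    moreover have "continuous_on UNIV clip" unfolding clip_def by (intro continuous_intros)
    ultimately have "continuous_on UNIV (\<lambda>t. integral {a..clip t} f)"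
      using continuous_on_compose2[of "{a..b}" _ UNIV clip] clip by blast
    then show ?thesis unfolding In_def by (intro continuous_intros)
  qed
  define P where "P = (\<lambda>(u :: real \<Rightarrow>\<^sub>C 'e) t. y0 + In (\<lambda>s. G s (apply_bcontfun u s)) t)"
  have Gc: "continuous_on {a..b} (\<lambda>s. G s (apply_bcontfun u s))" for u
    unfolding a_def b_def by (rule cont) simp
  have bd: "norm (In (\<lambda>s. G s (apply_bcontfun u s)) t) \<le> 4 * \<delta> * B" for u t
    by (rule In_bound[OF Gc]) (use bound in \<open>simp add: a_def b_def\<close>)
  have "P u \<in> bcontfun" for u
  proof (rule bcontfun_normI)
    show "continuous_on UNIV (P u)" unfolding P_def by (intro continuous_intros In_cont Gc)
    show "norm (P u t) \<le> norm y0 + 4 * \<delta> * B" for t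
      unfolding P_def using bd[of u t] norm_triangle_le[of y0] by simp
  qed
  then have apP: "apply_bcontfun (Bcontfun (P u)) = P u" for u by (simp add: Bcontfun_inverse)
  have "\<exists>!u. Bcontfun (P u) = u"
  proof (rule banach_fix_type)
    show "0 \<le> 4 * L * \<delta>" "4 * L * \<delta> < 1" using d by auto
    show "\<forall>u v. dist (Bcontfun (P u)) (Bcontfun (P v)) \<le> 4 * L * \<delta> * dist u v"
    proof (intro allI dist_bound)
      fix u v t
      define f where "f = (\<lambda>s. G s (apply_bcontfun u s) - G s (apply_bcontfun v s))"
      have int: "(\<lambda>s. G s (apply_bcontfun u s)) integrable_on {a..r}" if "r \<in> {a..b}" for u r
        by (rule integrable_continuous_real[OF continuous_on_subset[OF Gc]]) (use that in auto)
      have "P u t - P v t = In f t"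
        unfolding P_def In_def f_def using int[OF clip[of t]] int[OF ab(2)]
        by (simp add: integral_diff)
      moreover have "norm (In f t) \<le> 4 * \<delta> * (L * dist u v)"
      proof (rule In_bound)
        show "continuous_on {a..b} f" unfolding f_def by (intro continuous_intros Gc)
        fix s assume "s \<in> {a..b}"
        then have "norm (f s) \<le> L * norm (apply_bcontfun u s - apply_bcontfun v s)"
          unfolding f_def by (intro lip) (simp add: a_def b_def)
        also have "\<dots> \<le> L * dist u v"
          using dist_bounded[of u s v] d by (intro mult_left_mono) (simp_all add: dist_norm)
        finally show "norm (f s) \<le> L * dist u v" .
      qed
      ultimately show "dist (apply_bcontfun (Bcontfun (P u)) t) (apply_bcontfun (Bcontfun (P v)) t)
          \<le> 4 * L * \<delta> * dist u v"
        by (simp add: apP dist_norm mult_ac)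
    qed
  qed
  then obtain u where "Bcontfun (P u) = u" by blast
  then have u: "apply_bcontfun u t = P u t" for t using apP by metis
  show thesis
  proof
    show "apply_bcontfun u t0 = y0"
      unfolding u[of t0] P_def In_def using ab by (simp add: clip_def)
    show "norm (apply_bcontfun u t - y0) \<le> 4 * \<delta> * B" for t
      unfolding u[of t] P_def using bd[of u t] by simp
    fix t assume "t \<in> ball t0 \<delta>"
    then have t: "t \<in> {a<..<b}" by (auto simp: a_def b_def dist_real_def)
    have "((\<lambda>r. integral {a..r} (\<lambda>s. G s (apply_bcontfun u s))) has_vector_derivative G t (apply_bcontfun u t)) (at t within {a..b})"
      by (rule integral_has_vector_derivative[OF Gc]) (use t in auto)
    then have "((\<lambda>r. integral {a..r} (\<lambda>s. G s (apply_bcontfun u s))) has_vector_derivative G t (apply_bcontfun u t)) (at t)"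
      using at_within_Icc_at[of a t b] t by (metis greaterThanLessThan_iff)
    from has_vector_derivative_add[OF has_vector_derivative_const[of y0]
        has_vector_derivative_diff[OF this has_vector_derivative_const]]
    have "((\<lambda>r. y0 + (integral {a..r} (\<lambda>s. G s (apply_bcontfun u s)) - integral {a..t0} (\<lambda>s. G s (apply_bcontfun u s))))
        has_vector_derivative G t (apply_bcontfun u t)) (at t)"
      unfolding add_0_left diff_0_right .
    then show "(apply_bcontfun u has_vector_derivative G t (apply_bcontfun u t)) (at t)"
    proof (rule has_vector_derivative_transform_within_open[of _ _ _ "{a<..<b}"])
      show "y0 + (integral {a..x} (\<lambda>s. G s (apply_bcontfun u s)) - integral {a..t0} (\<lambda>s. G s (apply_bcontfun u s)))
          = apply_bcontfun u x" if "x \<in> {a<..<b}" for x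
        unfolding u[of x] P_def In_def using that by (simp add: clip_def)
    qed (use t in auto)
  qed
qed

proposition ode_local_solution:
  fixes F :: "real \<times> 'e::euclidean_space \<Rightarrow> 'e"
  assumes F: "C_inf_on F A" and A: "open A" "(t0, y0) \<in> A"
  obtains \<delta> y where "\<delta> > 0" "y t0 = y0" "C_inf_on y (ball t0 \<delta>)"
    "\<And>t. t \<in> ball t0 \<delta> \<Longrightarrow> (t, y t) \<in> A"
    "\<And>t. t \<in> ball t0 \<delta> \<Longrightarrow> (y has_vector_derivative F (t, y t)) (at t)"
proof -
  obtain U V where UV: "open U" "open V" "t0 \<in> U" "y0 \<in> V" "U \<times> V \<subseteq> A"
    using A open_prod_elim by (metis mem_Sigma_iff)
  obtain r1 where r1: "r1 > 0" "cball t0 r1 \<subseteq> U" using UV open_contains_cball by blast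
  obtain r2 where r2: "r2 > 0" "cball y0 r2 \<subseteq> V" using UV open_contains_cball by blast
  define K where "K = cball y0 r2"
  have K: "compact K" "convex K" "closed K" "K \<noteq> {}" using r2 by (auto simp: K_def)
  have IK: "cball t0 r1 \<times> K \<subseteq> A" using r1 r2 UV by (auto simp: K_def)
  have cIK: "compact (cball t0 r1 \<times> K)" by (simp add: K compact_Times)
  obtain L where L: "L \<ge> 0"
    "\<And>t y z. t \<in> cball t0 r1 \<Longrightarrow> y \<in> K \<Longrightarrow> z \<in> K \<Longrightarrow> norm (F (t, y) - F (t, z)) \<le> L * norm (y - z)"
    using C_inf_on_Lipschitz_snd[OF F cIK K(2) IK] by blast
  have cF: "continuous_on (cball t0 r1 \<times> K) F"
    by (rule continuous_on_subset[OF C_inf_on_continuous_on[OF F] IK])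
  obtain B where B: "B > 0" "\<And>p. p \<in> cball t0 r1 \<times> K \<Longrightarrow> norm (F p) \<le> B"
    using compact_imp_bounded[OF compact_continuous_image[OF cF cIK]] unfolding bounded_pos by blast
  \<comment> \<open>Three demands: time stays where the bounds on \<open>F\<close> hold, 4 L
    \<delta> < 1 makes the Picard operator a contraction, and 4 \<delta> B \<le> r2 keeps the
    solution in \<open>K\<close>. The \<open>L + 1\<close> covers the case L = 0.\<close>
  define \<delta> where "\<delta> = min r1 (min (1 / (8 * (L + 1))) (r2 / (8 * B)))"
  have \<delta>: "\<delta> > 0" "\<delta> \<le> r1" using r1 r2 B L by (auto simp: \<delta>_def)
  have "4 * L * \<delta> \<le> 4 * L * (1 / (8 * (L + 1)))"
    by (intro mult_left_mono) (use L in \<open>auto simp: \<delta>_def\<close>)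
  also have "\<dots> < 1" using L by (simp add: field_simps)
  finally have L\<delta>: "4 * L * \<delta> < 1" .
  have "4 * \<delta> * B \<le> 4 * (r2 / (8 * B)) * B"
    by (intro mult_right_mono mult_left_mono) (use B in \<open>auto simp: \<delta>_def\<close>)
  also have "\<dots> \<le> r2" using r2 B by simp
  finally have B\<delta>: "4 * \<delta> * B \<le> r2" .
  \<comment> \<open>Projecting onto \<open>K\<close> makes the right-hand side globally Lipschitz without changing it near \<open>y0\<close>.\<close>
  define G where "G = (\<lambda>s y. F (s, closest_point K y))"
  have I: "{t0 - \<delta>..t0 + \<delta>} \<subseteq> cball t0 r1" using \<delta> by (auto simp: dist_real_def)
  have cp: "closest_point K y \<in> K" for y using closest_point_in_set K by blast
  obtain y where y: "y t0 = y0"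
    "\<And>t. t \<in> ball t0 \<delta> \<Longrightarrow> (y has_vector_derivative G t (y t)) (at t)"
    "\<And>t. t \<in> ball t0 \<delta> \<Longrightarrow> norm (y t - y0) \<le> 4 * \<delta> * B"
  proof (rule Picard_local_solution[OF \<delta>(1) L\<delta> L(1)])
    show "continuous_on {t0 - \<delta>..t0 + \<delta>} (\<lambda>s. G s (u s))" if "continuous_on UNIV u" for u
    proof -
      have "continuous_on {t0 - \<delta>..t0 + \<delta>} (\<lambda>s. (s, closest_point K (u s)))"
        using continuous_on_compose2[OF continuous_on_closest_point[OF K(2,3,4), of UNIV] that]
        by (intro continuous_intros) (auto intro: continuous_on_subset)
      then show ?thesis unfolding G_def
        by (rule continuous_on_compose2[OF cF]) (use I cp in auto)
    qed
    show "norm (G s y - G s z) \<le> L * norm (y - z)" if "s \<in> {t0 - \<delta>..t0 + \<delta>}" for s y z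
    proof -
      have "norm (G s y - G s z) \<le> L * norm (closest_point K y - closest_point K z)"
        unfolding G_def by (rule L(2)) (use that I cp in auto)
      also have "\<dots> \<le> L * norm (y - z)"
        using closest_point_lipschitz[OF K(2,3,4), of y z] L(1)
        by (intro mult_left_mono) (simp_all add: dist_norm)
      finally show ?thesis .
    qed
    show "norm (G s y) \<le> B" if "s \<in> {t0 - \<delta>..t0 + \<delta>}" for s y
      unfolding G_def by (rule B(2)) (use that I cp in auto)
  qed blast
  have yK: "y t \<in> K" if "t \<in> ball t0 \<delta>" for t
    using y(3)[OF that] B\<delta> by (simp add: K_def dist_norm norm_minus_commute)
  have tI: "t \<in> cball t0 r1" if "t \<in> ball t0 \<delta>" for t using that \<delta> by auto
  have yd: "(y has_vector_derivative F (t, y t)) (at t)" if "t \<in> ball t0 \<delta>" for t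
    using y(2)[OF that] closest_point_self[OF yK[OF that]] by (simp add: G_def)
  have yA: "(t, y t) \<in> A" if "t \<in> ball t0 \<delta>" for t using yK tI IK that by blast
  \<comment> \<open>Bootstrapping: the derivative F(t, y) is as smooth as y, so y gains one order in
    each step.\<close>
  have "C_k_on k y (ball t0 \<delta>)" for k
  proof (induction k)
    case 0
    show ?case
      using has_vector_derivative_continuous[OF yd] by (auto intro!: continuous_at_imp_continuous_on)
  next
    case (Suc k)
    have "C_k_on k (\<lambda>t. F (t, y t)) (ball t0 \<delta>)"
    proof (rule C_k_on_compose[OF _ A(1)])
      show "C_k_on k F A" using F by (simp add: C_inf_on_def)
      show "C_k_on k (\<lambda>t. (t, y t)) (ball t0 \<delta>)"
        by (intro C_k_on_Pair Suc C_k_on_linear bounded_linear_ident) simp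
    qed (use yA in auto)
    then show ?case by (intro C_k_on_real_SucI[OF yd]) auto
  qed
  then show thesis using that[OF \<delta>(1) y(1) _ yA yd] by (simp add: C_inf_on_def)
qed

section \<open>Charts, tangent vectors and vector fields\<close>

lemma sum_fun_apply: "(\<Sum>k\<in>A. f k) x = (\<Sum>k\<in>A. f k x)"
  by (induction A rule: infinite_finite_induct) auto

text \<open>Only the chart axioms are collected here, so that the same locale can be instantiated
  both with the manifold and with its slit tangent bundle.\<close>

locale atlas =
  fixes M :: "('a, 'i, 'e::euclidean_space) mfd"
  assumes pts_eq: "(\<Union>i\<in>idx M. dom M i) = pts M"
    and inj: "i \<in> idx M \<Longrightarrow> inj_on (crd M i) (dom M i)"
    and open_overlap: "i \<in> idx M \<Longrightarrow> j \<in> idx M \<Longrightarrow> open (crd M i ` (dom M i \<inter> dom M j))"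
    and smooth_transition: "i \<in> idx M \<Longrightarrow> j \<in> idx M \<Longrightarrow>
      smooth_on (crd M i ` (dom M i \<inter> dom M j)) (transition M i j)"
begin

abbreviation img :: "'i \<Rightarrow> 'e set" where "img i \<equiv> crd M i ` dom M i"

lemma crd_inv_crd [simp]: "i \<in> idx M \<Longrightarrow> p \<in> dom M i \<Longrightarrow> crd_inv M i (crd M i p) = p"
  by (simp add: crd_inv_def inj)

lemma crd_crd_inv [simp]: "x \<in> img i \<Longrightarrow> crd M i (crd_inv M i x) = x"
  by (simp add: crd_inv_def f_inv_into_f)

lemma crd_inv_dom [simp]: "x \<in> img i \<Longrightarrow> crd_inv M i x \<in> dom M i"
  by (simp add: crd_inv_def inv_into_into)

lemma open_img [simp]: "i \<in> idx M \<Longrightarrow> open (img i)"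
  using open_overlap[of i i] by simp

lemma dom_pts: "i \<in> idx M \<Longrightarrow> p \<in> dom M i \<Longrightarrow> p \<in> pts M"
  using pts_eq by blast

lemma ptsE:
  assumes "p \<in> pts M" obtains i where "i \<in> idx M" "p \<in> dom M i"
  using assms pts_eq by blast

lemma some_chart: "p \<in> pts M \<Longrightarrow> some_chart M p \<in> idx M \<and> p \<in> dom M (some_chart M p)"
  unfolding some_chart_def by (rule someI_ex) (use ptsE in blast)

lemma overlap_iff:
  "i \<in> idx M \<Longrightarrow> x \<in> crd M i ` (dom M i \<inter> dom M j) \<longleftrightarrow> x \<in> img i \<and> crd_inv M i x \<in> dom M j"
  by (auto simp: image_iff)

lemma crd_mem_overlap [simp]: "i \<in> idx M \<Longrightarrow> p \<in> dom M i \<Longrightarrow> p \<in> dom M j \<Longrightarrow>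
    crd M i p \<in> crd M i ` (dom M i \<inter> dom M j)"
  by blast

lemma transition_C_inf:
  "i \<in> idx M \<Longrightarrow> j \<in> idx M \<Longrightarrow> C_inf_on (transition M i j) (crd M i ` (dom M i \<inter> dom M j))"
  using smooth_transition smooth_on_open_iff open_overlap by blast

lemma transition_crd [simp]: "i \<in> idx M \<Longrightarrow> p \<in> dom M i \<Longrightarrow> transition M i j (crd M i p) = crd M j p"
  by (simp add: transition_def)

lemma transition_has_derivative:
  "i \<in> idx M \<Longrightarrow> j \<in> idx M \<Longrightarrow> p \<in> dom M i \<Longrightarrow> p \<in> dom M j \<Longrightarrow>
    (transition M i j has_derivative fder (transition M i j) (crd M i p)) (at (crd M i p))"
  by (rule C_inf_on_has_derivative[OF transition_C_inf]) auto

lemma linear_transition: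
  "i \<in> idx M \<Longrightarrow> j \<in> idx M \<Longrightarrow> p \<in> dom M i \<Longrightarrow> p \<in> dom M j \<Longrightarrow>
    linear (fder (transition M i j) (crd M i p))"
  using transition_has_derivative has_derivative_linear by blast

text \<open>Chain rule on the triple overlap. This cocycle identity is what makes
  \<open>tvec\<close> below a tangent vector.\<close>

lemma fder_transition_compose:
  assumes ijk: "i \<in> idx M" "j \<in> idx M" "k \<in> idx M" and p: "p \<in> dom M i" "p \<in> dom M j" "p \<in> dom M k"
  shows "fder (transition M j k) (crd M j p) (fder (transition M i j) (crd M i p) v)
    = fder (transition M i k) (crd M i p) v"
proof -
  let ?U = "crd M i ` (dom M i \<inter> dom M j) \<inter> crd M i ` (dom M i \<inter> dom M k)"
  have "((\<lambda>x. transition M j k (transition M i j x)) has_derivative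
     (\<lambda>v. fder (transition M j k) (transition M i j (crd M i p)) (fder (transition M i j) (crd M i p) v))) (at (crd M i p))"
    by (rule has_derivative_compose[OF transition_has_derivative])
      (use assms transition_has_derivative[of j k p] in simp_all)
  then have "(transition M i k has_derivative
     (\<lambda>v. fder (transition M j k) (transition M i j (crd M i p)) (fder (transition M i j) (crd M i p) v))) (at (crd M i p))"
  proof (rule has_derivative_transform_within_open[of _ _ _ _ ?U])
    show "open ?U" using ijk open_overlap by blast
    show "transition M j k (transition M i j x) = transition M i k x" if "x \<in> ?U" for x
    proof -
      have "x \<in> img i" "crd_inv M i x \<in> dom M j" "crd_inv M i x \<in> dom M k"
        using that overlap_iff[OF ijk(1)] by blast+
      then show ?thesis
        using transition_crd[of j "crd_inv M i x" k] ijk by (auto simp: transition_def)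
    qed
  qed (use assms in auto)
  from fder_eqI[OF this] show ?thesis using assms by simp
qed

lemma fder_transition_self [simp]:
  assumes "i \<in> idx M" "p \<in> dom M i"
  shows "fder (transition M i i) (crd M i p) v = v"
proof -
  have "((\<lambda>x. x) has_derivative (\<lambda>x. x)) (at (crd M i p))" by simp
  then have "(transition M i i has_derivative (\<lambda>x. x)) (at (crd M i p))"
    by (rule has_derivative_transform_within_open[of _ _ _ _ "img i"]) (use assms in \<open>auto simp: transition_def\<close>)
  from fder_eqI[OF this] show ?thesis by simp
qed

text \<open>Inverse of the evaluation of tangent vectors at the chart \<open>i\<close>. Evaluation
  is thus an isomorphism of the tangent space at \<open>p\<close> onto the model space, and
  identities between tangent vectors can be checked in a single chart
  (\<open>tangent_eqI\<close>).\<close>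

definition tvec :: "'i \<Rightarrow> 'a \<Rightarrow> 'e \<Rightarrow> 'i \<Rightarrow> 'e"
  where "tvec i p v = (\<lambda>j. if j \<in> idx M \<and> p \<in> dom M j then fder (transition M i j) (crd M i p) v else 0)"

lemma tvec_self [simp]: "i \<in> idx M \<Longrightarrow> p \<in> dom M i \<Longrightarrow> tvec i p v i = v"
  by (simp add: tvec_def)

lemma tvec_tangent [simp]: "i \<in> idx M \<Longrightarrow> p \<in> dom M i \<Longrightarrow> tvec i p v \<in> tangent_space M p"
  by (simp add: tvec_def tangent_space_def fder_transition_compose)

lemma tangent_transform:
  "v \<in> tangent_space M p \<Longrightarrow> i \<in> idx M \<Longrightarrow> j \<in> idx M \<Longrightarrow> p \<in> dom M i \<Longrightarrow> p \<in> dom M j \<Longrightarrow>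
    v j = fder (transition M i j) (crd M i p) (v i)"
  unfolding tangent_space_def by blast

lemma tangent_outside: "v \<in> tangent_space M p \<Longrightarrow> \<not> (i \<in> idx M \<and> p \<in> dom M i) \<Longrightarrow> v i = 0"
  unfolding tangent_space_def by blast

lemma tangent_spaceI:
  assumes "\<And>i j. i \<in> idx M \<Longrightarrow> j \<in> idx M \<Longrightarrow> p \<in> dom M i \<Longrightarrow> p \<in> dom M j \<Longrightarrow>
      v j = fder (transition M i j) (crd M i p) (v i)"
    and "\<And>i. \<not> (i \<in> idx M \<and> p \<in> dom M i) \<Longrightarrow> v i = 0"
  shows "v \<in> tangent_space M p"
  unfolding tangent_space_def using assms by blast

lemma tvec_eq:
  assumes "v \<in> tangent_space M p" "i \<in> idx M" "p \<in> dom M i"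
  shows "tvec i p (v i) = v"
proof
  fix j show "tvec i p (v i) j = v j"
    using tangent_transform[OF assms(1,2) _ assms(3), of j] tangent_outside[OF assms(1), of j]
    by (simp add: tvec_def)
qed

lemma tangent_eqI:
  "u \<in> tangent_space M p \<Longrightarrow> v \<in> tangent_space M p \<Longrightarrow> i \<in> idx M \<Longrightarrow> p \<in> dom M i \<Longrightarrow> u i = v i \<Longrightarrow> u = v"
  using tvec_eq by metis

lemma tangent_0 [simp]: "0 \<in> tangent_space M p"
  by (rule tangent_spaceI) (simp_all add: linear_0[OF linear_transition])

lemma tangent_add [simp]:
  assumes "u \<in> tangent_space M p" "v \<in> tangent_space M p"
  shows "u + v \<in> tangent_space M p"
proof (rule tangent_spaceI)
  show "(u + v) j = fder (transition M i j) (crd M i p) ((u + v) i)"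
    if "i \<in> idx M" "j \<in> idx M" "p \<in> dom M i" "p \<in> dom M j" for i j
    unfolding plus_fun_apply linear_add[OF linear_transition[OF that]]
    using tangent_transform[OF assms(1) that] tangent_transform[OF assms(2) that] by metis
qed (simp add: tangent_outside[OF assms(1)] tangent_outside[OF assms(2)])

lemma tangent_scaleR [simp]:
  assumes "u \<in> tangent_space M p"
  shows "r *\<^sub>R u \<in> tangent_space M p"
proof (rule tangent_spaceI)
  show "(r *\<^sub>R u) j = fder (transition M i j) (crd M i p) ((r *\<^sub>R u) i)"
    if "i \<in> idx M" "j \<in> idx M" "p \<in> dom M i" "p \<in> dom M j" for i j
    unfolding scaleR_fun_def linear_cmul[OF linear_transition[OF that]]
    using tangent_transform[OF assms(1) that] by metis
qed (simp add: tangent_outside[OF assms(1)] scaleR_fun_def)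

lemma tangent_uminus [simp]: "u \<in> tangent_space M p \<Longrightarrow> - u \<in> tangent_space M p"
  using tangent_scaleR[of u p "-1"] by simp

lemma tangent_diff [simp]:
  "u \<in> tangent_space M p \<Longrightarrow> v \<in> tangent_space M p \<Longrightarrow> u - v \<in> tangent_space M p"
  using tangent_add[of u p "- v"] by simp

lemma tangent_sum:
  "(\<And>k. k \<in> A \<Longrightarrow> f k \<in> tangent_space M p) \<Longrightarrow> (\<Sum>k\<in>A. f k) \<in> tangent_space M p"
  by (induction A rule: infinite_finite_induct) (auto simp del: zero_fun_def plus_fun_def)

lemma tangent_nonzero_iff:
  "v \<in> tangent_space M p \<Longrightarrow> i \<in> idx M \<Longrightarrow> p \<in> dom M i \<Longrightarrow> v = 0 \<longleftrightarrow> v i = 0"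
  using tangent_eqI[of v p 0 i] by auto

lemma field_tangent: "X \<in> vector_fields M \<Longrightarrow> X p \<in> tangent_space M p"
  by (cases "p \<in> pts M") (auto simp: vector_fields_def)

lemma field_outside: "X \<in> vector_fields M \<Longrightarrow> p \<notin> pts M \<Longrightarrow> X p = 0"
  by (simp add: vector_fields_def)

lemma field_rep_C_inf: "X \<in> vector_fields M \<Longrightarrow> i \<in> idx M \<Longrightarrow> C_inf_on (field_rep M i X) (img i)"
  by (simp add: vector_fields_def smooth_on_open_iff)

lemma field_rep_crd [simp]: "i \<in> idx M \<Longrightarrow> p \<in> dom M i \<Longrightarrow> field_rep M i X (crd M i p) = X p i"
  by (simp add: field_rep_def)

lemma field_rep_transition:
  assumes "\<And>p. X p \<in> tangent_space M p" "i \<in> idx M" "j \<in> idx M"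
    "x \<in> crd M i ` (dom M i \<inter> dom M j)"
  shows "field_rep M j X (transition M i j x) = fder (transition M i j) x (field_rep M i X x)"
proof -
  obtain p where p: "x = crd M i p" "p \<in> dom M i" "p \<in> dom M j" using assms(4) by blast
  show ?thesis using tangent_transform[OF assms(1,2,3) p(2,3)] assms p by simp
qed

text \<open>Passes from a neighbourhood in chart \<open>i\<close> to one in chart \<open>j\<close>,
  so small that the chart change is defined on it and maps it into \<open>U\<close>. It feeds the
  two lemmas that allow smoothness to be checked in one chart around each point.\<close>

lemma chart_change_C_inf:
  assumes ij: "i \<in> idx M" "j \<in> idx M" and p: "p \<in> dom M i" "p \<in> dom M j" and U: "open U" "crd M i p \<in> U"
  obtains V where "open V" "crd M j p \<in> V" "V \<subseteq> crd M j ` (dom M j \<inter> dom M i)"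
    "C_inf_on (transition M j i) V" "transition M j i ` V \<subseteq> U"
proof
  let ?O = "crd M j ` (dom M j \<inter> dom M i)"
  let ?V = "?O \<inter> transition M j i -` U"
  have c: "C_inf_on (transition M j i) ?O" using transition_C_inf ij by blast
  show "open ?V"
    using C_inf_on_continuous_on[OF c] open_overlap[OF ij(2,1)] U(1)
    by (simp add: Int_commute continuous_on_open_vimage)
  show "crd M j p \<in> ?V" using assms by auto
  show "C_inf_on (transition M j i) ?V" by (rule C_inf_on_subset[OF c]) auto
qed auto

text \<open>In any other chart the representative is the derivative of the chart change applied to
  the given one, hence smooth as well. One convenient chart around each point is therefore
  enough.\<close>

lemma vector_fieldsI:
  assumes tan: "\<And>p. X p \<in> tangent_space M p" and out: "\<And>p. p \<notin> pts M \<Longrightarrow> X p = 0"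
    and loc: "\<And>p. p \<in> pts M \<Longrightarrow> \<exists>i\<in>idx M. \<exists>U. p \<in> dom M i \<and> open U \<and> crd M i p \<in> U \<and> C_inf_on (field_rep M i X) U"
  shows "X \<in> vector_fields M"
proof -
  have "C_inf_on (field_rep M j X) (img j)" if j: "j \<in> idx M" for j
  proof (rule C_inf_on_local)
    fix y assume "y \<in> img j"
    then obtain p where p: "p \<in> dom M j" "y = crd M j p" by blast
    then obtain i U where i: "i \<in> idx M" "p \<in> dom M i" and U: "open U" "crd M i p \<in> U" "C_inf_on (field_rep M i X) U"
      using loc dom_pts j by blast
    obtain V where V: "open V" "crd M j p \<in> V" "V \<subseteq> crd M j ` (dom M j \<inter> dom M i)"
      "C_inf_on (transition M j i) V" "transition M j i ` V \<subseteq> U"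
      using chart_change_C_inf[OF i(1) j i(2) p(1) U(1,2)] by blast
    have "C_inf_on (field_rep M j X) V"
    proof (rule C_inf_on_cong)
      show "C_inf_on (\<lambda>y. fder (transition M i j) (transition M j i y) (field_rep M i X (transition M j i y))) V"
      proof (rule C_inf_on_fder_apply[OF transition_C_inf[OF i(1) j] V(4) _ V(1) open_overlap[OF i(1) j]])
        show "C_inf_on (\<lambda>y. field_rep M i X (transition M j i y)) V"
          by (rule C_inf_on_compose[OF U(3) V(4,1) U(1) V(5)])
        show "transition M j i ` V \<subseteq> crd M i ` (dom M i \<inter> dom M j)"
          using V(3) i j by force
      qed
      fix z assume "z \<in> V"
      then obtain q where q: "z = crd M j q" "q \<in> dom M j" "q \<in> dom M i" using V by blast
      then show "fder (transition M i j) (transition M j i z) (field_rep M i X (transition M j i z)) = field_rep M j X z"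
        using tangent_transform[OF tan i(1) j q(3,2)] i j by simp
    qed (rule V)
    then show "\<exists>U. open U \<and> y \<in> U \<and> C_inf_on (field_rep M j X) U" using V p by blast
  qed
  then show ?thesis using tan out by (simp add: vector_fields_def smooth_on_open_iff)
qed

lemma smooth_funI:
  assumes loc: "\<And>p. p \<in> pts M \<Longrightarrow> \<exists>i\<in>idx M. \<exists>U. p \<in> dom M i \<and> open U \<and> crd M i p \<in> U \<and> C_inf_on (f \<circ> crd_inv M i) U"
  shows "smooth_fun M f"
proof -
  have "C_inf_on (f \<circ> crd_inv M j) (img j)" if j: "j \<in> idx M" for j
  proof (rule C_inf_on_local)
    fix y assume "y \<in> img j"
    then obtain p where p: "p \<in> dom M j" "y = crd M j p" by blast
    then obtain i U where i: "i \<in> idx M" "p \<in> dom M i" and U: "open U" "crd M i p \<in> U" "C_inf_on (f \<circ> crd_inv M i) U"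
      using loc dom_pts j by blast
    obtain V where V: "open V" "crd M j p \<in> V" "V \<subseteq> crd M j ` (dom M j \<inter> dom M i)"
      "C_inf_on (transition M j i) V" "transition M j i ` V \<subseteq> U"
      using chart_change_C_inf[OF i(1) j i(2) p(1) U(1,2)] by blast
    have "C_inf_on (f \<circ> crd_inv M j) V"
    proof (rule C_inf_on_cong)
      show "C_inf_on (\<lambda>y. (f \<circ> crd_inv M i) (transition M j i y)) V"
        by (rule C_inf_on_compose[OF U(3) V(4,1) U(1) V(5)])
      show "(f \<circ> crd_inv M i) (transition M j i z) = (f \<circ> crd_inv M j) z" if "z \<in> V" for z
        using that V(3) i j by auto
    qed (rule V)
    then show "\<exists>U. open U \<and> y \<in> U \<and> C_inf_on (f \<circ> crd_inv M j) U" using V p by blast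
  qed
  then show ?thesis by (simp add: smooth_fun_def smooth_on_open_iff)
qed

lemma smooth_fun_C_inf: "smooth_fun M f \<Longrightarrow> i \<in> idx M \<Longrightarrow> C_inf_on (f \<circ> crd_inv M i) (img i)"
  by (simp add: smooth_fun_def smooth_on_open_iff)

text \<open>\<open>dir_deriv\<close> is computed in an arbitrarily chosen chart; the chain rule,
  together with the transformation law of tangent vectors, shows that any chart gives the same
  value.\<close>

lemma dir_deriv_chart:
  assumes f: "smooth_fun M f" and v: "v \<in> tangent_space M p" and i: "i \<in> idx M" "p \<in> dom M i"
  shows "dir_deriv M p v f = fder (f \<circ> crd_inv M i) (crd M i p) (v i)"
proof -
  define j where "j = some_chart M p"
  have j: "j \<in> idx M" "p \<in> dom M j" using some_chart dom_pts[OF i] by (auto simp: j_def)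
  have "((\<lambda>x. (f \<circ> crd_inv M j) (transition M i j x)) has_derivative
     (\<lambda>h. fder (f \<circ> crd_inv M j) (crd M j p) (fder (transition M i j) (crd M i p) h))) (at (crd M i p))"
    by (rule has_derivative_compose[OF transition_has_derivative[OF i(1) j(1) i(2) j(2)]])
      (unfold transition_crd[OF i], rule C_inf_on_has_derivative[OF smooth_fun_C_inf[OF f j(1)]], use j in blast)
  then have "((f \<circ> crd_inv M i) has_derivative
     (\<lambda>h. fder (f \<circ> crd_inv M j) (crd M j p) (fder (transition M i j) (crd M i p) h))) (at (crd M i p))"
    by (rule has_derivative_transform_within_open[of _ _ _ _ "crd M i ` (dom M i \<inter> dom M j)"])
      (use i j open_overlap in auto)
  from fder_eqI[OF this] show ?thesis
    unfolding dir_deriv_def Let_def j_def[symmetric] using tangent_transform[OF v i(1) j(1) i(2) j(2)] by simp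
qed

subsection \<open>Lie brackets\<close>

lemma lie_bracket_chart: "i \<in> idx M \<Longrightarrow> p \<in> dom M i \<Longrightarrow>
    lie_bracket M X Y p i = fder (field_rep M i Y) (crd M i p) (X p i) - fder (field_rep M i X) (crd M i p) (Y p i)"
  by (simp add: lie_bracket_def)

text \<open>Differentiating the transformation law of a field along the other one
  (\<open>key\<close>) produces a second derivative of the chart change. It occurs once in each half
  of the bracket, with the two fields interchanged, and cancels by symmetry.\<close>

lemma lie_bracket_tangent:
  assumes X: "X \<in> vector_fields M" and Y: "Y \<in> vector_fields M"
  shows "lie_bracket M X Y p \<in> tangent_space M p"
proof -
  have "lie_bracket M X Y p j = fder (transition M i j) (crd M i p) (lie_bracket M X Y p i)"
    if ij: "i \<in> idx M" "j \<in> idx M" "p \<in> dom M i" "p \<in> dom M j" for i j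
  proof -
    let ?O = "crd M i ` (dom M i \<inter> dom M j)"
    let ?t = "transition M i j"
    let ?x = "crd M i p"
    have t: "C_inf_on ?t ?O" and O: "open ?O" "?x \<in> ?O" using transition_C_inf open_overlap ij by auto
    have key: "fder (field_rep M j Z) (crd M j p) (fder ?t ?x v)
        = fder (\<lambda>y. fder ?t y (Z p i)) ?x v + fder ?t ?x (fder (field_rep M i Z) ?x v)"
      if Z: "Z \<in> vector_fields M" for Z v
    proof -
      have "((\<lambda>x. field_rep M j Z (?t x)) has_derivative (\<lambda>v. fder (field_rep M j Z) (?t ?x) (fder ?t ?x v))) (at ?x)"
        by (rule has_derivative_compose[OF transition_has_derivative[OF ij]])
          (use C_inf_on_has_derivative[OF field_rep_C_inf[OF Z ij(2)]] ij in simp)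
      then have "((\<lambda>x. fder ?t x (field_rep M i Z x)) has_derivative (\<lambda>v. fder (field_rep M j Z) (?t ?x) (fder ?t ?x v))) (at ?x)"
        by (rule has_derivative_transform_within_open[OF _ O])
          (use field_rep_transition[OF field_tangent[OF Z] ij(1,2)] in simp)
      moreover have "((\<lambda>x. fder ?t x (field_rep M i Z x)) has_derivative
          (\<lambda>v. fder (\<lambda>y. fder ?t y (field_rep M i Z ?x)) ?x v + fder ?t ?x (fder (field_rep M i Z) ?x v))) (at ?x)"
        by (rule has_derivative_fder_apply[OF t O(1)])
          (use O C_inf_on_has_derivative[OF field_rep_C_inf[OF Z ij(1)]] ij in simp_all)
      ultimately have "fder (field_rep M j Z) (?t ?x) (fder ?t ?x v)
          = fder (\<lambda>y. fder ?t y (field_rep M i Z ?x)) ?x v + fder ?t ?x (fder (field_rep M i Z) ?x v)"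
        by (rule fun_cong[OF has_derivative_unique])
      then show ?thesis unfolding transition_crd[OF ij(1,3)] field_rep_crd[OF ij(1,3)] .
    qed
    have tr: "Z p j = fder ?t ?x (Z p i)" if "Z \<in> vector_fields M" for Z
      by (rule tangent_transform[OF field_tangent[OF that] ij])
    have "fder (\<lambda>y. fder ?t y (Y p i)) ?x (X p i) = fder (\<lambda>y. fder ?t y (X p i)) ?x (Y p i)"
      by (rule second_derivative_symmetric[OF t O])
    then show ?thesis
      using ij key[OF X, of "Y p i"] key[OF Y, of "X p i"] tr[OF X] tr[OF Y]
      by (simp add: lie_bracket_chart linear_diff[OF linear_transition[OF ij]])
  qed
  then show ?thesis by (rule tangent_spaceI) (auto simp: lie_bracket_def)
qed

lemma lie_bracket_field:
  assumes X: "X \<in> vector_fields M" and Y: "Y \<in> vector_fields M"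
  shows "lie_bracket M X Y \<in> vector_fields M"
proof (rule vector_fieldsI[OF lie_bracket_tangent[OF X Y]])
  show "lie_bracket M X Y p = 0" if "p \<notin> pts M" for p
    using that dom_pts by (auto simp: lie_bracket_def fun_eq_iff)
  fix p assume "p \<in> pts M"
  then obtain i where i: "i \<in> idx M" "p \<in> dom M i" by (rule ptsE)
  have "C_inf_on (field_rep M i (lie_bracket M X Y)) (img i)"
  proof (rule C_inf_on_cong)
    have *: "C_inf_on (\<lambda>x. fder (field_rep M i Y) x (field_rep M i X x)) (img i)"
      if "X \<in> vector_fields M" "Y \<in> vector_fields M" for X Y
      by (rule C_inf_on_fder_apply[OF field_rep_C_inf[OF that(2) i(1)] C_inf_on_ident field_rep_C_inf[OF that(1) i(1)]])
        (use i in auto)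
    show "C_inf_on (\<lambda>x. fder (field_rep M i Y) x (field_rep M i X x) - fder (field_rep M i X) x (field_rep M i Y x)) (img i)"
      by (intro C_inf_on_diff * X Y open_img i)
  qed (use i in \<open>auto simp: lie_bracket_chart\<close>)
  then show "\<exists>i\<in>idx M. \<exists>U. p \<in> dom M i \<and> open U \<and> crd M i p \<in> U \<and> C_inf_on (field_rep M i (lie_bracket M X Y)) U"
    using i open_img by blast
qed

subsection \<open>Smooth maps into the manifold\<close>

text \<open>\<open>S\<close> need not be open: \<open>g\<close> is an extension of the chart
  expression across possible boundary points, and ordinary derivatives of \<open>g\<close> replace
  one-sided ones.\<close>

lemma smooth_intoD:
  assumes "smooth_into M S F" "x \<in> S" "i \<in> idx M" "F x \<in> dom M i"
  obtains A g where "open A" "x \<in> A" "C_inf_on g A" "\<And>y. y \<in> S \<inter> A \<Longrightarrow> F y \<in> dom M i \<and> crd M i (F y) = g y"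
proof -
  have "\<forall>x\<in>S. \<forall>i\<in>idx M. F x \<in> dom M i \<longrightarrow>
      (\<exists>A. open A \<and> x \<in> A \<and> F ` (S \<inter> A) \<subseteq> dom M i \<and> smooth_on (S \<inter> A) (crd M i \<circ> F))"
    using assms(1) unfolding smooth_into_def by (rule conjunct2)
  then obtain A where A: "open A" "x \<in> A" "F ` (S \<inter> A) \<subseteq> dom M i" "smooth_on (S \<inter> A) (crd M i \<circ> F)"
    using assms(2-4) by metis
  obtain B g where B: "open B" "x \<in> B" "\<forall>k. C_k_on k g B" "\<forall>y\<in>S \<inter> A \<inter> B. (crd M i \<circ> F) y = g y"
    using bspec[OF A(4)[unfolded smooth_on_def], of x] A(2) assms(2) by auto
  show thesis
    by (rule that[of "A \<inter> B" g]) (use A B in \<open>auto simp: C_inf_on_def intro: C_k_on_subset\<close>)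
qed

text \<open>One chart around each image point suffices: in another chart, compose the local
  extension with the chart change on the preimage of the overlap.\<close>

lemma smooth_intoI:
  assumes loc: "\<And>x. x \<in> S \<Longrightarrow> \<exists>i\<in>idx M. \<exists>A g. open A \<and> x \<in> A \<and> C_inf_on g A \<and>
     (\<forall>y\<in>S \<inter> A. F y \<in> dom M i \<and> crd M i (F y) = g y)"
  shows "smooth_into M S F"
proof -
  have "F x \<in> pts M" if "x \<in> S" for x using loc[OF that] that dom_pts by blast
  moreover have "\<exists>B. open B \<and> x \<in> B \<and> F ` (S \<inter> B) \<subseteq> dom M j \<and> smooth_on (S \<inter> B) (crd M j \<circ> F)"
    if x: "x \<in> S" and j: "j \<in> idx M" "F x \<in> dom M j" for x j
  proof -
    obtain i A g where i: "i \<in> idx M" and A: "open A" "x \<in> A" and g: "C_inf_on g A"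
      and Fg: "\<And>y. y \<in> S \<inter> A \<Longrightarrow> F y \<in> dom M i \<and> crd M i (F y) = g y"
      using loc[OF x] by blast
    let ?O = "crd M i ` (dom M i \<inter> dom M j)"
    define B where "B = A \<inter> g -` ?O"
    have B: "open B" "B \<subseteq> A" "g ` B \<subseteq> ?O"
      using C_inf_on_continuous_on[OF g] A open_overlap[OF i j(1)]
      by (auto simp: B_def Int_commute continuous_on_open_vimage)
    have xB: "x \<in> B" using A x Fg[of x] i j by (force simp: B_def)
    have FB: "F y \<in> dom M j \<and> crd M j (F y) = transition M i j (g y)" if "y \<in> S \<inter> B" for y
    proof -
      have y: "F y \<in> dom M i" "crd M i (F y) = g y" using Fg that B by auto
      then have "crd M i (F y) \<in> ?O" using that B by auto
      then show ?thesis using y i by (metis crd_inv_crd overlap_iff transition_crd)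
    qed
    have "C_inf_on (\<lambda>y. transition M i j (g y)) B"
      by (rule C_inf_on_compose[OF transition_C_inf[OF i j(1)] C_inf_on_subset[OF g B(2)] B(1) open_overlap[OF i j(1)] B(3)])
    then have "smooth_on (S \<inter> B) (crd M j \<circ> F)"
      unfolding smooth_on_def C_inf_on_def using B(1) FB by fastforce
    then show ?thesis using B(1) xB FB by blast
  qed
  ultimately show ?thesis by (auto simp: smooth_into_def)
qed

lemma velocity_chart:
  assumes c: "smooth_into M J c" and t: "t \<in> J" "at t within J \<noteq> bot" and i: "i \<in> idx M" "c t \<in> dom M i"
  shows "((\<lambda>t. crd M i (c t)) has_vector_derivative velocity M J c t i) (at t within J)"
proof -
  obtain A g where A: "open A" "t \<in> A" "C_inf_on g A" "\<And>y. y \<in> J \<inter> A \<Longrightarrow> c y \<in> dom M i \<and> crd M i (c y) = g y"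
    using smooth_intoD[OF c t(1) i] by blast
  have "(g has_vector_derivative fder g t 1) (at t within J)"
    using C_inf_on_vector_derivative[of g A 0 t 1] A by simp
  then have "((crd M i \<circ> c) has_vector_derivative fder g t 1) (at t within J)"
    unfolding has_vector_derivative_def
  proof (rule has_derivative_transform_eventually)
    show "\<forall>\<^sub>F x' in at t within J. g x' = (crd M i \<circ> c) x'"
      using A eventually_at_topological[of _ t J] by (auto intro!: exI[of _ A])
  qed (use A t in auto)
  then have "((crd M i \<circ> c) has_vector_derivative vector_derivative (crd M i \<circ> c) (at t within J)) (at t within J)"
    using vector_derivative_within[OF t(2)] by metis
  then show ?thesis using i by (simp add: velocity_def o_def)
qed

lemma velocity_eqI:
  assumes "((\<lambda>t. crd M i (c t)) has_vector_derivative v) (at t within J)" "at t within J \<noteq> bot"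
    "i \<in> idx M" "c t \<in> dom M i"
  shows "velocity M J c t i = v"
  using assms vector_derivative_within[OF assms(2,1)] by (simp add: velocity_def o_def)

lemma velocity_tangent:
  assumes c: "smooth_into M J c" and t: "t \<in> J" "at t within J \<noteq> bot"
  shows "velocity M J c t \<in> tangent_space M (c t)"
proof -
  have "velocity M J c t j = fder (transition M i j) (crd M i (c t)) (velocity M J c t i)"
    if ij: "i \<in> idx M" "j \<in> idx M" "c t \<in> dom M i" "c t \<in> dom M j" for i j
  proof (rule velocity_eqI[where c = c and t = t, OF _ t(2) ij(2,4)])
    obtain A g where A: "open A" "t \<in> A" "C_inf_on g A" "\<And>y. y \<in> J \<inter> A \<Longrightarrow> c y \<in> dom M i \<and> crd M i (c y) = g y"
      using smooth_intoD[OF c t(1) ij(1,3)] by blast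
    have "((\<lambda>t. transition M i j (crd M i (c t))) has_derivative
        (\<lambda>h. fder (transition M i j) (crd M i (c t)) (h *\<^sub>R velocity M J c t i))) (at t within J)"
      by (rule has_derivative_compose[OF velocity_chart[OF c t ij(1,3), unfolded has_vector_derivative_def]
            transition_has_derivative[OF ij]])
    then have "((\<lambda>t. transition M i j (crd M i (c t))) has_vector_derivative
        fder (transition M i j) (crd M i (c t)) (velocity M J c t i)) (at t within J)"
      unfolding has_vector_derivative_def by (simp add: linear_cmul[OF linear_transition[OF ij]])
    then show "((\<lambda>t. crd M j (c t)) has_vector_derivative
        fder (transition M i j) (crd M i (c t)) (velocity M J c t i)) (at t within J)"
      unfolding has_vector_derivative_def
    proof (rule has_derivative_transform_eventually)
      show "\<forall>\<^sub>F x' in at t within J. transition M i j (crd M i (c x')) = crd M j (c x')"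
        using A(1,2,4) transition_crd[OF ij(1)] unfolding eventually_at_topological by blast
    qed (use t transition_crd[OF ij(1,3)] in auto)
  qed
  then show ?thesis by (rule tangent_spaceI) (auto simp: velocity_def)
qed

subsection \<open>Extension of local data by cutoff functions\<close>

text \<open>Vanishing outside the chart domain would not be enough for extension by zero to be
  smooth. The second clause demands vanishing near each outside point, measured in any chart around
  it.\<close>

definition cutoff :: "'i \<Rightarrow> ('a \<Rightarrow> real) \<Rightarrow> bool"
  where "cutoff i \<phi> \<longleftrightarrow> smooth_fun M \<phi> \<and>
    (\<forall>j\<in>idx M. \<forall>q\<in>dom M j - dom M i. \<exists>A. open A \<and> crd M j q \<in> A \<and> (\<forall>z\<in>A \<inter> img j. \<phi> (crd_inv M j z) = 0))"

lemma cutoff_0: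
  assumes "cutoff i \<phi>" "p \<in> pts M" "p \<notin> dom M i"
  shows "\<phi> p = 0"
proof -
  obtain j where j: "j \<in> idx M" "p \<in> dom M j" using ptsE[OF assms(2)] .
  then obtain A where "crd M j p \<in> A" "\<forall>z\<in>A \<inter> img j. \<phi> (crd_inv M j z) = 0"
    using assms unfolding cutoff_def by blast
  then have "\<phi> (crd_inv M j (crd M j p)) = 0" using j by blast
  then show ?thesis using j by simp
qed

lemma cutoff_smooth: "cutoff i \<phi> \<Longrightarrow> smooth_fun M \<phi>"
  by (simp add: cutoff_def)

lemma cutoff_nbhd:
  assumes "cutoff i \<phi>" "j \<in> idx M" "q \<in> dom M j" "q \<notin> dom M i"
  obtains A where "open A" "crd M j q \<in> A" "A \<subseteq> img j" "\<And>z. z \<in> A \<Longrightarrow> \<phi> (crd_inv M j z) = 0"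
proof -
  obtain A where "open A" "crd M j q \<in> A" "\<forall>z\<in>A \<inter> img j. \<phi> (crd_inv M j z) = 0"
    using assms unfolding cutoff_def by blast
  moreover have "open (A \<inter> img j)" using \<open>open A\<close> open_img[OF assms(2)] by blast
  ultimately show thesis using that[of "A \<inter> img j"] assms(3) by blast
qed

text \<open>\<open>u\<close> gives components in the chart \<open>i\<close>. With constant
  \<open>u\<close> these are globalised coordinate fields, used below as a frame near a
  point.\<close>

definition cutoff_field :: "'i \<Rightarrow> ('a \<Rightarrow> real) \<Rightarrow> ('e \<Rightarrow> 'e) \<Rightarrow> 'a \<Rightarrow> 'i \<Rightarrow> 'e"
  where "cutoff_field i \<phi> u = (\<lambda>p. if p \<in> dom M i then \<phi> p *\<^sub>R tvec i p (u (crd M i p)) else 0)"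

lemma cutoff_field_chart [simp]:
  "i \<in> idx M \<Longrightarrow> p \<in> dom M i \<Longrightarrow> cutoff_field i \<phi> u p i = \<phi> p *\<^sub>R u (crd M i p)"
  by (simp add: cutoff_field_def scaleR_fun_def)

lemma cutoff_field_tangent: "i \<in> idx M \<Longrightarrow> cutoff_field i \<phi> u p \<in> tangent_space M p"
  by (simp add: cutoff_field_def)

text \<open>Inside the chart domain the representative is a product of smooth maps; around an
  outside point it is identically zero by the second clause of \<open>cutoff\<close>.\<close>

lemma cutoff_field_field:
  assumes i: "i \<in> idx M" and \<phi>: "cutoff i \<phi>" and u: "C_inf_on u (img i)"
  shows "cutoff_field i \<phi> u \<in> vector_fields M"
proof (rule vector_fieldsI[OF cutoff_field_tangent[OF i]])
  show "cutoff_field i \<phi> u p = 0" if "p \<notin> pts M" for p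
    using that dom_pts[OF i] by (auto simp: cutoff_field_def)
  fix p assume "p \<in> pts M"
  then obtain j where j: "j \<in> idx M" "p \<in> dom M j" by (rule ptsE)
  show "\<exists>i'\<in>idx M. \<exists>U. p \<in> dom M i' \<and> open U \<and> crd M i' p \<in> U \<and> C_inf_on (field_rep M i' (cutoff_field i \<phi> u)) U"
  proof (cases "p \<in> dom M i")
    case True
    have "C_inf_on (field_rep M i (cutoff_field i \<phi> u)) (img i)"
    proof (rule C_inf_on_cong)
      show "C_inf_on (\<lambda>x. (\<phi> \<circ> crd_inv M i) x *\<^sub>R u x) (img i)"
        by (intro C_inf_on_scaleR smooth_fun_C_inf[OF cutoff_smooth[OF \<phi>]] u open_img i)
    qed (use i in auto)
    then show ?thesis using True i open_img by blast
  next
    case False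
    obtain A where A: "open A" "crd M j p \<in> A" "A \<subseteq> img j" "\<And>z. z \<in> A \<Longrightarrow> \<phi> (crd_inv M j z) = 0"
      using cutoff_nbhd[OF \<phi> j False] by blast
    have "C_inf_on (field_rep M j (cutoff_field i \<phi> u)) A"
      by (rule C_inf_on_cong[OF C_inf_on_const[of 0] A(1)])
        (use A(4) in \<open>auto simp: field_rep_def cutoff_field_def scaleR_fun_def\<close>)
    then show ?thesis using j A by blast
  qed
qed

lemma cutoff_fun:
  assumes i: "i \<in> idx M" and \<phi>: "cutoff i \<phi>" and h: "C_inf_on h (img i)"
  shows "smooth_fun M (\<lambda>p. \<phi> p * h (crd M i p))"
proof (rule smooth_funI)
  fix p assume "p \<in> pts M"
  then obtain j where j: "j \<in> idx M" "p \<in> dom M j" by (rule ptsE)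
  let ?f = "\<lambda>p. \<phi> p * h (crd M i p)"
  show "\<exists>i'\<in>idx M. \<exists>U. p \<in> dom M i' \<and> open U \<and> crd M i' p \<in> U \<and> C_inf_on (?f \<circ> crd_inv M i') U"
  proof (cases "p \<in> dom M i")
    case True
    have "C_inf_on (?f \<circ> crd_inv M i) (img i)"
    proof (rule C_inf_on_cong)
      show "C_inf_on (\<lambda>x. (\<phi> \<circ> crd_inv M i) x * h x) (img i)"
        by (intro C_inf_on_mult smooth_fun_C_inf[OF cutoff_smooth[OF \<phi>]] h open_img i)
    qed (use i in auto)
    then show ?thesis using True i open_img by blast
  next
    case False
    obtain A where A: "open A" "crd M j p \<in> A" "A \<subseteq> img j" "\<And>z. z \<in> A \<Longrightarrow> \<phi> (crd_inv M j z) = 0"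
      using cutoff_nbhd[OF \<phi> j False] by blast
    have "C_inf_on (?f \<circ> crd_inv M j) A"
      by (rule C_inf_on_cong[OF C_inf_on_const[of 0] A(1)]) (use A(4) in auto)
    then show ?thesis using j A by blast
  qed
qed

section \<open>The manifold topology and the existence of cutoff functions\<close>

text \<open>\<open>topology\<close> is meaningful only for families that satisfy the axioms.
  Stability under intersection is where injectivity of the coordinate maps enters.\<close>

lemma openin_mfd:
  "openin (mfd_topology M) A \<longleftrightarrow> A \<subseteq> pts M \<and> (\<forall>i\<in>idx M. open (crd M i ` (A \<inter> dom M i)))"
proof -
  have "istopology (\<lambda>A. A \<subseteq> pts M \<and> (\<forall>i\<in>idx M. open (crd M i ` (A \<inter> dom M i))))"
    unfolding istopology_def
  proof (intro conjI allI impI ballI)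
    fix A B i
    assume A: "A \<subseteq> pts M \<and> (\<forall>i\<in>idx M. open (crd M i ` (A \<inter> dom M i)))"
      and B: "B \<subseteq> pts M \<and> (\<forall>i\<in>idx M. open (crd M i ` (B \<inter> dom M i)))" and i: "i \<in> idx M"
    have "crd M i ` (A \<inter> B \<inter> dom M i) = crd M i ` (A \<inter> dom M i) \<inter> crd M i ` (B \<inter> dom M i)"
      using inj_on_image_Int[OF inj[OF i], of "A \<inter> dom M i" "B \<inter> dom M i"]
      by (simp add: Int_ac Int_left_absorb)
    then show "open (crd M i ` (A \<inter> B \<inter> dom M i))" using A B i by auto
  next
    fix K i assume K: "\<forall>A\<in>K. A \<subseteq> pts M \<and> (\<forall>i\<in>idx M. open (crd M i ` (A \<inter> dom M i)))" and i: "i \<in> idx M"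
    have "crd M i ` (\<Union>K \<inter> dom M i) = (\<Union>A\<in>K. crd M i ` (A \<inter> dom M i))" by blast
    then show "open (crd M i ` (\<Union>K \<inter> dom M i))" using K i by auto
  qed blast+
  from topology_inverse'[OF this] show ?thesis by (simp add: mfd_topology_def)
qed

text \<open>The Hausdorff property enters only here: a compact subset of a chart is closed in the manifold,
  so a bump function on the chart extends smoothly by zero.\<close>

lemma compact_chart_closed:
  assumes H: "Hausdorff_space (mfd_topology M)" and i: "i \<in> idx M" and K: "compact K" "K \<subseteq> img i"
    and j: "j \<in> idx M" "q \<in> dom M j" "q \<notin> dom M i"
  obtains A where "open A" "crd M j q \<in> A" "A \<subseteq> img j" "\<And>p. p \<in> dom M i \<Longrightarrow> crd M i p \<in> K \<Longrightarrow> p \<in> dom M j \<Longrightarrow> crd M j p \<notin> A"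
proof -
  have top: "topspace (mfd_topology M) = pts M"
  proof -
    have "openin (mfd_topology M) (pts M)"
      unfolding openin_mfd using pts_eq open_img by (metis Sup_upper imageI inf.absorb_iff2 subset_refl)
    then show ?thesis by (metis openin_mfd openin_subset openin_topspace subset_antisym)
  qed
  have "\<exists>U V. openin (mfd_topology M) U \<and> openin (mfd_topology M) V \<and> crd_inv M i z \<in> U \<and> q \<in> V \<and> disjnt U V"
    if "z \<in> K" for z
  proof -
    have "crd_inv M i z \<in> dom M i" using K that by auto
    then have "crd_inv M i z \<noteq> q" "crd_inv M i z \<in> pts M" "q \<in> pts M" using i j dom_pts by auto
    then show ?thesis using H unfolding Hausdorff_space_def top by blast
  qed
  then obtain U V where UV: "\<And>z. z \<in> K \<Longrightarrow> openin (mfd_topology M) (U z)" "\<And>z. z \<in> K \<Longrightarrow> openin (mfd_topology M) (V z)"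
    "\<And>z. z \<in> K \<Longrightarrow> crd_inv M i z \<in> U z" "\<And>z. z \<in> K \<Longrightarrow> q \<in> V z" "\<And>z. z \<in> K \<Longrightarrow> disjnt (U z) (V z)"
    by metis
  have cov: "K \<subseteq> (\<Union>z\<in>K. crd M i ` (U z \<inter> dom M i))"
  proof
    fix z assume z: "z \<in> K"
    then have "crd_inv M i z \<in> U z \<inter> dom M i" using UV K by auto
    moreover have "z = crd M i (crd_inv M i z)" using K z by auto
    ultimately show "z \<in> (\<Union>z\<in>K. crd M i ` (U z \<inter> dom M i))" using z by blast
  qed
  have op: "\<And>z. z \<in> K \<Longrightarrow> open (crd M i ` (U z \<inter> dom M i))" using UV(1) i unfolding openin_mfd by blast
  obtain D where D: "D \<subseteq> K" "finite D" "K \<subseteq> (\<Union>z\<in>D. crd M i ` (U z \<inter> dom M i))"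
    using compactE_image[OF K(1) op cov] by blast
  \<comment> \<open>Only the finitely many neighbourhoods of \<open>q\<close> that belong to the
    subcover of \<open>K\<close> are intersected, so the result is open, and it misses everything
    over \<open>K\<close>.\<close>
  define A where "A = img j \<inter> (\<Inter>z\<in>D. crd M j ` (V z \<inter> dom M j))"
  have "open A"
    unfolding A_def using D UV(2) j open_img
    by (intro open_Int open_INT ballI) (auto simp: openin_mfd subset_iff)
  moreover have "crd M j q \<in> A" unfolding A_def using D UV(4) j by blast
  moreover have "crd M j p \<notin> A" if p: "p \<in> dom M i" "crd M i p \<in> K" "p \<in> dom M j" for p
  proof
    assume "crd M j p \<in> A"
    obtain z where z: "z \<in> D" "crd M i p \<in> crd M i ` (U z \<inter> dom M i)" using D p by blast
    then have "p \<in> U z" using inj_onD[OF inj[OF i]] p by blast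
    moreover have "crd M j p \<in> crd M j ` (V z \<inter> dom M j)" using \<open>crd M j p \<in> A\<close> z by (auto simp: A_def)
    then have "p \<in> V z" using inj_onD[OF inj[OF j(1)]] p by blast
    ultimately show False using UV(5) z D by (auto simp: disjnt_iff)
  qed
  ultimately show thesis using that[of A] by (auto simp: A_def)
qed

text \<open>A bump function in coordinates, extended by zero. It vanishes off a compact subset of
  the chart, and \<open>compact_chart_closed\<close> separates outside points from that
  subset.\<close>

lemma cutoff_exists:
  assumes H: "Hausdorff_space (mfd_topology M)" and i: "i \<in> idx M" "p \<in> dom M i"
  obtains \<phi> A where "cutoff i \<phi>" "\<phi> p = 1" "fder (\<phi> \<circ> crd_inv M i) (crd M i p) = (\<lambda>v. 0)"
    "open A" "crd M i p \<in> A" "A \<subseteq> img i" "\<And>z. z \<in> A \<Longrightarrow> \<phi> (crd_inv M i z) > 0"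
proof -
  \<comment> \<open>A closed ball inside the chart image, because compactness is required; the bump
    function itself is positive only on the open ball.\<close>
  obtain r where r: "r > 0" "cball (crd M i p) r \<subseteq> img i"
    using open_img[OF i(1)] i open_contains_cball by (metis imageI)
  obtain b :: "'e \<Rightarrow> real" where b: "C_inf_on b UNIV" "b (crd M i p) = 1" "fder b (crd M i p) = (\<lambda>v. 0)"
    "\<And>x. x \<in> ball (crd M i p) r \<Longrightarrow> b x > 0" "\<And>x. x \<notin> ball (crd M i p) r \<Longrightarrow> b x = 0"
    using bump_function[OF r(1), of "crd M i p"] by blast
  define \<phi> where "\<phi> = (\<lambda>q. if q \<in> dom M i then b (crd M i q) else 0)"
  have nb: "\<exists>A. open A \<and> crd M j q \<in> A \<and> A \<subseteq> img j \<and> (\<forall>z\<in>A. \<phi> (crd_inv M j z) = 0)"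
    if j: "j \<in> idx M" "q \<in> dom M j" "q \<notin> dom M i" for j q
  proof -
    obtain A where A: "open A" "crd M j q \<in> A" "A \<subseteq> img j"
      "\<And>p'. p' \<in> dom M i \<Longrightarrow> crd M i p' \<in> cball (crd M i p) r \<Longrightarrow> p' \<in> dom M j \<Longrightarrow> crd M j p' \<notin> A"
      using compact_chart_closed[OF H i(1) compact_cball r(2) j] by blast
    have "\<phi> (crd_inv M j z) = 0" if z: "z \<in> A" for z
    proof (rule ccontr)
      assume n: "\<phi> (crd_inv M j z) \<noteq> 0"
      then have "crd_inv M j z \<in> dom M i" "b (crd M i (crd_inv M j z)) \<noteq> 0" by (auto simp: \<phi>_def split: if_splits)
      moreover from this(2) have "crd M i (crd_inv M j z) \<in> ball (crd M i p) r" using b(5) by blast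
      moreover have "z \<in> img j" using A z by auto
      ultimately show False using A(4)[of "crd_inv M j z"] z by auto
    qed
    then show ?thesis using A by blast
  qed
  have rep: "C_inf_on (\<phi> \<circ> crd_inv M i) (img i)"
    by (rule C_inf_on_cong[OF C_inf_on_subset[OF b(1)]]) (use i in \<open>auto simp: \<phi>_def\<close>)
  have "smooth_fun M \<phi>"
  proof (rule smooth_funI)
    fix q assume "q \<in> pts M"
    then obtain j where j: "j \<in> idx M" "q \<in> dom M j" by (rule ptsE)
    show "\<exists>i\<in>idx M. \<exists>U. q \<in> dom M i \<and> open U \<and> crd M i q \<in> U \<and> C_inf_on (\<phi> \<circ> crd_inv M i) U"
    proof (cases "q \<in> dom M i")
      case True
      then show ?thesis using rep i open_img by blast
    next
      case False
      then obtain A where A: "open A" "crd M j q \<in> A" "\<forall>z\<in>A. \<phi> (crd_inv M j z) = 0" using nb j by blast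
      have "C_inf_on (\<phi> \<circ> crd_inv M j) A"
        by (rule C_inf_on_cong[OF C_inf_on_const[of 0] A(1)]) (use A in auto)
      then show ?thesis using j A by blast
    qed
  qed
  then have 1: "cutoff i \<phi>" unfolding cutoff_def using nb by fastforce
  have "(b has_derivative fder b (crd M i p)) (at (crd M i p))" using C_inf_on_has_derivative[OF b(1)] by simp
  then have "(\<phi> \<circ> crd_inv M i has_derivative fder b (crd M i p)) (at (crd M i p))"
    by (rule has_derivative_transform_within_open[of _ _ _ _ "img i"]) (use i in \<open>auto simp: \<phi>_def\<close>)
  from fder_eqI[OF this] have 2: "fder (\<phi> \<circ> crd_inv M i) (crd M i p) = (\<lambda>v. 0)" using b by simp
  show thesis
  proof (rule that[OF 1 _ 2])
    show "\<phi> p = 1" using i b by (simp add: \<phi>_def)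
    show "open (ball (crd M i p) r)" "crd M i p \<in> ball (crd M i p) r" using r by auto
    show "ball (crd M i p) r \<subseteq> img i" using r(2) ball_subset_cball by blast
    then show "\<phi> (crd_inv M i z) > 0" if "z \<in> ball (crd M i p) r" for z
      using that b(4)[OF that] by (auto simp: \<phi>_def)
  qed
qed

section \<open>Evaluation of tensorial operators and algebra of vector fields\<close>

text \<open>The two halves of the definite description: one extension of the vector has to exist,
  and all extensions have to give the same value.\<close>

lemma tensor_at_eqI:
  assumes "X \<in> vector_fields M" "X p = v"
    and "\<And>Y. Y \<in> vector_fields M \<Longrightarrow> Y p = v \<Longrightarrow> L Y p = u"
  shows "tensor_at M L p v = u"
  unfolding tensor_at_def by (rule the_equality) (use assms in auto)

lemma field_0: "(0 :: 'a \<Rightarrow> 'i \<Rightarrow> 'e) \<in> vector_fields M"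
proof (rule vector_fieldsI)
  fix p assume "p \<in> pts M"
  then obtain i where "i \<in> idx M" "p \<in> dom M i" by (rule ptsE)
  moreover have "field_rep M i 0 = (\<lambda>y. 0)" for i by (simp add: field_rep_def)
  ultimately show "\<exists>i\<in>idx M. \<exists>U. p \<in> dom M i \<and> open U \<and> crd M i p \<in> U \<and> C_inf_on (field_rep M i 0) U"
    by (metis C_inf_on_const UNIV_I open_UNIV)
qed simp_all

lemma field_add:
  assumes "X \<in> vector_fields M" "Y \<in> vector_fields M"
  shows "X + Y \<in> vector_fields M"
proof (rule vector_fieldsI)
  fix p assume "p \<in> pts M"
  then obtain i where i: "i \<in> idx M" "p \<in> dom M i" by (rule ptsE)
  have "C_inf_on (\<lambda>z. field_rep M i X z + field_rep M i Y z) (img i)"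
    by (intro C_inf_on_add field_rep_C_inf assms i open_img)
  then have "C_inf_on (field_rep M i (X + Y)) (img i)" by (simp add: field_rep_def)
  then show "\<exists>i\<in>idx M. \<exists>U. p \<in> dom M i \<and> open U \<and> crd M i p \<in> U \<and> C_inf_on (field_rep M i (X + Y)) U"
    using i open_img by blast
next
  have *: "(X + Y) p = X p + Y p" for p by (rule plus_fun_apply)
  show "(X + Y) p \<in> tangent_space M p" for p unfolding * by (intro tangent_add field_tangent assms)
  show "(X + Y) p = 0" if "p \<notin> pts M" for p
    unfolding * field_outside[OF assms(1) that] field_outside[OF assms(2) that] by (rule add_0_left)
qed

lemma field_scale:
  assumes X: "X \<in> vector_fields M" and f: "smooth_fun M f"
  shows "(\<lambda>p. f p *\<^sub>R X p) \<in> vector_fields M"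
proof (rule vector_fieldsI)
  fix p assume "p \<in> pts M"
  then obtain i where i: "i \<in> idx M" "p \<in> dom M i" by (rule ptsE)
  have "C_inf_on (\<lambda>z. (f \<circ> crd_inv M i) z *\<^sub>R field_rep M i X z) (img i)"
    by (intro C_inf_on_scaleR smooth_fun_C_inf field_rep_C_inf f X i open_img)
  then have "C_inf_on (field_rep M i (\<lambda>p. f p *\<^sub>R X p)) (img i)"
    by (simp add: field_rep_def scaleR_fun_def)
  then show "\<exists>i\<in>idx M. \<exists>U. p \<in> dom M i \<and> open U \<and> crd M i p \<in> U \<and> C_inf_on (field_rep M i (\<lambda>p. f p *\<^sub>R X p)) U"
    using i open_img by blast
qed (use field_tangent[OF X] field_outside[OF X] in auto)

lemma smooth_fun_mult:
  "smooth_fun M f \<Longrightarrow> smooth_fun M g \<Longrightarrow> smooth_fun M (\<lambda>p. f p * g p)"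
  using C_inf_on_mult[of "f \<circ> crd_inv M i" _ "g \<circ> crd_inv M i" for i]
  by (simp add: smooth_fun_def smooth_on_open_iff o_def)

text \<open>The factor \<open>\<phi>\<^sup>2\<close> turns the local expansion of \<open>X\<close> in coordinate fields into one with global
  fields and global coefficients, so that no separate locality argument for connections is needed.\<close>

lemma cutoff_field_expansion:
  assumes i: "i \<in> idx M" and \<phi>: "cutoff i \<phi>" and X: "X \<in> vector_fields M"
    and h: "\<And>p. p \<in> dom M i \<Longrightarrow> (\<Sum>k\<in>B. h k (crd M i p) *\<^sub>R e k) = X p i"
  shows "(\<lambda>p. (\<phi> p * \<phi> p) *\<^sub>R X p) = (\<Sum>k\<in>B. (\<lambda>p. (\<phi> p * h k (crd M i p)) *\<^sub>R cutoff_field i \<phi> (\<lambda>z. e k) p))"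
proof
  fix p
  have rhs: "(\<Sum>k\<in>B. (\<lambda>p. (\<phi> p * h k (crd M i p)) *\<^sub>R cutoff_field i \<phi> (\<lambda>z. e k) p)) p
      = (\<Sum>k\<in>B. (\<phi> p * h k (crd M i p)) *\<^sub>R cutoff_field i \<phi> (\<lambda>z. e k) p)"
    by (rule sum_fun_apply)
  have "(\<phi> p * \<phi> p) *\<^sub>R X p = (\<Sum>k\<in>B. (\<phi> p * h k (crd M i p)) *\<^sub>R cutoff_field i \<phi> (\<lambda>z. e k) p)"
  proof (cases "p \<in> dom M i")
    case True
    show ?thesis
    proof (rule tangent_eqI[OF _ _ i True])
      show "(\<phi> p * \<phi> p) *\<^sub>R X p \<in> tangent_space M p" by (rule tangent_scaleR[OF field_tangent[OF X]])
      show "(\<Sum>k\<in>B. (\<phi> p * h k (crd M i p)) *\<^sub>R cutoff_field i \<phi> (\<lambda>z. e k) p) \<in> tangent_space M p"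
        by (intro tangent_sum tangent_scaleR cutoff_field_tangent i)
      have "(\<phi> p * \<phi> p) *\<^sub>R X p i = (\<Sum>k\<in>B. (\<phi> p * \<phi> p) *\<^sub>R (h k (crd M i p) *\<^sub>R e k))"
        unfolding h[OF True, symmetric] by (rule scaleR_sum_right)
      then show "((\<phi> p * \<phi> p) *\<^sub>R X p) i = (\<Sum>k\<in>B. (\<phi> p * h k (crd M i p)) *\<^sub>R cutoff_field i \<phi> (\<lambda>z. e k) p) i"
        unfolding sum_fun_apply using i True by (simp add: scaleR_fun_def mult_ac)
    qed
  next
    case False
    then have "(\<phi> p * \<phi> p) *\<^sub>R X p = 0"
      using cutoff_0[OF \<phi> _ False] field_outside[OF X] by (cases "p \<in> pts M") simp_all
    then show ?thesis using False by (simp add: cutoff_field_def)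
  qed
  then show "(\<phi> p * \<phi> p) *\<^sub>R X p = (\<Sum>k\<in>B. (\<lambda>p. (\<phi> p * h k (crd M i p)) *\<^sub>R cutoff_field i \<phi> (\<lambda>z. e k) p)) p"
    unfolding rhs .
qed

end

lemma smooth_manifold_atlas: "smooth_manifold M \<Longrightarrow> atlas M"
  unfolding smooth_manifold_def atlas_def by blast

section \<open>The slit tangent bundle in coordinates\<close>

text \<open>As simplification rules these unfold the coordinates of the slit tangent bundle. The
  fourth one is removed wherever \<open>crd\<close> must stay folded in order to match a chart
  formula.\<close>

lemma slit_tangent_sel [simp]:
  "idx (slit_tangent M) = idx M"
  "w \<in> dom (slit_tangent M) i \<longleftrightarrow> fst w \<in> dom M i \<and> snd w \<in> tangent_space M (fst w) \<and> snd w \<noteq> 0"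
  "w \<in> pts (slit_tangent M) \<longleftrightarrow> fst w \<in> pts M \<and> snd w \<in> tangent_space M (fst w) \<and> snd w \<noteq> 0"
  "crd (slit_tangent M) i w = (crd M i (fst w), snd w i)"
  by (auto simp: slit_tangent_def split: prod.splits)

context atlas
begin

abbreviation "TM \<equiv> slit_tangent M"

lemma slit_inj: "i \<in> idx M \<Longrightarrow> inj_on (crd TM i) (dom TM i)"
proof (rule inj_onI)
  fix w z assume i: "i \<in> idx M" and w: "w \<in> dom TM i" and z: "z \<in> dom TM i"
    and eq: "crd TM i w = crd TM i z"
  have p: "fst w = fst z" using inj_onD[OF inj[OF i]] w z eq by auto
  then have "snd w = snd z" using tangent_eqI[of "snd w" "fst z" "snd z" i] i w z eq by auto
  then show "w = z" using p by (simp add: prod_eq_iff)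
qed

text \<open>Charts contain whole fibres without the origin: a nonzero vector has nonzero components
  in every chart, and conversely \<open>tvec\<close> realises all nonzero components.\<close>

lemma slit_overlap:
  assumes "i \<in> idx M" "j \<in> idx M"
  shows "crd TM i ` (dom TM i \<inter> dom TM j)
    = crd M i ` (dom M i \<inter> dom M j) \<times> (- {0})" (is "?L = ?R")
proof
  show "?L \<subseteq> ?R" using assms tangent_nonzero_iff by auto
  show "?R \<subseteq> ?L"
  proof
    fix z assume "z \<in> ?R"
    then have "fst z \<in> crd M i ` (dom M i \<inter> dom M j)" "snd z \<noteq> 0" by auto
    then obtain p where p: "p \<in> dom M i" "p \<in> dom M j" "fst z = crd M i p" "snd z \<noteq> 0" by blast
    let ?w = "(p, tvec i p (snd z))"
    have "tvec i p (snd z) \<noteq> 0"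
      using tangent_nonzero_iff[OF tvec_tangent assms(1) p(1)] assms p by simp
    then have "?w \<in> dom TM i \<inter> dom TM j" using assms p by simp
    moreover have "crd TM i ?w = z" using assms p by (simp add: prod_eq_iff)
    ultimately show "z \<in> ?L" by (metis image_eqI)
  qed
qed

lemma slit_img: "i \<in> idx M \<Longrightarrow> crd TM i ` dom TM i = img i \<times> (- {0})"
  using slit_overlap[of i i] by simp

lemma slit_crd_inv_crd:
  "i \<in> idx M \<Longrightarrow> w \<in> dom TM i \<Longrightarrow> crd_inv TM i (crd TM i w) = w"
  unfolding crd_inv_def by (rule inv_into_f_f[OF slit_inj])

lemma slit_transition:
  assumes "i \<in> idx M" "j \<in> idx M" "z \<in> crd M i ` (dom M i \<inter> dom M j) \<times> (- {0})"
  shows "transition TM i j z = (transition M i j (fst z), fder (transition M i j) (fst z) (snd z))"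
proof -
  obtain w where w: "w \<in> dom TM i" "w \<in> dom TM j" "z = crd TM i w"
    using assms slit_overlap[OF assms(1,2)] by blast
  have "transition TM i j z = crd TM j w"
    unfolding transition_def w(3) using slit_crd_inv_crd[OF assms(1) w(1)] by simp
  then show ?thesis using tangent_transform[of "snd w" "fst w" i j] assms w by simp
qed

lemma open_slit_overlap:
  "i \<in> idx M \<Longrightarrow> j \<in> idx M \<Longrightarrow> open (crd M i ` (dom M i \<inter> dom M j) \<times> (- {0::'e}))"
  by (intro open_Times open_overlap) auto

lemma slit_transition_C_inf:
  assumes "i \<in> idx M" "j \<in> idx M"
  shows "C_inf_on (transition TM i j) (crd M i ` (dom M i \<inter> dom M j) \<times> (- {0}))"
proof (rule C_inf_on_cong[OF _ open_slit_overlap[OF assms] slit_transition[OF assms, symmetric]])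
  have o: "open (crd M i ` (dom M i \<inter> dom M j) \<times> (- {0::'e}))" by (rule open_slit_overlap[OF assms])
  show "C_inf_on (\<lambda>z. (transition M i j (fst z), fder (transition M i j) (fst z) (snd z)))
      (crd M i ` (dom M i \<inter> dom M j) \<times> (- {0}))"
    by (intro C_inf_on_Pair o C_inf_on_compose[OF transition_C_inf[OF assms]]
        C_inf_on_fder_apply[OF transition_C_inf[OF assms]] open_overlap assms) auto
qed

lemma atlas_slit: "atlas TM"
proof
  show "(\<Union>i\<in>idx TM. dom TM i) = pts TM"
    using pts_eq by (auto simp: set_eq_iff)
  fix i assume i: "i \<in> idx TM"
  then show "inj_on (crd TM i) (dom TM i)" using slit_inj by simp
  fix j assume j: "j \<in> idx TM"
  show "open (crd TM i ` (dom TM i \<inter> dom TM j))"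
    using i j slit_overlap open_slit_overlap by simp
  then show "smooth_on (crd TM i ` (dom TM i \<inter> dom TM j)) (transition TM i j)"
    using i j slit_overlap[of i j] slit_transition_C_inf[of i j] by (simp add: smooth_on_open_iff)
qed

text \<open>The derivative of (x, y) \<mapsto> (t x, Dt y) is block triangular, and the second
  derivative of t sits in the corner that maps base directions to fibre directions. Hence base
  parts, and fibre parts of vertical vectors, transform like tangent vectors of the base.\<close>

lemma slit_transition_fder:
  assumes ij: "i \<in> idx M" "j \<in> idx M" and w: "w \<in> dom TM i" "w \<in> dom TM j"
  shows "fst (fder (transition TM i j) (crd TM i w) \<xi>)
      = fder (transition M i j) (crd M i (fst w)) (fst \<xi>)"
    and "fder (transition TM i j) (crd TM i w) (0, u)
      = (0, fder (transition M i j) (crd M i (fst w)) u)"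
proof -
  let ?x = "crd M i (fst w)"
  let ?z = "crd TM i w"
  let ?O = "crd M i ` (dom M i \<inter> dom M j) \<times> (- {0::'e})"
  let ?D = "\<lambda>h. (fder (transition M i j) ?x (fst h),
    fder (\<lambda>y. fder (transition M i j) y (snd ?z)) ?x (fst h) + fder (transition M i j) ?x (snd h))"
  have x: "?x \<in> crd M i ` (dom M i \<inter> dom M j)" using w by auto
  have zO: "?z \<in> ?O" using w x tangent_nonzero_iff[of "snd w" "fst w" i] ij by auto
  have "((\<lambda>z. (transition M i j (fst z), fder (transition M i j) (fst z) (snd z))) has_derivative ?D) (at ?z)"
  proof (rule has_derivative_Pair)
    show "((\<lambda>z. transition M i j (fst z)) has_derivative (\<lambda>h. fder (transition M i j) ?x (fst h))) (at ?z)"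
      by (rule has_derivative_compose[OF has_derivative_fst[OF has_derivative_ident]])
        (use transition_has_derivative[OF ij, of "fst w"] w in simp)
    have "((\<lambda>z. fder (transition M i j) (fst z) (snd z)) has_derivative
       (\<lambda>h. fder (\<lambda>y. fder (transition M i j) y (snd ?z)) (fst ?z) (fst h) + fder (transition M i j) (fst ?z) (snd h))) (at ?z)"
      by (rule has_derivative_fder_apply[OF transition_C_inf[OF ij] open_overlap[OF ij]])
        (use x in \<open>auto intro!: derivative_eq_intros\<close>)
    then show "((\<lambda>z. fder (transition M i j) (fst z) (snd z)) has_derivative
       (\<lambda>h. fder (\<lambda>y. fder (transition M i j) y (snd ?z)) ?x (fst h) + fder (transition M i j) ?x (snd h))) (at ?z)"
      by simp
  qed
  then have "(transition TM i j has_derivative ?D) (at ?z)"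
    by (rule has_derivative_transform_within_open[OF _ open_slit_overlap[OF ij] zO])
      (rule slit_transition[OF ij, symmetric])
  then have D: "fder (transition TM i j) ?z = ?D" by (rule fder_eqI)
  show "fst (fder (transition TM i j) ?z \<xi>) = fder (transition M i j) ?x (fst \<xi>)"
    unfolding D by simp
  have "fder (transition M i j) ?x 0 = 0" using linear_0[OF linear_transition[OF ij]] w by simp
  moreover have "fder (\<lambda>y. fder (transition M i j) y (snd ?z)) ?x 0 = 0"
    by (rule linear_0[OF linear_frechet_derivative[OF C_inf_on_differentiable[OF C_inf_on_fder[OF transition_C_inf[OF ij]] x]]])
  ultimately show "fder (transition TM i j) ?z (0, u) = (0, fder (transition M i j) ?x u)"
    unfolding D by simp
qed

end

text \<open>Separation is assumed for the base, since cutoff functions on the slit tangent bundle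
  are pulled back from there.\<close>

locale slit_atlas = atlas M for M :: "('a, 'i, 'e::euclidean_space) mfd" +
  assumes Hausdorff: "Hausdorff_space (mfd_topology M)"

sublocale slit_atlas \<subseteq> slit: atlas "slit_tangent M"
  by (rule atlas_slit)

context slit_atlas
begin

abbreviation "simg i \<equiv> img i \<times> (- {0::'e})"

lemma slitE:
  assumes "w \<in> pts TM" obtains i where "i \<in> idx M" "w \<in> dom TM i"
  using slit.ptsE[OF assms] by auto

lemma simg_crd: "i \<in> idx M \<Longrightarrow> w \<in> dom TM i \<Longrightarrow> crd TM i w \<in> simg i"
  using slit_img by blast

lemma open_simg: "i \<in> idx M \<Longrightarrow> open (simg i)"
  using slit.open_img slit_img by simp

lemma slit_rep_C_inf: "X \<in> vector_fields TM \<Longrightarrow> i \<in> idx M \<Longrightarrow> C_inf_on (field_rep TM i X) (simg i)"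
  using slit.field_rep_C_inf slit_img by simp

lemma slit_crd_inv:
  assumes "i \<in> idx M" "z \<in> simg i"
  obtains w where "w \<in> dom TM i" "z = crd TM i w" "crd_inv TM i z = w"
proof -
  have "z \<in> crd TM i ` dom TM i" using assms(2) unfolding slit_img[OF assms(1)] .
  then obtain w where w: "z = crd TM i w" "w \<in> dom TM i" by (rule imageE)
  show thesis by (rule that[OF w(2,1)]) (use w slit_crd_inv_crd[OF assms(1) w(2)] in metis)
qed

subsection \<open>Vertical lifts and the tangent structure\<close>

lemma vert_chart:
  assumes "i \<in> idx M" "w \<in> dom TM i"
  shows "vert M w u i = (0, u i)"
proof -
  have "((\<lambda>t. (crd M i (fst w), snd w i + t *\<^sub>R u i)) has_vector_derivative (0, u i)) (at 0)"
    by (auto intro!: derivative_eq_intros has_vector_derivative_Pair)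
  then have "vector_derivative (\<lambda>t. (crd M i (fst w), snd w i + t *\<^sub>R u i)) (at 0) = (0, u i)"
    by (rule vector_derivative_at)
  moreover have "crd TM i \<circ> (\<lambda>t. (fst w, snd w + t *\<^sub>R u)) = (\<lambda>t. (crd M i (fst w), snd w i + t *\<^sub>R u i))"
    by (simp add: fun_eq_iff scaleR_fun_def)
  ultimately show ?thesis using assms by (simp add: vert_def velocity_def)
qed

lemma vert_outside: "\<not> (i \<in> idx M \<and> w \<in> dom TM i) \<Longrightarrow> vert M w u i = 0"
  by (auto simp: vert_def velocity_def)

lemma vert_tangent:
  assumes u: "u \<in> tangent_space M (fst w)"
  shows "vert M w u \<in> tangent_space TM w"
proof (rule slit.tangent_spaceI)
  fix i j assume ij: "i \<in> idx TM" "j \<in> idx TM" and w: "w \<in> dom TM i" "w \<in> dom TM j"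
  have "u j = fder (transition M i j) (crd M i (fst w)) (u i)"
    by (rule tangent_transform[OF u]) (use ij w in auto)
  then show "vert M w u j = fder (transition TM i j) (crd TM i w) (vert M w u i)"
    using slit_transition_fder(2)[of i j w "u i"] vert_chart[of i w u] vert_chart[of j w u] ij w by simp
qed (use vert_outside in simp)

text \<open>\<open>dproj\<close> is computed from an arbitrarily chosen chart of the slit bundle;
  \<open>slit_transition_fder\<close> identifies the outcome with the base part in any
  chart.\<close>

lemma dproj_chart:
  assumes \<xi>: "\<xi> \<in> tangent_space TM w" and j: "j \<in> idx M" "w \<in> dom TM j"
  shows "dproj M w \<xi> j = fst (\<xi> j)"
proof -
  define i where "i = some_chart TM w"
  have i: "i \<in> idx M" "w \<in> dom TM i"
    using slit.some_chart slit.dom_pts[of j w] j by (auto simp: i_def)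
  let ?z = "crd TM i w"
  let ?O = "crd M i ` (dom M i \<inter> dom M j) \<times> (- {0::'e})"
  have zO: "?z \<in> ?O" using slit_overlap[OF i(1) j(1)] i j by blast
  have "((\<lambda>z. transition M i j (fst z)) has_derivative (\<lambda>h. fder (transition M i j) (crd M i (fst w)) (fst h))) (at ?z)"
    by (rule has_derivative_compose[OF has_derivative_fst[OF has_derivative_ident]])
      (use transition_has_derivative[OF i(1) j(1), of "fst w"] i j in simp)
  then have "(crd M j \<circ> fst \<circ> crd_inv TM i has_derivative (\<lambda>h. fder (transition M i j) (crd M i (fst w)) (fst h))) (at ?z)"
  proof (rule has_derivative_transform_within_open[OF _ open_slit_overlap[OF i(1) j(1)] zO])
    fix z assume "z \<in> ?O"
    then obtain v where v: "v \<in> dom TM i" "v \<in> dom TM j" "z = crd TM i v"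
      using slit_overlap[OF i(1) j(1)] by blast
    then show "transition M i j (fst z) = (crd M j \<circ> fst \<circ> crd_inv TM i) z"
      using slit_crd_inv_crd[OF i(1) v(1)] i by simp
  qed
  from fder_eqI[OF this] have "dproj M w \<xi> j = fder (transition M i j) (crd M i (fst w)) (fst (\<xi> i))"
    using j i_def by (simp add: dproj_def tangent_map_def Let_def)
  also have "\<dots> = fst (fder (transition TM i j) ?z (\<xi> i))"
    using slit_transition_fder(1)[OF i(1) j(1) i(2) j(2)] by metis
  also have "\<dots> = fst (\<xi> j)"
    using slit.tangent_transform[OF \<xi>, of i j] i j by auto
  finally show ?thesis .
qed

lemma dproj_tangent:
  assumes \<xi>: "\<xi> \<in> tangent_space TM w" and w: "w \<in> pts TM"
  shows "dproj M w \<xi> \<in> tangent_space M (fst w)"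
proof (rule tangent_spaceI)
  fix i j assume ij: "i \<in> idx M" "j \<in> idx M" and p: "fst w \<in> dom M i" "fst w \<in> dom M j"
  have wij: "w \<in> dom TM i" "w \<in> dom TM j" using w p by auto
  have "fst (\<xi> j) = fst (fder (transition TM i j) (crd TM i w) (\<xi> i))"
    by (rule arg_cong[of _ _ fst], rule slit.tangent_transform[OF \<xi>]) (use ij wij in auto)
  then show "dproj M w \<xi> j = fder (transition M i j) (crd M i (fst w)) (dproj M w \<xi> i)"
    using slit_transition_fder(1)[OF ij wij] dproj_chart[OF \<xi> ij(1) wij(1)] dproj_chart[OF \<xi> ij(2) wij(2)] by simp
qed (auto simp: dproj_def tangent_map_def)

lemma vertical_space_iff:
  assumes i: "i \<in> idx M" "w \<in> dom TM i"
  shows "\<xi> \<in> vertical_space M w \<longleftrightarrow> \<xi> \<in> tangent_space TM w \<and> fst (\<xi> i) = 0"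
proof -
  have w: "w \<in> pts TM" using slit.dom_pts[of i w] i by simp
  have "dproj M w \<xi> = 0 \<longleftrightarrow> fst (\<xi> i) = 0" if \<xi>: "\<xi> \<in> tangent_space TM w"
    using tangent_nonzero_iff[OF dproj_tangent[OF \<xi> w] i(1)] dproj_chart[OF \<xi> i] i by auto
  then show ?thesis by (auto simp: vertical_space_def)
qed

lemma vert_vertical:
  assumes u: "u \<in> tangent_space M (fst w)" and w: "w \<in> pts TM"
  shows "vert M w u \<in> vertical_space M w"
proof -
  obtain i where i: "i \<in> idx M" "w \<in> dom TM i" using slitE[OF w] .
  show ?thesis by (simp add: vertical_space_iff[OF i] vert_tangent[OF u] vert_chart[OF i])
qed

lemma vert_inv_vert:
  assumes u: "u \<in> tangent_space M (fst w)" and w: "w \<in> pts TM"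
  shows "vert_inv M w (vert M w u) = u"
proof -
  obtain i where i: "i \<in> idx M" "w \<in> dom TM i" using slitE[OF w] .
  have "inj_on (vert M w) (tangent_space M (fst w))"
  proof (rule inj_onI)
    fix a b assume ab: "a \<in> tangent_space M (fst w)" "b \<in> tangent_space M (fst w)" "vert M w a = vert M w b"
    from fun_cong[OF ab(3), of i] show "a = b"
      using tangent_eqI[OF ab(1,2) i(1)] i vert_chart[OF i] by simp
  qed
  then show ?thesis unfolding vert_inv_def using u by (rule inv_into_f_f)
qed

text \<open>\<open>vert_inv\<close> is an \<open>inv_into\<close>, which says nothing outside the
  range. Here every vertical vector is shown to be hit, by the base vector with the same fibre
  components.\<close>

lemma vertical_vert_inv:
  assumes \<eta>: "\<eta> \<in> vertical_space M w" and w: "w \<in> pts TM"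
  shows "vert_inv M w \<eta> \<in> tangent_space M (fst w)" "vert M w (vert_inv M w \<eta>) = \<eta>"
    and "i \<in> idx M \<Longrightarrow> w \<in> dom TM i \<Longrightarrow> vert_inv M w \<eta> i = snd (\<eta> i)"
proof -
  obtain j where j: "j \<in> idx M" "w \<in> dom TM j" using slitE[OF w] .
  define u where "u = tvec j (fst w) (snd (\<eta> j))"
  have u: "u \<in> tangent_space M (fst w)" using j by (simp add: u_def)
  have \<eta>': "\<eta> \<in> tangent_space TM w" "fst (\<eta> j) = 0" using \<eta> vertical_space_iff[OF j] by auto
  have eq: "vert M w u = \<eta>"
    by (rule slit.tangent_eqI[OF vert_tangent[OF u] \<eta>'(1), of j])
      (use j \<eta>'(2) vert_chart[OF j] in \<open>simp_all add: u_def prod_eq_iff\<close>)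
  have inv: "vert_inv M w \<eta> = u" using vert_inv_vert[OF u w] eq by simp
  show "vert_inv M w \<eta> \<in> tangent_space M (fst w)" "vert M w (vert_inv M w \<eta>) = \<eta>"
    using inv u eq by auto
  show "vert_inv M w \<eta> i = snd (\<eta> i)" if "i \<in> idx M" "w \<in> dom TM i"
    using inv vert_chart[OF that, of u] eq by simp
qed

lemma tangent_structure_chart:
  "X w \<in> tangent_space TM w \<Longrightarrow> i \<in> idx M \<Longrightarrow> w \<in> dom TM i \<Longrightarrow> tangent_structure M X w i = (0, fst (X w i))"
  by (simp add: tangent_structure_def vert_chart dproj_chart)

lemma vert_outside_pts:
  assumes "w \<notin> pts TM" shows "vert M w u = 0"
proof
  fix i
  have "\<not> (i \<in> idx M \<and> w \<in> dom TM i)" using slit.dom_pts[of i w] assms by auto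
  then show "vert M w u i = 0 i" using vert_outside by simp
qed

lemma vertical_fieldsI:
  assumes X: "\<And>w. w \<in> pts TM \<Longrightarrow> X w \<in> vertical_space M w" "\<And>w. w \<notin> pts TM \<Longrightarrow> X w = 0"
    and h: "\<And>i. i \<in> idx M \<Longrightarrow> C_inf_on (h i) (simg i)"
    and eq: "\<And>i w. i \<in> idx M \<Longrightarrow> w \<in> dom TM i \<Longrightarrow> X w i = h i (crd TM i w)"
  shows "X \<in> vertical_fields M"
proof -
  have "X \<in> vector_fields TM"
  proof (rule slit.vector_fieldsI)
    show "X w \<in> tangent_space TM w" for w
      using X by (cases "w \<in> pts TM") (auto simp: vertical_space_def)
    fix w assume "w \<in> pts TM"
    then obtain i where i: "i \<in> idx M" "w \<in> dom TM i" by (rule slitE)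
    have "C_inf_on (field_rep TM i X) (simg i)"
    proof (rule C_inf_on_cong[OF h[OF i(1)] open_simg[OF i(1)]])
      fix z assume "z \<in> simg i"
      then obtain v where "v \<in> dom TM i" "z = crd TM i v" "crd_inv TM i z = v" using slit_crd_inv i by metis
      then show "h i z = field_rep TM i X z" using eq[OF i(1)] by (simp add: field_rep_def)
    qed
    then show "\<exists>i\<in>idx TM. \<exists>U. w \<in> dom TM i \<and> open U \<and> crd TM i w \<in> U \<and> C_inf_on (field_rep TM i X) U"
      using i open_simg simg_crd by (metis slit_tangent_sel(1))
  qed (rule X)
  then show ?thesis using X by (simp add: vertical_fields_def)
qed

lemma tangent_structure_vertical:
  assumes X: "X \<in> vector_fields TM"
  shows "tangent_structure M X \<in> vertical_fields M"
proof (rule vertical_fieldsI[where h = "\<lambda>i z. (0, fst (field_rep TM i X z))"])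
  show "tangent_structure M X w \<in> vertical_space M w" if "w \<in> pts TM" for w
    unfolding tangent_structure_def by (rule vert_vertical[OF dproj_tangent[OF slit.field_tangent[OF X] that] that])
  show "tangent_structure M X w = 0" if "w \<notin> pts TM" for w
    unfolding tangent_structure_def by (rule vert_outside_pts[OF that])
  show "C_inf_on (\<lambda>z. (0, fst (field_rep TM i X z))) (simg i)" if "i \<in> idx M" for i
    by (intro C_inf_on_Pair C_inf_on_fst slit_rep_C_inf X that C_inf_on_const open_simg)
  show "tangent_structure M X w i = (0, fst (field_rep TM i X (crd TM i w)))"
    if "i \<in> idx M" "w \<in> dom TM i" for i w
    using tangent_structure_chart[where X = X and w = w, OF slit.field_tangent[OF X] that] slit.field_rep_crd[of i w X] that by simp
qed

lemma canonical_chart: "i \<in> idx M \<Longrightarrow> w \<in> dom TM i \<Longrightarrow> canonical_field M w i = (0, snd w i)"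
  by (simp add: canonical_field_def vert_chart)

lemma canonical_vertical: "canonical_field M \<in> vertical_fields M"
proof (rule vertical_fieldsI[where h = "\<lambda>i z. (0, snd z)"])
  show "canonical_field M w \<in> vertical_space M w" if "w \<in> pts TM" for w
    unfolding canonical_field_def using that by (intro vert_vertical) auto
  show "canonical_field M w = 0" if "w \<notin> pts TM" for w
    unfolding canonical_field_def by (rule vert_outside_pts[OF that])
  show "C_inf_on (\<lambda>z. (0, snd z)) (simg i)" if "i \<in> idx M" for i
    by (intro C_inf_on_Pair open_simg that C_inf_on_snd') simp
qed (simp add: canonical_chart)

lemma vertical_fields_field: "X \<in> vertical_fields M \<Longrightarrow> X \<in> vector_fields TM"
  by (simp add: vertical_fields_def)

lemma vertical_fields_chart:
  assumes "X \<in> vertical_fields M" "i \<in> idx M" "w \<in> dom TM i"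
  shows "fst (X w i) = 0"
proof -
  have "w \<in> pts TM" using slit.dom_pts[of i w] assms by simp
  then have "X w \<in> vertical_space M w" using assms(1) unfolding vertical_fields_def by blast
  then show ?thesis using vertical_space_iff[OF assms(2,3)] by blast
qed

subsection \<open>Cutoff functions on the slit tangent bundle\<close>

text \<open>No cutoff in the fibre direction is needed: chart domains of the slit tangent bundle contain
  whole fibres.\<close>

lemma slit_cutoff:
  assumes i: "i \<in> idx M" and \<phi>: "cutoff i \<phi>"
  shows "slit.cutoff i (\<phi> \<circ> fst)"
proof -
  have rep: "(\<phi> \<circ> fst) (crd_inv TM j z) = \<phi> (crd_inv M j (fst z))" if jz: "j \<in> idx M" "z \<in> simg j" for j z
  proof -
    obtain w where "w \<in> dom TM j" "z = crd TM j w" "crd_inv TM j z = w" using slit_crd_inv[OF jz] .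
    then show ?thesis using jz(1) by simp
  qed
  have "smooth_fun TM (\<phi> \<circ> fst)"
  proof (rule slit.smooth_funI)
    fix w assume "w \<in> pts TM"
    then obtain j where j: "j \<in> idx M" "w \<in> dom TM j" by (rule slitE)
    have "C_inf_on (\<lambda>z. (\<phi> \<circ> crd_inv M j) (fst z)) (simg j)"
      by (rule C_inf_on_compose[OF smooth_fun_C_inf[OF cutoff_smooth[OF \<phi>] j(1)]])
        (use j open_simg open_img in auto)
    then have "C_inf_on (\<phi> \<circ> fst \<circ> crd_inv TM j) (simg j)"
      by (rule C_inf_on_cong[OF _ open_simg[OF j(1)]]) (use rep[OF j(1)] in simp)
    then show "\<exists>i\<in>idx TM. \<exists>U. w \<in> dom TM i \<and> open U \<and> crd TM i w \<in> U \<and> C_inf_on (\<phi> \<circ> fst \<circ> crd_inv TM i) U"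
      using j open_simg simg_crd by (metis slit_tangent_sel(1))
  qed
  moreover have "\<exists>A. open A \<and> crd TM j w \<in> A \<and> (\<forall>z\<in>A \<inter> simg j. (\<phi> \<circ> fst) (crd_inv TM j z) = 0)"
    if j: "j \<in> idx M" and w: "w \<in> dom TM j" "w \<notin> dom TM i" for j w
  proof -
    obtain A where A: "open A" "crd M j (fst w) \<in> A" "A \<subseteq> img j" "\<And>x. x \<in> A \<Longrightarrow> \<phi> (crd_inv M j x) = 0"
      using cutoff_nbhd[OF \<phi> j, of "fst w"] w by auto
    \<comment> \<open>The neighbourhood is a cylinder over one in the base, since the pulled back
      function is constant on fibres.\<close>
    have "open (A \<times> (UNIV :: 'e set))" using A by (intro open_Times) auto
    moreover have "crd TM j w \<in> A \<times> UNIV" using A by simp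
    moreover have "(\<phi> \<circ> fst) (crd_inv TM j z) = 0" if "z \<in> A \<times> UNIV \<inter> simg j" for z
      using rep[OF j] that A(4) by auto
    ultimately show ?thesis by (intro exI[of _ "A \<times> UNIV"] conjI ballI)
  qed
  ultimately show ?thesis unfolding slit.cutoff_def slit_tangent_sel(1)
    by (metis DiffD1 DiffD2 slit_img)
qed

text \<open>The base cutoff composed with \<open>fst\<close>. Value 1 and derivative 0 at the point
  survive the pullback by the chain rule.\<close>

lemma slit_cutoff_exists:
  assumes i: "i \<in> idx M" and w: "w \<in> dom TM i"
  obtains \<phi> A where "slit.cutoff i \<phi>" "\<phi> w = 1" "fder (\<phi> \<circ> crd_inv TM i) (crd TM i w) = (\<lambda>v. 0)"
    "open A" "crd TM i w \<in> A" "A \<subseteq> simg i" "\<And>v. v \<in> dom TM i \<Longrightarrow> crd TM i v \<in> A \<Longrightarrow> \<phi> v > 0"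
proof -
  have p: "fst w \<in> dom M i" using w by simp
  obtain \<phi> A where \<phi>: "cutoff i \<phi>" "\<phi> (fst w) = 1" "fder (\<phi> \<circ> crd_inv M i) (crd M i (fst w)) = (\<lambda>v. 0)"
    and A: "open A" "crd M i (fst w) \<in> A" "A \<subseteq> img i" "\<And>z. z \<in> A \<Longrightarrow> \<phi> (crd_inv M i z) > 0"
    using cutoff_exists[OF Hausdorff i p] by blast
  have "(\<phi> \<circ> crd_inv M i has_derivative (\<lambda>v. 0)) (at (fst (crd TM i w)))"
    using C_inf_on_has_derivative[OF smooth_fun_C_inf[OF cutoff_smooth[OF \<phi>(1)] i], of "crd M i (fst w)"] \<phi>(3) p
    by simp
  from has_derivative_compose[OF has_derivative_fst[OF has_derivative_ident] this]
  have "((\<lambda>z. (\<phi> \<circ> crd_inv M i) (fst z)) has_derivative (\<lambda>v. 0)) (at (crd TM i w))" .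
  then have "(\<phi> \<circ> fst \<circ> crd_inv TM i has_derivative (\<lambda>v. 0)) (at (crd TM i w))"
  proof (rule has_derivative_transform_within_open[OF _ open_simg[OF i] simg_crd[OF i w]])
    fix z assume z: "z \<in> simg i"
    obtain v where "v \<in> dom TM i" "z = crd TM i v" "crd_inv TM i z = v" using slit_crd_inv[OF i z] .
    then show "(\<phi> \<circ> crd_inv M i) (fst z) = (\<phi> \<circ> fst \<circ> crd_inv TM i) z" using i by simp
  qed
  then have d: "fder (\<phi> \<circ> fst \<circ> crd_inv TM i) (crd TM i w) = (\<lambda>v. 0)" by (rule fder_eqI)
  show thesis
  proof (rule that[OF slit_cutoff[OF i \<phi>(1)] _ d])
    show "open (A \<times> (- {0::'e}))" using A by (intro open_Times) auto
    show "crd TM i w \<in> A \<times> - {0}" using simg_crd[OF i w] A by auto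
    show "A \<times> - {0} \<subseteq> simg i" using A by auto
    show "(\<phi> \<circ> fst) v > 0" if "v \<in> dom TM i" "crd TM i v \<in> A \<times> - {0}" for v
    proof -
      have "crd M i (fst v) \<in> A" using that(2) by simp
      from A(4)[OF this] show ?thesis using that(1) i by simp
    qed
  qed (use \<phi> in simp)
qed

text \<open>The existence half of every use of \<open>tensor_at\<close>: the constant components of
  \<xi> are extended by a cutoff that equals 1 at \<open>w\<close>.\<close>

lemma slit_extension:
  assumes w: "w \<in> pts TM" and \<xi>: "\<xi> \<in> tangent_space TM w"
  obtains X where "X \<in> vector_fields TM" "X w = \<xi>"
proof -
  obtain i where i: "i \<in> idx M" "w \<in> dom TM i" using slitE[OF w] .
  then have i': "i \<in> idx TM" by simp
  obtain \<phi> where \<phi>: "slit.cutoff i \<phi>" "\<phi> w = 1" using slit_cutoff_exists[OF i] by metis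
  show thesis
  proof
    show "slit.cutoff_field i \<phi> (\<lambda>x. \<xi> i) \<in> vector_fields TM"
      by (rule slit.cutoff_field_field[OF i' \<phi>(1)]) simp
    show "slit.cutoff_field i \<phi> (\<lambda>x. \<xi> i) w = \<xi>"
      by (rule slit.tangent_eqI[OF slit.cutoff_field_tangent[OF i'] \<xi> i' i(2)])
        (use slit.cutoff_field_chart[OF i' i(2)] \<phi> in simp)
  qed
qed

lemma vertical_0:
  assumes "w \<in> pts TM" shows "0 \<in> vertical_space M w"
proof -
  obtain i where i: "i \<in> idx M" "w \<in> dom TM i" using slitE[OF assms] .
  show ?thesis by (simp add: vertical_space_iff[OF i])
qed

lemma vertical_add:
  assumes "w \<in> pts TM" "\<xi> \<in> vertical_space M w" "\<eta> \<in> vertical_space M w"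
  shows "\<xi> + \<eta> \<in> vertical_space M w"
proof -
  obtain i where i: "i \<in> idx M" "w \<in> dom TM i" using slitE[OF assms(1)] .
  show ?thesis using assms(2,3) slit.tangent_add unfolding vertical_space_iff[OF i] by simp
qed

lemma vertical_scaleR:
  assumes "w \<in> pts TM" "\<xi> \<in> vertical_space M w"
  shows "r *\<^sub>R \<xi> \<in> vertical_space M w"
proof -
  obtain i where i: "i \<in> idx M" "w \<in> dom TM i" using slitE[OF assms(1)] .
  have "(r *\<^sub>R \<xi>) i = r *\<^sub>R \<xi> i" by (simp add: scaleR_fun_def)
  then show ?thesis using assms(2) slit.tangent_scaleR unfolding vertical_space_iff[OF i] by simp
qed

lemma vertical_sum:
  assumes "w \<in> pts TM" "\<And>k. k \<in> B \<Longrightarrow> f k \<in> vertical_space M w"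
  shows "(\<Sum>k\<in>B. f k) \<in> vertical_space M w"
  using assms(2)
proof (induction B rule: infinite_finite_induct)
  case (insert k B)
  then show ?case unfolding sum.insert[OF insert(1,2)]
    by (intro vertical_add[OF assms(1)] insert.IH insert.prems insertI1 insertI2)
qed (simp_all only: sum.infinite sum.empty vertical_0[OF assms(1)] not_False_eq_True)

lemma vertical_field_0: "0 \<in> vertical_fields M"
  using slit.field_0 vertical_0 by (simp add: vertical_fields_def)

lemma vertical_field_add: "X \<in> vertical_fields M \<Longrightarrow> Y \<in> vertical_fields M \<Longrightarrow> X + Y \<in> vertical_fields M"
  using slit.field_add vertical_add by (auto simp: vertical_fields_def)

lemma vertical_field_scale: "X \<in> vertical_fields M \<Longrightarrow> smooth_fun TM f \<Longrightarrow> (\<lambda>w. f w *\<^sub>R X w) \<in> vertical_fields M"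
  using slit.field_scale vertical_scaleR by (auto simp: vertical_fields_def)

text \<open>As \<open>k\<close> runs through the basis, these global sections form a frame of the
  vertical bundle wherever \<phi> is nonzero on the chart domain.\<close>

lemma vertical_cutoff_field:
  assumes i: "i \<in> idx M" and \<phi>: "slit.cutoff i \<phi>"
  shows "slit.cutoff_field i \<phi> (\<lambda>z. (0, k)) \<in> vertical_fields M"
proof -
  have i': "i \<in> idx TM" using i by simp
  have "slit.cutoff_field i \<phi> (\<lambda>z. (0, k)) w \<in> vertical_space M w" if w: "w \<in> pts TM" for w
  proof (cases "w \<in> dom TM i")
    case True
    then show ?thesis
      unfolding vertical_space_iff[OF i True]
      using slit.cutoff_field_tangent[OF i'] slit.cutoff_field_chart[OF i' True] by simp
  next
    case False
    then have "slit.cutoff_field i \<phi> (\<lambda>z. (0, k)) w = 0" unfolding slit.cutoff_field_def by (simp only: if_False)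
    then show ?thesis using vertical_0[OF w] by simp
  qed
  moreover have "slit.cutoff_field i \<phi> (\<lambda>z. (0, k)) \<in> vector_fields TM"
    by (rule slit.cutoff_field_field[OF i' \<phi>]) simp
  ultimately show ?thesis by (simp add: vertical_fields_def)
qed

end

section \<open>The canonical connection of a spray in coordinates\<close>

locale spray_atlas = slit_atlas M for M :: "('a, 'i, 'e::euclidean_space) mfd" +
  fixes S :: "('a, 'i, 'e) slit_field"
  assumes spray: "spray M S"
begin

text \<open>In classical spray notation this is -2 G, so that \<open>conn_coeff\<close> is the fibre
  derivative of G. In a chart geodesics solve x'' = \<open>spray_coeff\<close>(x, x').\<close>

definition spray_coeff :: "'i \<Rightarrow> 'e \<times> 'e \<Rightarrow> 'e"
  where "spray_coeff i z = snd (field_rep TM i S z)"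

text \<open>The coefficients of the nonlinear connection: a vector with components \<open>(a, b)\<close> is
  horizontal iff \<open>b = - N a\<close>.\<close>

definition conn_coeff :: "'i \<Rightarrow> 'e \<times> 'e \<Rightarrow> 'e \<Rightarrow> 'e"
  where "conn_coeff i z a = - (1/2) *\<^sub>R fder (spray_coeff i) z (0, a)"

lemma S_field: "S \<in> vector_fields TM"
  using spray by (simp add: spray_def)

lemma spray_coeff_C_inf: "i \<in> idx M \<Longrightarrow> C_inf_on (spray_coeff i) (simg i)"
  unfolding spray_coeff_def[abs_def]
  by (intro C_inf_on_snd slit_rep_C_inf[OF S_field] open_simg)

lemma spray_chart:
  assumes "i \<in> idx M" "w \<in> dom TM i"
  shows "S w i = (snd w i, spray_coeff i (crd TM i w))"
proof -
  have "tangent_structure M S w i = canonical_field M w i" using spray by (simp add: spray_def)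
  then have "fst (S w i) = snd w i"
    using tangent_structure_chart[where X = S and w = w, OF slit.field_tangent[OF S_field] assms]
      canonical_chart[OF assms] by simp
  moreover have "snd (S w i) = spray_coeff i (crd TM i w)"
    using slit.field_rep_crd[of i w S] assms by (simp add: spray_coeff_def)
  ultimately show ?thesis by (simp add: prod_eq_iff)
qed

lemma spray_rep:
  assumes "i \<in> idx M" "z \<in> simg i"
  shows "field_rep TM i S z = (snd z, spray_coeff i z)"
proof -
  obtain w where w: "w \<in> dom TM i" "z = crd TM i w" "crd_inv TM i z = w" using slit_crd_inv[OF assms] .
  show ?thesis using spray_chart[OF assms(1) w(1)] w by (simp add: field_rep_def)
qed

lemma fder_spray_rep:
  assumes "i \<in> idx M" "z \<in> simg i"
  shows "fder (field_rep TM i S) z v = (snd v, fder (spray_coeff i) z v)"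
proof -
  have "((\<lambda>z. (snd z, spray_coeff i z)) has_derivative (\<lambda>v. (snd v, fder (spray_coeff i) z v))) (at z)"
    by (intro has_derivative_Pair has_derivative_snd has_derivative_ident
        C_inf_on_has_derivative[OF spray_coeff_C_inf[OF assms(1)] assms(2)])
  then have "(field_rep TM i S has_derivative (\<lambda>v. (snd v, fder (spray_coeff i) z v))) (at z)"
    by (rule has_derivative_transform_within_open[OF _ open_simg[OF assms(1)] assms(2)])
      (simp add: spray_rep[OF assms(1)])
  from fder_eqI[OF this] show ?thesis by simp
qed

lemma canonical_rep:
  assumes "i \<in> idx M" "z \<in> simg i"
  shows "field_rep TM i (canonical_field M) z = (0, snd z)"
proof -
  obtain w where w: "w \<in> dom TM i" "z = crd TM i w" "crd_inv TM i z = w" using slit_crd_inv[OF assms] .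
  show ?thesis using canonical_chart[OF assms(1) w(1)] w by (simp add: field_rep_def)
qed

lemma fder_canonical_rep:
  assumes "i \<in> idx M" "z \<in> simg i"
  shows "fder (field_rep TM i (canonical_field M)) z v = (0, snd v)"
proof -
  have "((\<lambda>z. (0::'e, snd z :: 'e)) has_derivative (\<lambda>v. (0, snd v))) (at z)"
    by (intro has_derivative_Pair has_derivative_snd has_derivative_ident has_derivative_const)
  then have "(field_rep TM i (canonical_field M) has_derivative (\<lambda>v. (0, snd v))) (at z)"
    by (rule has_derivative_transform_within_open[OF _ open_simg[OF assms(1)] assms(2)])
      (simp add: canonical_rep[OF assms(1)])
  from fder_eqI[OF this] show ?thesis by simp
qed

text \<open>The fibre component of [C, S] = S reads D\<sigma>(0, y) - \<sigma> = \<sigma>: Euler's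
  relation for homogeneity of degree 2.\<close>

lemma spray_coeff_homogeneous:
  assumes i: "i \<in> idx M" and w: "w \<in> dom TM i"
  shows "fder (spray_coeff i) (crd TM i w) (0, snd w i) = 2 *\<^sub>R spray_coeff i (crd TM i w)"
proof -
  have z: "crd TM i w \<in> simg i" by (rule simg_crd[OF i w])
  have "lie_bracket TM (canonical_field M) S w i = S w i" using spray by (simp add: spray_def)
  then have "snd (fder (field_rep TM i S) (crd TM i w) (0, snd w i)
      - fder (field_rep TM i (canonical_field M)) (crd TM i w) (S w i)) = spray_coeff i (crd TM i w)"
    using slit.lie_bracket_chart[of i w "canonical_field M" S] i w canonical_chart[OF i w] spray_chart[OF i w] by simp
  then show ?thesis
    by (simp add: fder_spray_rep[OF i z] fder_canonical_rep[OF i z] spray_chart[OF i w] scaleR_2 diff_eq_eq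
        del: slit_tangent_sel(4))
qed

text \<open>The factor 1/2 in \<open>conn_coeff\<close> meets the degree 2 of homogeneity. In terms
  of the splitting this is the horizontality of \<open>S\<close>.\<close>

lemma conn_coeff_self:
  assumes "i \<in> idx M" "w \<in> dom TM i"
  shows "conn_coeff i (crd TM i w) (snd w i) = - spray_coeff i (crd TM i w)"
  unfolding conn_coeff_def spray_coeff_homogeneous[OF assms] by simp

lemma linear_conn_coeff:
  assumes "i \<in> idx M" "z \<in> simg i"
  shows "linear (conn_coeff i z)"
proof -
  have l: "linear (fder (spray_coeff i) z)"
    by (rule linear_frechet_derivative[OF C_inf_on_differentiable[OF spray_coeff_C_inf[OF assms(1)] assms(2)]])
  have "linear (\<lambda>a. (0::'e, a::'e))" by (intro linearI) auto
  from linear_compose_scale_right[OF linear_compose[OF this l], of "- (1/2)"]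
  show ?thesis unfolding conn_coeff_def[abs_def] by (simp add: o_def)
qed

lemma conn_coeff_C_inf:
  assumes i: "i \<in> idx M" and g: "C_inf_on g A" "C_inf_on a A" "open A" "g ` A \<subseteq> simg i"
  shows "C_inf_on (\<lambda>x. conn_coeff i (g x) (a x)) A"
  unfolding conn_coeff_def[abs_def]
  by (intro C_inf_on_bounded_linear[OF bounded_linear_scaleR_right] C_inf_on_fder_apply[OF spray_coeff_C_inf[OF i]]
      C_inf_on_Pair open_simg i g C_inf_on_const)

lemma fder_spray_coeff_split:
  assumes "i \<in> idx M" "z \<in> simg i"
  shows "fder (spray_coeff i) z (a, b) = fder (spray_coeff i) z (a, 0) - 2 *\<^sub>R conn_coeff i z b"
proof -
  have "linear (fder (spray_coeff i) z)"
    by (rule linear_frechet_derivative[OF C_inf_on_differentiable[OF spray_coeff_C_inf[OF assms(1)] assms(2)]])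
  from linear_add[OF this, of "(a, 0)" "(0, b)"] show ?thesis by (simp add: conn_coeff_def)
qed

text \<open>\<open>conn_coeff\<close> is up to a constant a directional derivative of the spray
  coefficient, so the product rule for \<open>fder\<close> applies, with the vertical direction
  \<open>(0, a x)\<close> as the varying one.\<close>

lemma conn_coeff_has_derivative:
  assumes i: "i \<in> idx M" and g: "(g has_derivative g') (at x within J)" "g x \<in> simg i" "x \<in> J"
    and a: "(a has_derivative a') (at x within J)"
  shows "((\<lambda>x. conn_coeff i (g x) (a x)) has_derivative
    (\<lambda>h. fder (\<lambda>z. conn_coeff i z (a x)) (g x) (g' h) + conn_coeff i (g x) (a' h))) (at x within J)"
proof -
  have C: "C_inf_on (\<lambda>z. fder (spray_coeff i) z (0, a x)) (simg i)" by (rule C_inf_on_fder[OF spray_coeff_C_inf[OF i]])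
  have "((\<lambda>z. conn_coeff i z (a x)) has_derivative
      (\<lambda>v. - (1/2) *\<^sub>R fder (\<lambda>z. fder (spray_coeff i) z (0, a x)) (g x) v)) (at (g x))"
    unfolding conn_coeff_def by (rule has_derivative_scaleR_right[OF C_inf_on_has_derivative[OF C g(2)]])
  note eq = fder_eqI[OF this]
  have "((\<lambda>x. fder (spray_coeff i) (g x) (0, a x)) has_derivative
      (\<lambda>h. fder (\<lambda>y. fder (spray_coeff i) y (0, a x)) (g x) (g' h) + fder (spray_coeff i) (g x) (0, a' h))) (at x within J)"
    by (rule has_derivative_fder_apply[OF spray_coeff_C_inf[OF i] open_simg[OF i] g(2,3,1)])
      (intro has_derivative_Pair has_derivative_const a)
  from has_derivative_scaleR_right[OF this, of "- (1/2)"]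
  show ?thesis unfolding eq unfolding conn_coeff_def scaleR_add_right .
qed

subsection \<open>Horizontal vectors\<close>

lemma spray_connection_tangent:
  assumes Y: "Y \<in> vector_fields TM"
  shows "spray_connection M S Y w \<in> tangent_space TM w"
proof -
  have "tangent_structure M Z w \<in> tangent_space TM w" if "Z \<in> vector_fields TM" for Z
    using slit.field_tangent[OF vertical_fields_field[OF tangent_structure_vertical[OF that]]] .
  moreover have "lie_bracket TM S (tangent_structure M Y) w \<in> tangent_space TM w"
    by (rule slit.lie_bracket_tangent[OF S_field vertical_fields_field[OF tangent_structure_vertical[OF Y]]])
  moreover have "spray_connection M S Y w
      = tangent_structure M (lie_bracket TM S Y) w - lie_bracket TM S (tangent_structure M Y) w"
    unfolding spray_connection_def by (rule minus_apply)
  ultimately show ?thesis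
    using slit.lie_bracket_field[OF S_field Y] slit.tangent_diff by metis
qed

lemma tangent_structure_rep:
  assumes Y: "Y \<in> vector_fields TM" and i: "i \<in> idx M" and z: "z \<in> simg i"
  shows "field_rep TM i (tangent_structure M Y) z = (0, fst (field_rep TM i Y z))"
    and "fder (field_rep TM i (tangent_structure M Y)) z v = (0, fst (fder (field_rep TM i Y) z v))"
proof -
  have rep: "field_rep TM i (tangent_structure M Y) z = (0, fst (field_rep TM i Y z))" if "z \<in> simg i" for z
  proof -
    obtain w where w: "w \<in> dom TM i" "z = crd TM i w" "crd_inv TM i z = w" using slit_crd_inv[OF i \<open>z \<in> simg i\<close>] .
    show ?thesis
      using tangent_structure_chart[where X = Y and w = w, OF slit.field_tangent[OF Y] i w(1)] w(3)
      by (simp add: field_rep_def)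
  qed
  then show "field_rep TM i (tangent_structure M Y) z = (0, fst (field_rep TM i Y z))" using z .
  have "((\<lambda>z. (0::'e, fst (field_rep TM i Y z))) has_derivative (\<lambda>v. (0, fst (fder (field_rep TM i Y) z v)))) (at z)"
    by (intro has_derivative_Pair has_derivative_const has_derivative_fst
        C_inf_on_has_derivative[OF slit_rep_C_inf[OF Y i] z])
  then have "(field_rep TM i (tangent_structure M Y) has_derivative (\<lambda>v. (0, fst (fder (field_rep TM i Y) z v)))) (at z)"
    by (rule has_derivative_transform_within_open[OF _ open_simg[OF i] z]) (simp add: rep)
  from fder_eqI[OF this]
  show "fder (field_rep TM i (tangent_structure M Y)) z v = (0, fst (fder (field_rep TM i Y) z v))" by simp
qed

text \<open>The derivative of the base part of \<open>Y\<close> along \<open>S\<close> occurs in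
  both brackets and cancels. What remains is algebraic in the value of \<open>Y\<close>, which is
  the tensoriality behind \<open>tensor_at\<close>.\<close>

lemma spray_connection_chart:
  assumes Y: "Y \<in> vector_fields TM" and i: "i \<in> idx M" and w: "w \<in> dom TM i"
  shows "spray_connection M S Y w i
    = (fst (Y w i), - snd (Y w i) - 2 *\<^sub>R conn_coeff i (crd TM i w) (fst (Y w i)))"
proof -
  have z: "crd TM i w \<in> simg i" by (rule simg_crd[OF i w])
  have i': "i \<in> idx TM" using i by simp
  let ?F = "fder (field_rep TM i Y) (crd TM i w) (S w i)"
  have JY: "tangent_structure M Y w i = (0, fst (Y w i))"
    by (rule tangent_structure_chart[where X = Y and w = w, OF slit.field_tangent[OF Y] i w])
  have "tangent_structure M (lie_bracket TM S Y) w i = (0, fst (lie_bracket TM S Y w i))"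
    by (rule tangent_structure_chart[where X = "lie_bracket TM S Y" and w = w,
          OF slit.lie_bracket_tangent[OF S_field Y] i w])
  also have "\<dots> = (0, fst ?F - snd (Y w i))"
    by (simp add: slit.lie_bracket_chart[OF i' w] fder_spray_rep[OF i z] del: slit_tangent_sel(4))
  finally have 1: "tangent_structure M (lie_bracket TM S Y) w i = (0, fst ?F - snd (Y w i))" .
  have 2: "lie_bracket TM S (tangent_structure M Y) w i
      = (- fst (Y w i), fst ?F - fder (spray_coeff i) (crd TM i w) (0, fst (Y w i)))"
    by (simp add: slit.lie_bracket_chart[OF i' w] fder_spray_rep[OF i z] tangent_structure_rep(2)[OF Y i z] JY
        del: slit_tangent_sel(4))
  show ?thesis unfolding spray_connection_def minus_apply 1 2 by (simp add: conn_coeff_def)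
qed

lemma tensor_at_spray_connection:
  assumes Y: "Y \<in> vector_fields TM" and w: "w \<in> pts TM"
  shows "tensor_at TM (spray_connection M S) w (Y w) = spray_connection M S Y w"
proof (rule slit.tensor_at_eqI[OF Y refl])
  fix Z assume Z: "Z \<in> vector_fields TM" "Z w = Y w"
  obtain i where i: "i \<in> idx M" "w \<in> dom TM i" using slitE[OF w] .
  show "spray_connection M S Z w = spray_connection M S Y w"
    by (rule slit.tangent_eqI[OF spray_connection_tangent[OF Z(1)] spray_connection_tangent[OF Y], of i])
      (use i Z spray_connection_chart[OF Z(1) i] spray_connection_chart[OF Y i] in simp_all)
qed

text \<open>The fixed point equation is (a, - b - 2 N a) = (a, b), that is b = - N a.\<close>

lemma horizontal_space_iff:
  assumes i: "i \<in> idx M" and w: "w \<in> dom TM i"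
  shows "\<xi> \<in> horizontal_space M S w \<longleftrightarrow>
    \<xi> \<in> tangent_space TM w \<and> snd (\<xi> i) = - conn_coeff i (crd TM i w) (fst (\<xi> i))"
proof -
  have pw: "w \<in> pts TM" using slit.dom_pts[of i w] i w by simp
  have "tensor_at TM (spray_connection M S) w \<xi> = \<xi> \<longleftrightarrow> snd (\<xi> i) = - conn_coeff i (crd TM i w) (fst (\<xi> i))"
    if \<xi>: "\<xi> \<in> tangent_space TM w"
  proof -
    obtain Y where Y: "Y \<in> vector_fields TM" "Y w = \<xi>" using slit_extension[OF pw \<xi>] .
    let ?c = "conn_coeff i (crd TM i w) (fst (\<xi> i))"
    have "tensor_at TM (spray_connection M S) w \<xi> = spray_connection M S Y w"
      using tensor_at_spray_connection[OF Y(1) pw] Y(2) by simp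
    then have "tensor_at TM (spray_connection M S) w \<xi> = \<xi> \<longleftrightarrow> spray_connection M S Y w i = \<xi> i"
      using slit.tangent_eqI[OF spray_connection_tangent[OF Y(1)] \<xi>, of i] i w by auto
    also have "\<dots> \<longleftrightarrow> - snd (\<xi> i) - 2 *\<^sub>R ?c = snd (\<xi> i)"
      using spray_connection_chart[OF Y(1) i w] Y(2) by (simp add: prod_eq_iff)
    also have "\<dots> \<longleftrightarrow> snd (\<xi> i) = - ?c"
    proof
      assume "- snd (\<xi> i) - 2 *\<^sub>R ?c = snd (\<xi> i)"
      moreover have "2 *\<^sub>R (snd (\<xi> i) + ?c) = snd (\<xi> i) - (- snd (\<xi> i) - 2 *\<^sub>R ?c)"
        by (simp add: scaleR_2)
      ultimately have "snd (\<xi> i) + ?c = 0" by (metis diff_self scaleR_eq_0_iff zero_neq_numeral)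
      then show "snd (\<xi> i) = - ?c" by (simp only: eq_neg_iff_add_eq_0)
    qed (simp add: scaleR_2)
    finally show ?thesis .
  qed
  then show ?thesis by (auto simp: horizontal_space_def)
qed

text \<open>The splitting is (a, b) = (a, - N a) + (0, b + N a). In the chart both conditions on the
  vertical summand together prescribe its components, which gives uniqueness.\<close>

lemma vertical_part_chart:
  assumes i: "i \<in> idx M" and w: "w \<in> dom TM i" and \<xi>: "\<xi> \<in> tangent_space TM w"
  shows "vertical_part M S w \<xi> i = (0, snd (\<xi> i) + conn_coeff i (crd TM i w) (fst (\<xi> i)))"
proof -
  have i': "i \<in> idx TM" using i by simp
  define \<eta> where "\<eta> = slit.tvec i w (0, snd (\<xi> i) + conn_coeff i (crd TM i w) (fst (\<xi> i)))"
  have \<eta>: "\<eta> \<in> tangent_space TM w" "\<eta> i = (0, snd (\<xi> i) + conn_coeff i (crd TM i w) (fst (\<xi> i)))"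
    using slit.tvec_tangent[OF i' w] slit.tvec_self[OF i' w] by (simp_all add: \<eta>_def)
  have iff: "\<zeta> \<in> vertical_space M w \<and> \<xi> - \<zeta> \<in> horizontal_space M S w \<longleftrightarrow> \<zeta> \<in> tangent_space TM w \<and> \<zeta> i = \<eta> i" for \<zeta>
    unfolding vertical_space_iff[OF i w] horizontal_space_iff[OF i w]
    using slit.tangent_diff[OF \<xi>, of \<zeta>] \<eta>(2) by (auto simp: prod_eq_iff algebra_simps)
  have "vertical_part M S w \<xi> = \<eta>"
    unfolding vertical_part_def iff
  proof (rule the_equality)
    show "\<zeta> = \<eta>" if "\<zeta> \<in> tangent_space TM w \<and> \<zeta> i = \<eta> i" for \<zeta>
      using slit.tangent_eqI[OF _ \<eta>(1) i' w] that by blast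
  qed (use \<eta>(1) in blast)
  then show ?thesis using \<eta> by simp
qed

lemma horizontal_lift_chart:
  assumes i: "i \<in> idx M" and w: "w \<in> dom TM i" and u: "u \<in> tangent_space M (fst w)"
  shows "horizontal_lift M S w u \<in> tangent_space TM w"
    and "horizontal_lift M S w u i = (u i, - conn_coeff i (crd TM i w) (u i))"
proof -
  have i': "i \<in> idx TM" and pw: "w \<in> pts TM" using slit.dom_pts[of i w] i w by simp_all
  define \<eta> where "\<eta> = slit.tvec i w (u i, - conn_coeff i (crd TM i w) (u i))"
  have \<eta>: "\<eta> \<in> tangent_space TM w" "\<eta> i = (u i, - conn_coeff i (crd TM i w) (u i))"
    using slit.tvec_tangent[OF i' w] slit.tvec_self[OF i' w] by (simp_all add: \<eta>_def)
  have d: "dproj M w \<zeta> = u \<longleftrightarrow> fst (\<zeta> i) = u i" if "\<zeta> \<in> tangent_space TM w" for \<zeta>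
    using tangent_eqI[OF dproj_tangent[OF that pw] u i] dproj_chart[OF that i w] w by auto
  have iff: "\<zeta> \<in> horizontal_space M S w \<and> dproj M w \<zeta> = u \<longleftrightarrow> \<zeta> \<in> tangent_space TM w \<and> \<zeta> i = \<eta> i" for \<zeta>
  proof -
    have "\<zeta> \<in> horizontal_space M S w \<and> dproj M w \<zeta> = u \<longleftrightarrow> \<zeta> \<in> tangent_space TM w \<and>
        snd (\<zeta> i) = - conn_coeff i (crd TM i w) (fst (\<zeta> i)) \<and> fst (\<zeta> i) = u i"
      unfolding horizontal_space_iff[OF i w] using d by blast
    then show ?thesis by (auto simp: \<eta>(2) prod_eq_iff)
  qed
  have "horizontal_lift M S w u = \<eta>"
    unfolding horizontal_lift_def iff
  proof (rule the_equality)
    show "\<zeta> = \<eta>" if "\<zeta> \<in> tangent_space TM w \<and> \<zeta> i = \<eta> i" for \<zeta>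
      using slit.tangent_eqI[OF _ \<eta>(1) i' w] that by blast
  qed (use \<eta>(1) in blast)
  then show "horizontal_lift M S w u \<in> tangent_space TM w"
    "horizontal_lift M S w u i = (u i, - conn_coeff i (crd TM i w) (u i))" using \<eta> by simp_all
qed

end

section \<open>Linear connections in coordinates\<close>

locale connection_atlas = slit_atlas M for M :: "('a, 'i, 'e::euclidean_space) mfd" +
  fixes nabla :: "('a, 'i, 'e) connection"
  assumes linear_connection: "linear_connection M nabla"
begin

lemma nabla_vertical: "X \<in> vector_fields TM \<Longrightarrow> \<sigma> \<in> vertical_fields M \<Longrightarrow> nabla X \<sigma> \<in> vertical_fields M"
  using linear_connection unfolding linear_connection_def by blast

lemma nabla_add_left: "X \<in> vector_fields TM \<Longrightarrow> Y \<in> vector_fields TM \<Longrightarrow> \<sigma> \<in> vertical_fields M \<Longrightarrow>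
    nabla (X + Y) \<sigma> = nabla X \<sigma> + nabla Y \<sigma>"
  using linear_connection unfolding linear_connection_def by blast

lemma nabla_add_right: "X \<in> vector_fields TM \<Longrightarrow> \<sigma> \<in> vertical_fields M \<Longrightarrow> \<tau> \<in> vertical_fields M \<Longrightarrow>
    nabla X (\<sigma> + \<tau>) = nabla X \<sigma> + nabla X \<tau>"
  using linear_connection unfolding linear_connection_def by blast

lemma nabla_scale_left:
  assumes "X \<in> vector_fields TM" "\<sigma> \<in> vertical_fields M" "smooth_fun TM f"
  shows "nabla (\<lambda>w. f w *\<^sub>R X w) \<sigma> w = f w *\<^sub>R nabla X \<sigma> w"
proof -
  have "nabla (\<lambda>w. f w *\<^sub>R X w) \<sigma> = (\<lambda>w. f w *\<^sub>R nabla X \<sigma> w)"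
    using bspec[OF bspec[OF linear_connection[unfolded linear_connection_def] assms(1)] assms(2)] assms(3)
    by (elim conjE allE[of _ f]) simp
  then show ?thesis by (rule fun_cong)
qed

lemma nabla_Leibniz:
  assumes "X \<in> vector_fields TM" "\<sigma> \<in> vertical_fields M" "smooth_fun TM f"
  shows "nabla X (\<lambda>w. f w *\<^sub>R \<sigma> w) w = dir_deriv TM w (X w) f *\<^sub>R \<sigma> w + f w *\<^sub>R nabla X \<sigma> w"
proof -
  have "nabla X (\<lambda>w. f w *\<^sub>R \<sigma> w) = (\<lambda>w. dir_deriv TM w (X w) f *\<^sub>R \<sigma> w + f w *\<^sub>R nabla X \<sigma> w)"
    using bspec[OF bspec[OF linear_connection[unfolded linear_connection_def] assms(1)] assms(2)] assms(3)
    by (elim conjE allE[of _ f]) simp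
  then show ?thesis by (rule fun_cong)
qed

lemma nabla_0_left: "\<sigma> \<in> vertical_fields M \<Longrightarrow> nabla 0 \<sigma> = 0"
  using nabla_add_left[OF slit.field_0 slit.field_0] by simp

lemma nabla_0_right: "X \<in> vector_fields TM \<Longrightarrow> nabla X 0 = 0"
  using nabla_add_right[OF _ vertical_field_0 vertical_field_0] by simp

lemma nabla_sum_left:
  assumes "finite B" "\<And>k. k \<in> B \<Longrightarrow> F k \<in> vector_fields TM" and \<sigma>: "\<sigma> \<in> vertical_fields M"
  shows "(\<Sum>k\<in>B. F k) \<in> vector_fields TM \<and> nabla (\<Sum>k\<in>B. F k) \<sigma> = (\<Sum>k\<in>B. nabla (F k) \<sigma>)"
  using assms(1,2)
proof (induction B)
  case empty
  then show ?case using slit.field_0 nabla_0_left[OF \<sigma>] by (simp only: sum.empty)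
next
  case (insert k B)
  have B: "\<And>j. j \<in> B \<Longrightarrow> F j \<in> vector_fields TM" and k: "F k \<in> vector_fields TM" using insert.prems by auto
  show ?case
    unfolding sum.insert[OF insert(1,2)]
    using slit.field_add[OF k] nabla_add_left[OF _ _ \<sigma>] insert.IH[OF B] k by metis
qed

lemma nabla_sum_right:
  assumes "finite B" "\<And>k. k \<in> B \<Longrightarrow> F k \<in> vertical_fields M" and X: "X \<in> vector_fields TM"
  shows "(\<Sum>k\<in>B. F k) \<in> vertical_fields M \<and> nabla X (\<Sum>k\<in>B. F k) = (\<Sum>k\<in>B. nabla X (F k))"
  using assms(1,2)
proof (induction B)
  case empty
  then show ?case using vertical_field_0 nabla_0_right[OF X] by (simp only: sum.empty)
next
  case (insert k B)
  have B: "\<And>j. j \<in> B \<Longrightarrow> F j \<in> vertical_fields M" and k: "F k \<in> vertical_fields M" using insert.prems by auto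
  show ?case
    unfolding sum.insert[OF insert(1,2)]
    using vertical_field_add[OF k] nabla_add_right[OF X] insert.IH[OF B] k by metis
qed

lemma nabla_pointwise:
  assumes X: "X \<in> vector_fields TM" "X' \<in> vector_fields TM" "X w = X' w"
    and \<sigma>: "\<sigma> \<in> vertical_fields M" and w: "w \<in> pts TM"
  shows "nabla X \<sigma> w = nabla X' \<sigma> w"
proof -
  obtain i where i: "i \<in> idx M" "w \<in> dom TM i" using slitE[OF w] .
  have i': "i \<in> idx TM" using i by simp
  obtain \<phi> where \<phi>: "slit.cutoff i \<phi>" "\<phi> w = 1" using slit_cutoff_exists[OF i] by metis
  let ?e = "\<lambda>k. slit.cutoff_field i \<phi> (\<lambda>z. k)"
  have e: "?e k \<in> vector_fields TM" for k by (rule slit.cutoff_field_field[OF i' \<phi>(1)]) simp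
  have "nabla X \<sigma> w = (\<Sum>k\<in>Basis. (X w i \<bullet> k) *\<^sub>R nabla (?e k) \<sigma> w)" if X: "X \<in> vector_fields TM" for X
  proof -
    define f where "f = (\<lambda>k v. \<phi> v * (field_rep TM i X (crd TM i v) \<bullet> k))"
    have f: "smooth_fun TM (f k)" for k
      unfolding f_def
      by (rule slit.cutoff_fun[OF i' \<phi>(1)]) (intro C_inf_on_inner_left slit.field_rep_C_inf[OF X i'] slit.open_img[OF i'])
    have s: "smooth_fun TM (\<lambda>v. \<phi> v * \<phi> v)"
      by (intro slit.smooth_fun_mult slit.cutoff_smooth[OF \<phi>(1)])
    have "(\<lambda>v. (\<phi> v * \<phi> v) *\<^sub>R X v) = (\<Sum>k\<in>Basis. (\<lambda>v. f k v *\<^sub>R ?e k v))"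
      unfolding f_def
    proof (rule slit.cutoff_field_expansion[OF i' \<phi>(1) X, where h = "\<lambda>k z. field_rep TM i X z \<bullet> k" and e = "\<lambda>k. k"])
      show "(\<Sum>k\<in>Basis. (field_rep TM i X (crd TM i p) \<bullet> k) *\<^sub>R k) = X p i" if "p \<in> dom TM i" for p
        unfolding slit.field_rep_crd[OF i' that] by (rule euclidean_representation)
    qed
    then have "nabla (\<lambda>v. (\<phi> v * \<phi> v) *\<^sub>R X v) \<sigma> w = (\<Sum>k\<in>Basis. nabla (\<lambda>v. f k v *\<^sub>R ?e k v) \<sigma>) w"
      using conjunct2[OF nabla_sum_left[where F = "\<lambda>k v. f k v *\<^sub>R ?e k v", OF finite_Basis slit.field_scale[OF e f] \<sigma>]]
      by (simp only:)
    also have "\<dots> = (\<Sum>k\<in>Basis. f k w *\<^sub>R nabla (?e k) \<sigma> w)"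
      unfolding sum_fun_apply by (simp only: nabla_scale_left[OF e \<sigma> f])
    also have "\<dots> = (\<Sum>k\<in>Basis. (X w i \<bullet> k) *\<^sub>R nabla (?e k) \<sigma> w)"
      unfolding f_def \<phi>(2) slit.field_rep_crd[OF i' i(2)] by (simp only: mult_1_left)
    finally show ?thesis unfolding nabla_scale_left[OF X \<sigma> s] by (simp only: \<phi>(2) mult_1_left scaleR_one)
  qed
  from this[OF X(1)] this[OF X(2)] show ?thesis by (simp only: X(3))
qed

lemma tensor_at_nabla:
  assumes "X \<in> vector_fields TM" "w \<in> pts TM" "\<sigma> \<in> vertical_fields M"
  shows "tensor_at TM (\<lambda>X. nabla X \<sigma>) w (X w) = nabla X \<sigma> w"
  by (rule slit.tensor_at_eqI[OF assms(1) refl]) (rule nabla_pointwise[OF _ assms(1) _ assms(3,2)])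

text \<open>The point \<open>w\<close> is kept fixed, so no regularity of the Christoffel symbols in \<open>w\<close> is required.\<close>

definition is_christoffel :: "'i \<Rightarrow> 'a \<times> ('i \<Rightarrow> 'e) \<Rightarrow> ('e \<times> 'e \<Rightarrow> 'e \<Rightarrow> 'e) \<Rightarrow> bool"
  where "is_christoffel i w B \<longleftrightarrow> (\<forall>\<xi>. linear (B \<xi>)) \<and>
    (\<forall>X\<in>vector_fields TM. \<forall>\<sigma>\<in>vertical_fields M.
      snd (nabla X \<sigma> w i) = snd (fder (field_rep TM i \<sigma>) (crd TM i w) (X w i)) + B (X w i) (snd (\<sigma> w i)))"

lemma is_christoffel_exists:
  assumes i: "i \<in> idx M" and w: "w \<in> dom TM i"
  shows "\<exists>B. is_christoffel i w B"
proof -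
  have i': "i \<in> idx TM" and pw: "w \<in> pts TM" using slit.dom_pts[of i w] i w by simp_all
  have wi: "crd TM i w \<in> simg i" by (rule simg_crd[OF i w])
  obtain \<phi> where \<phi>: "slit.cutoff i \<phi>" "\<phi> w = 1" "fder (\<phi> \<circ> crd_inv TM i) (crd TM i w) = (\<lambda>v. 0)"
    using slit_cutoff_exists[OF i w] by metis
  have ci: "crd_inv TM i (crd TM i w) = w" by (rule slit.crd_inv_crd[OF i' w])
  have d\<phi>: "((\<phi> \<circ> crd_inv TM i) has_derivative (\<lambda>v. 0)) (at (crd TM i w))"
    using C_inf_on_has_derivative[OF slit.smooth_fun_C_inf[OF slit.cutoff_smooth[OF \<phi>(1)] i'], of "crd TM i w"] w
    unfolding \<phi>(3) by blast
  let ?e = "\<lambda>\<xi>. slit.cutoff_field i \<phi> (\<lambda>z. \<xi>)"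
  let ?v = "\<lambda>k. slit.cutoff_field i \<phi> (\<lambda>z. (0, k))"
  have e: "?e \<xi> \<in> vector_fields TM" for \<xi> by (rule slit.cutoff_field_field[OF i' \<phi>(1)]) simp
  have v: "?v k \<in> vertical_fields M" for k by (rule vertical_cutoff_field[OF i \<phi>(1)])
  have vw: "?v k w i = (0, k)" for k using slit.cutoff_field_chart[OF i' w] \<phi>(2) by simp
  \<comment> \<open>Covariant derivatives at \<open>w\<close> of the cutoff frame. Since \<phi> has
    value 1 and derivative 0 there, that frame agrees to first order with the coordinate frame, so
    these are the usual Christoffel symbols.\<close>
  define B where "B = (\<lambda>\<xi> Z. \<Sum>k\<in>Basis. (Z \<bullet> k) *\<^sub>R snd (nabla (?e \<xi>) (?v k) w i))"
  have "linear (B \<xi>)" for \<xi>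
    unfolding B_def by (intro linearI) (simp_all add: inner_add_left scaleR_add_left sum.distrib scaleR_sum_right)
  moreover have "snd (nabla X \<sigma> w i) = snd (fder (field_rep TM i \<sigma>) (crd TM i w) (X w i)) + B (X w i) (snd (\<sigma> w i))"
    if X: "X \<in> vector_fields TM" and \<sigma>: "\<sigma> \<in> vertical_fields M" for X \<sigma>
  proof -
    have \<sigma>f: "\<sigma> \<in> vector_fields TM" by (rule vertical_fields_field[OF \<sigma>])
    define h where "h = (\<lambda>k z. snd (field_rep TM i \<sigma> z) \<bullet> k)"
    have hC: "C_inf_on (h k) (crd TM i ` dom TM i)" for k
      unfolding h_def by (intro C_inf_on_inner_left C_inf_on_snd slit.field_rep_C_inf[OF \<sigma>f i'] slit.open_img[OF i'])
    define f where "f = (\<lambda>k v. \<phi> v * h k (crd TM i v))"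
    have f: "smooth_fun TM (f k)" for k
      unfolding f_def by (rule slit.cutoff_fun[OF i' \<phi>(1) hC])
    have s: "smooth_fun TM (\<lambda>v. \<phi> v * \<phi> v)"
      by (intro slit.smooth_fun_mult slit.cutoff_smooth[OF \<phi>(1)])
    have eq: "(\<lambda>v. (\<phi> v * \<phi> v) *\<^sub>R \<sigma> v) = (\<Sum>k\<in>Basis. (\<lambda>v. f k v *\<^sub>R ?v k v))"
      unfolding f_def
    proof (rule slit.cutoff_field_expansion[OF i' \<phi>(1) \<sigma>f, where h = h and e = "\<lambda>k. (0, k)"])
      show "(\<Sum>k\<in>Basis. h k (crd TM i p) *\<^sub>R (0, k)) = \<sigma> p i" if "p \<in> dom TM i" for p
        unfolding h_def slit.field_rep_crd[OF i' that]
        using vertical_fields_chart[OF \<sigma> i that]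
        by (simp add: prod_eq_iff fst_sum snd_sum euclidean_representation)
    qed
    have Xw: "X w \<in> tangent_space TM w" by (rule slit.field_tangent[OF X])
    have "nabla X (\<lambda>v. (\<phi> v * \<phi> v) *\<^sub>R \<sigma> v) w = dir_deriv TM w (X w) (\<lambda>v. \<phi> v * \<phi> v) *\<^sub>R \<sigma> w + nabla X \<sigma> w"
      unfolding nabla_Leibniz[OF X \<sigma> s] by (simp only: \<phi>(2) mult_1_left scaleR_one)
    \<comment> \<open>This is where the vanishing derivative of the cutoff at its centre is
      used.\<close>
    also have "dir_deriv TM w (X w) (\<lambda>v. \<phi> v * \<phi> v) = 0"
    proof -
      have "((\<lambda>z. (\<phi> \<circ> crd_inv TM i) z * (\<phi> \<circ> crd_inv TM i) z) has_derivative (\<lambda>v. 0)) (at (crd TM i w))"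
        using has_derivative_mult[OF d\<phi> d\<phi>] by simp
      from fder_eqI[OF this]
      show ?thesis unfolding slit.dir_deriv_chart[OF s Xw i' w] by (simp add: o_def)
    qed
    finally have 1: "nabla X (\<lambda>v. (\<phi> v * \<phi> v) *\<^sub>R \<sigma> v) w = nabla X \<sigma> w" by (simp only: scaleR_zero_left add_0_left)
    have vs: "(\<lambda>v. f k v *\<^sub>R ?v k v) \<in> vertical_fields M" for k
      by (rule vertical_field_scale[OF v f])
    have "nabla X (\<lambda>v. (\<phi> v * \<phi> v) *\<^sub>R \<sigma> v) w = (\<Sum>k\<in>Basis. nabla X (\<lambda>v. f k v *\<^sub>R ?v k v)) w"
      unfolding eq
      using conjunct2[OF nabla_sum_right[where F = "\<lambda>k v. f k v *\<^sub>R ?v k v", OF finite_Basis vs X]]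
      by (simp only:)
    also have "\<dots> = (\<Sum>k\<in>Basis. dir_deriv TM w (X w) (f k) *\<^sub>R ?v k w + f k w *\<^sub>R nabla X (?v k) w)"
      unfolding sum_fun_apply by (simp only: nabla_Leibniz[OF X v f])
    finally have 2: "nabla X \<sigma> w = (\<Sum>k\<in>Basis. dir_deriv TM w (X w) (f k) *\<^sub>R ?v k w + f k w *\<^sub>R nabla X (?v k) w)"
      unfolding 1 .
    have dd: "dir_deriv TM w (X w) (f k) = snd (fder (field_rep TM i \<sigma>) (crd TM i w) (X w i)) \<bullet> k" for k
    proof -
      have "(h k has_derivative (\<lambda>v. snd (fder (field_rep TM i \<sigma>) (crd TM i w) v) \<bullet> k)) (at (crd TM i w))"
        unfolding h_def
        by (intro has_derivative_inner_left has_derivative_snd C_inf_on_has_derivative[OF slit_rep_C_inf[OF \<sigma>f i] wi])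
      from has_derivative_mult[OF d\<phi> this]
      have "((\<lambda>z. (\<phi> \<circ> crd_inv TM i) z * h k z) has_derivative
          (\<lambda>v. snd (fder (field_rep TM i \<sigma>) (crd TM i w) v) \<bullet> k)) (at (crd TM i w))"
        using ci \<phi>(2) by simp
      then have "(f k \<circ> crd_inv TM i has_derivative
          (\<lambda>v. snd (fder (field_rep TM i \<sigma>) (crd TM i w) v) \<bullet> k)) (at (crd TM i w))"
      proof (rule has_derivative_transform_within_open[OF _ slit.open_img[OF i']])
        show "(\<phi> \<circ> crd_inv TM i) z * h k z = (f k \<circ> crd_inv TM i) z" if "z \<in> crd TM i ` dom TM i" for z
          using slit.crd_crd_inv[OF that] by (simp add: f_def del: slit_tangent_sel(4))
      qed (use w in blast)
      from fder_eqI[OF this] show ?thesis unfolding slit.dir_deriv_chart[OF f Xw i' w] by metis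
    qed
    have fw: "f k w = snd (\<sigma> w i) \<bullet> k" for k
      unfolding f_def h_def slit.field_rep_crd[OF i' w] by (simp add: \<phi>(2))
    \<comment> \<open>\<open>B\<close> is defined with the extension of a vector by constant
      components; at \<open>w\<close> it may be used in place of \<open>X\<close>.\<close>
    have nv: "nabla X (?v k) w = nabla (?e (X w i)) (?v k) w" for k
    proof (rule nabla_pointwise[OF X e _ v pw])
      show "X w = ?e (X w i) w"
        by (rule slit.tangent_eqI[OF Xw slit.cutoff_field_tangent[OF i'] i' w])
          (use slit.cutoff_field_chart[OF i' w] \<phi>(2) in simp)
    qed
    have "snd (nabla X \<sigma> w i) = (\<Sum>k\<in>Basis. dir_deriv TM w (X w) (f k) *\<^sub>R snd (?v k w i) + f k w *\<^sub>R snd (nabla X (?v k) w i))"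
      unfolding 2 by (simp add: sum_fun_apply snd_sum scaleR_fun_def)
    also have "\<dots> = (\<Sum>k\<in>Basis. (snd (fder (field_rep TM i \<sigma>) (crd TM i w) (X w i)) \<bullet> k) *\<^sub>R k) + B (X w i) (snd (\<sigma> w i))"
      unfolding dd fw nv vw B_def by (simp only: sum.distrib snd_conv)
    finally show ?thesis by (simp only: euclidean_representation)
  qed
  ultimately show ?thesis unfolding is_christoffel_def by blast
qed

definition christoffel :: "'i \<Rightarrow> 'a \<times> ('i \<Rightarrow> 'e) \<Rightarrow> 'e \<times> 'e \<Rightarrow> 'e \<Rightarrow> 'e"
  where "christoffel i w = (SOME B. is_christoffel i w B)"

lemma christoffel: "i \<in> idx M \<Longrightarrow> w \<in> dom TM i \<Longrightarrow> is_christoffel i w (christoffel i w)"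
  unfolding christoffel_def by (rule someI_ex[OF is_christoffel_exists])

lemma linear_christoffel: "i \<in> idx M \<Longrightarrow> w \<in> dom TM i \<Longrightarrow> linear (christoffel i w \<xi>)"
  using christoffel unfolding is_christoffel_def by blast

lemma nabla_chart: "i \<in> idx M \<Longrightarrow> w \<in> dom TM i \<Longrightarrow> X \<in> vector_fields TM \<Longrightarrow> \<sigma> \<in> vertical_fields M \<Longrightarrow>
    snd (nabla X \<sigma> w i) = snd (fder (field_rep TM i \<sigma>) (crd TM i w) (X w i)) + christoffel i w (X w i) (snd (\<sigma> w i))"
  using christoffel unfolding is_christoffel_def by blast

end

section \<open>Covariant derivatives along curves in coordinates\<close>

lemma at_within_Int_ball: "t \<in> ball t0 \<delta> \<Longrightarrow> at t within (J \<inter> ball t0 \<delta>) = at t within J"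
  by (rule at_within_nhd[of t "ball t0 \<delta>"]) auto

lemma cov_deriv_vertical_cong:
  assumes "\<And>t. t \<in> J \<Longrightarrow> \<sigma> t = \<sigma>' t"
  shows "cov_deriv_vertical M nabla J c \<sigma> t0 = cov_deriv_vertical M nabla J c \<sigma>' t0"
proof -
  have "(\<forall>t\<in>J \<inter> A. \<sigma> t = F t) \<longleftrightarrow> (\<forall>t\<in>J \<inter> A. \<sigma>' t = F t)" for A F using assms by auto
  then show ?thesis unfolding cov_deriv_vertical_def by (simp only:)
qed

text \<open>Identities between vector fields along a curve hold on the parameter interval only,
  where the fields are meaningful. This lets them be substituted under a covariant derivative
  nevertheless.\<close>

lemma cov_deriv_cong:
  assumes "\<And>t. t \<in> J \<Longrightarrow> V t = V' t"
  shows "cov_deriv M S nabla J \<gamma> W V t0 = cov_deriv M S nabla J \<gamma> W V' t0"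
proof -
  have "cov_deriv_vertical M nabla (J \<inter> ball t0 \<delta>) c (\<lambda>t. vert M (c t) (V t)) t0
      = cov_deriv_vertical M nabla (J \<inter> ball t0 \<delta>) c (\<lambda>t. vert M (c t) (V' t)) t0" for \<delta> c
    by (rule cov_deriv_vertical_cong) (use assms in simp)
  then show ?thesis unfolding cov_deriv_def by (simp only:)
qed

context connection_atlas
begin

lemma vertical_eqI:
  assumes "i \<in> idx M" "w \<in> dom TM i" "\<xi> \<in> vertical_space M w" "\<eta> \<in> vertical_space M w" "snd (\<xi> i) = snd (\<eta> i)"
  shows "\<xi> = \<eta>"
proof -
  have i': "i \<in> idx TM" using assms(1) by simp
  show ?thesis
    using assms(3,4,5) slit.tangent_eqI[OF _ _ i' assms(2)] unfolding vertical_space_iff[OF assms(1,2)]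
    by (simp add: prod_eq_iff)
qed

context
  fixes J :: "real set" and c :: "real \<Rightarrow> 'a \<times> ('i \<Rightarrow> 'e)" and t0 :: real and i :: 'i
    and \<sigma> :: "real \<Rightarrow> 'i \<Rightarrow> 'e \<times> 'e" and v' :: 'e
  assumes c: "smooth_into TM J c" and t: "t0 \<in> J" "at t0 within J \<noteq> bot"
    and i: "i \<in> idx M" "c t0 \<in> dom TM i"
    and \<sigma>: "\<And>t. t \<in> J \<Longrightarrow> \<sigma> t \<in> vertical_space M (c t)"
    and d: "((\<lambda>t. snd (\<sigma> t i)) has_vector_derivative v') (at t0 within J)"
begin

text \<open>The predicate under the description operator of \<open>cov_deriv_vertical\<close>, named
  so that existence and uniqueness can be treated apart.\<close>

definition Leibniz_value :: "('i \<Rightarrow> 'e \<times> 'e) \<Rightarrow> bool"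
  where "Leibniz_value \<eta> \<longleftrightarrow> (\<exists>(n::nat) (f :: nat \<Rightarrow> real \<Rightarrow> real) f' E A.
      (\<forall>k<n. E k \<in> vertical_fields M \<and> (f k has_real_derivative f' k) (at t0 within J)) \<and>
      open A \<and> t0 \<in> A \<and> (\<forall>t\<in>J \<inter> A. \<sigma> t = (\<Sum>k<n. f k t *\<^sub>R E k (c t))) \<and>
      \<eta> = (\<Sum>k<n. f' k *\<^sub>R E k (c t0) + f k t0 *\<^sub>R tensor_at TM (\<lambda>X. nabla X (E k)) (c t0) (velocity TM J c t0)))"

lemma crd_curve_has_derivative:
  "((\<lambda>t. crd TM i (c t)) has_derivative (\<lambda>h. h *\<^sub>R velocity TM J c t0 i)) (at t0 within J)"
  using slit.velocity_chart[OF c t _ i(2)] i(1) unfolding has_vector_derivative_def by simp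

text \<open>Uniqueness: for any representation of \<sigma>, the product rule in the chart gathers
  the derivatives of coefficients and sections into the derivative of \<sigma>, and linearity of the
  Christoffel map gathers the remaining terms. The outcome no longer mentions the
  representation.\<close>

lemma Leibniz_value_chart:
  assumes "Leibniz_value \<eta>"
  shows "\<eta> \<in> vertical_space M (c t0)
    \<and> snd (\<eta> i) = v' + christoffel i (c t0) (velocity TM J c t0 i) (snd (\<sigma> t0 i))"
proof -
  have i': "i \<in> idx TM" and pw: "c t0 \<in> pts TM" and z: "crd TM i (c t0) \<in> simg i"
    using slit.dom_pts[of i "c t0"] simg_crd[OF i] i by simp_all
  obtain X where X: "X \<in> vector_fields TM" "X (c t0) = (velocity TM J c t0)" using slit_extension[OF pw slit.velocity_tangent[OF c t]] .
  have tens: "tensor_at TM (\<lambda>X. nabla X E) (c t0) (velocity TM J c t0) = nabla X E (c t0)" if "E \<in> vertical_fields M" for E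
    using tensor_at_nabla[OF X(1) pw that] unfolding X(2) .
  obtain A2 g where A2: "open A2" "t0 \<in> A2" "C_inf_on g A2" "\<And>t. t \<in> J \<inter> A2 \<Longrightarrow> c t \<in> dom TM i \<and> crd TM i (c t) = g t"
    by (rule slit.smooth_intoD[OF c t(1) i' i(2)], rule that)
  obtain n :: nat and f f' E A where *: "(\<forall>k<n. E k \<in> vertical_fields M \<and> (f k has_real_derivative f' k) (at t0 within J)) \<and>
      open A \<and> t0 \<in> A \<and> (\<forall>t\<in>J \<inter> A. \<sigma> t = (\<Sum>k<n. f k t *\<^sub>R E k (c t))) \<and>
      \<eta> = (\<Sum>k<n. f' k *\<^sub>R E k (c t0) + f k t0 *\<^sub>R tensor_at TM (\<lambda>X. nabla X (E k)) (c t0) (velocity TM J c t0))"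
    using assms unfolding Leibniz_value_def by (elim exE) (rule that, assumption)
  then have E: "\<And>k. k < n \<Longrightarrow> E k \<in> vertical_fields M"
    and f: "\<And>k. k < n \<Longrightarrow> (f k has_real_derivative f' k) (at t0 within J)"
    and A: "open A" "t0 \<in> A" and \<sigma>A: "\<And>t. t \<in> J \<inter> A \<Longrightarrow> \<sigma> t = (\<Sum>k<n. f k t *\<^sub>R E k (c t))"
    and \<eta>: "\<eta> = (\<Sum>k<n. f' k *\<^sub>R E k (c t0) + f k t0 *\<^sub>R tensor_at TM (\<lambda>X. nabla X (E k)) (c t0) (velocity TM J c t0))"
    by blast+
  have \<eta>: "\<eta> = (\<Sum>k<n. f' k *\<^sub>R E k (c t0) + f k t0 *\<^sub>R nabla X (E k) (c t0))"
    unfolding \<eta> by (rule sum.cong) (simp_all add: tens E)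
  have Ew: "E k (c t0) \<in> vertical_space M (c t0)" if "k < n" for k
    using E[OF that] pw unfolding vertical_fields_def by blast
  have nEw: "nabla X (E k) (c t0) \<in> vertical_space M (c t0)" if "k < n" for k
    using nabla_vertical[OF X(1) E[OF that]] pw unfolding vertical_fields_def by blast
  have "\<eta> \<in> vertical_space M (c t0)"
    unfolding \<eta> by (intro vertical_sum vertical_add vertical_scaleR pw Ew nEw) simp_all
  moreover have "snd (\<eta> i) = v' + christoffel i (c t0) (velocity TM J c t0 i) (snd (\<sigma> t0 i))"
  proof -
    let ?r = "\<lambda>k t. snd (field_rep TM i (E k) (crd TM i (c t)))"
    let ?d = "\<lambda>k. snd (fder (field_rep TM i (E k)) (crd TM i (c t0)) (velocity TM J c t0 i))"
    have r: "(?r k has_vector_derivative ?d k) (at t0 within J)" if k: "k < n" for k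
    proof -
      have C: "C_inf_on (field_rep TM i (E k)) (simg i)"
        by (rule slit_rep_C_inf[OF vertical_fields_field[OF E[OF k]] i(1)])
      have "(field_rep TM i (E k) has_derivative fder (field_rep TM i (E k)) (crd TM i (c t0))) (at (crd TM i (c t0)))"
        using C_inf_on_has_derivative[OF C z] .
      from has_derivative_snd[OF has_derivative_compose[OF crd_curve_has_derivative this]]
      show ?thesis unfolding has_vector_derivative_def
        by (simp add: linear_cmul[OF linear_frechet_derivative[OF C_inf_on_differentiable[OF C z]]]
            del: slit_tangent_sel(4))
    qed
    have Ei: "?r k t = snd (E k (c t) i)" if "c t \<in> dom TM i" for k t
      unfolding slit.field_rep_crd[OF i' that] ..
    have "((\<lambda>t. \<Sum>k<n. f k t *\<^sub>R ?r k t) has_vector_derivative (\<Sum>k<n. f k t0 *\<^sub>R ?d k + f' k *\<^sub>R ?r k t0)) (at t0 within J)"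
      by (intro has_vector_derivative_sum has_vector_derivative_scaleR f r) simp_all
    then have "((\<lambda>t. snd (\<sigma> t i)) has_vector_derivative (\<Sum>k<n. f k t0 *\<^sub>R ?d k + f' k *\<^sub>R ?r k t0)) (at t0 within J)"
      unfolding has_vector_derivative_def
    proof (rule has_derivative_transform_eventually)
      have eq: "(\<Sum>k<n. f k t *\<^sub>R ?r k t) = snd (\<sigma> t i)" if "t \<in> J" "t \<in> A \<inter> A2" for t
        using \<sigma>A[of t] A2(4)[of t] that Ei[of t]
        by (simp add: sum_fun_apply snd_sum scaleR_fun_def del: slit_tangent_sel(4))
      show "\<forall>\<^sub>F t in at t0 within J. (\<Sum>k<n. f k t *\<^sub>R ?r k t) = snd (\<sigma> t i)"
        unfolding eventually_at_topological using eq A A2 by (intro exI[of _ "A \<inter> A2"]) auto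
      show "(\<Sum>k<n. f k t0 *\<^sub>R ?r k t0) = snd (\<sigma> t0 i)" using eq[OF t(1)] A A2 by simp
    qed (rule t)
    \<comment> \<open>The filter within \<open>J\<close> is proper, so the derivative is unique;
      this ties the given \<open>v'\<close> to the chosen representation.\<close>
    then have v': "v' = (\<Sum>k<n. f k t0 *\<^sub>R ?d k + f' k *\<^sub>R ?r k t0)"
      by (rule vector_derivative_unique_within[OF t(2) d])
    have "snd (\<sigma> t0 i) = (\<Sum>k<n. f k t0 *\<^sub>R snd (E k (c t0) i))"
      using \<sigma>A[of t0] t A by (simp add: sum_fun_apply snd_sum scaleR_fun_def)
    then have "christoffel i (c t0) (velocity TM J c t0 i) (snd (\<sigma> t0 i)) = (\<Sum>k<n. f k t0 *\<^sub>R christoffel i (c t0) (velocity TM J c t0 i) (snd (E k (c t0) i)))"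
      by (simp add: linear_sum[OF linear_christoffel[OF i]] linear_cmul[OF linear_christoffel[OF i]])
    then have "v' + christoffel i (c t0) (velocity TM J c t0 i) (snd (\<sigma> t0 i))
       = (\<Sum>k<n. f' k *\<^sub>R snd (E k (c t0) i) + f k t0 *\<^sub>R (?d k + christoffel i (c t0) (velocity TM J c t0 i) (snd (E k (c t0) i))))"
      unfolding v'
      by (simp only: slit.field_rep_crd[OF i' i(2)] sum.distrib[symmetric] scaleR_add_right add.assoc add.commute add.left_commute)
    also have "\<dots> = (\<Sum>k<n. f' k *\<^sub>R snd (E k (c t0) i) + f k t0 *\<^sub>R snd (nabla X (E k) (c t0) i))"
    proof (rule sum.cong)
      fix k assume "k \<in> {..<n}"
      then have "snd (nabla X (E k) (c t0) i) = ?d k + christoffel i (c t0) (velocity TM J c t0 i) (snd (E k (c t0) i))"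
        using nabla_chart[OF i X(1) E[of k]] unfolding X(2) by simp
      then show "f' k *\<^sub>R snd (E k (c t0) i) + f k t0 *\<^sub>R (?d k + christoffel i (c t0) (velocity TM J c t0 i) (snd (E k (c t0) i)))
        = f' k *\<^sub>R snd (E k (c t0) i) + f k t0 *\<^sub>R snd (nabla X (E k) (c t0) i)" by simp
    qed simp
    also have "\<dots> = snd (\<eta> i)" unfolding \<eta> by (simp add: sum_fun_apply snd_sum scaleR_fun_def)
    finally show ?thesis by simp
  qed
  ultimately show ?thesis ..
qed

text \<open>The cutoff sections form a frame where \<phi> is positive, and the curve stays there for
  parameters near \<open>t0\<close>.\<close>

lemma Leibniz_value_exists: "\<exists>\<eta>. Leibniz_value \<eta>"
proof -
  have i': "i \<in> idx TM" using i by simp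
  obtain A2 g where A2: "open A2" "t0 \<in> A2" "C_inf_on g A2" "\<And>t. t \<in> J \<inter> A2 \<Longrightarrow> c t \<in> dom TM i \<and> crd TM i (c t) = g t"
    by (rule slit.smooth_intoD[OF c t(1) i' i(2)], rule that)
  obtain \<phi> A where \<phi>: "slit.cutoff i \<phi>" "\<phi> (c t0) = 1"
    and A: "open A" "crd TM i (c t0) \<in> A" "A \<subseteq> simg i" "\<And>v. v \<in> dom TM i \<Longrightarrow> crd TM i v \<in> A \<Longrightarrow> \<phi> v > 0"
    using slit_cutoff_exists[OF i] by metis
  obtain b where b: "bij_betw b {0..<DIM('e)} (Basis :: 'e set)" using ex_bij_betw_nat_finite[OF finite_Basis] by blast
  define E where "E = (\<lambda>k. slit.cutoff_field i \<phi> (\<lambda>z. (0, b k)))"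
  \<comment> \<open>Division by \<phi> compensates the factor \<phi> in the sections
    \<open>E k\<close>.\<close>
  define f where "f = (\<lambda>k t. (snd (\<sigma> t i) \<bullet> b k) / \<phi> (c t))"
  define f' where "f' = (\<lambda>k. vector_derivative (f k) (at t0 within J))"
  \<comment> \<open>Parameters at which the extended chart expression of the curve lies in the
    region where \<phi> is positive.\<close>
  define A3 where "A3 = A2 \<inter> g -` A"
  have A3: "open A3" "A3 \<subseteq> A2"
    using C_inf_on_continuous_on[OF A2(3)] A2(1) A(1)
    by (auto simp: A3_def Int_commute continuous_on_open_vimage)
  have t0A3: "t0 \<in> A3" using A2(4)[of t0] A2(2) A(2) t(1) by (simp add: A3_def del: slit_tangent_sel(4))
  have pos: "\<phi> (c t) > 0 \<and> c t \<in> dom TM i" if "t \<in> J \<inter> A3" for t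
  proof -
    have "c t \<in> dom TM i" "crd TM i (c t) = g t" using A2(4)[of t] that A3 by auto
    moreover have "g t \<in> A" using that by (simp add: A3_def)
    ultimately show ?thesis using A(4) by metis
  qed
  have fd: "(f k has_real_derivative f' k) (at t0 within J)" for k
  proof -
    have "((\<phi> \<circ> crd_inv TM i) has_derivative fder (\<phi> \<circ> crd_inv TM i) (crd TM i (c t0))) (at (crd TM i (c t0)))"
      using C_inf_on_has_derivative[OF slit.smooth_fun_C_inf[OF slit.cutoff_smooth[OF \<phi>(1)] i'], of "crd TM i (c t0)"] i(2)
      by blast
    from has_derivative_compose[OF crd_curve_has_derivative this]
    have "(\<lambda>t. (\<phi> \<circ> crd_inv TM i) (crd TM i (c t))) differentiable (at t0 within J)"
      unfolding differentiable_def by blast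
    moreover have "(\<lambda>t. snd (\<sigma> t i) \<bullet> b k) differentiable (at t0 within J)"
      using has_derivative_inner_left[OF d[unfolded has_vector_derivative_def]] unfolding differentiable_def by blast
    moreover have "(\<phi> \<circ> crd_inv TM i) (crd TM i (c t0)) \<noteq> 0"
      using slit.crd_inv_crd[OF i' i(2)] \<phi>(2) by (simp del: slit_tangent_sel(4))
    ultimately have "(\<lambda>t. (snd (\<sigma> t i) \<bullet> b k) / (\<phi> \<circ> crd_inv TM i) (crd TM i (c t))) differentiable (at t0 within J)"
      by (intro differentiable_divide)
    then obtain D where D: "((\<lambda>t. (snd (\<sigma> t i) \<bullet> b k) / (\<phi> \<circ> crd_inv TM i) (crd TM i (c t))) has_derivative D) (at t0 within J)"
      unfolding differentiable_def by blast
    have "(f k has_derivative D) (at t0 within J)"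
    proof (rule has_derivative_transform_eventually[OF D])
      have eq: "(snd (\<sigma> t i) \<bullet> b k) / (\<phi> \<circ> crd_inv TM i) (crd TM i (c t)) = f k t" if "t \<in> J \<inter> A3" for t
        using slit.crd_inv_crd[OF i' conjunct2[OF pos[OF that]]] by (simp add: f_def del: slit_tangent_sel(4))
      show "\<forall>\<^sub>F t in at t0 within J. (snd (\<sigma> t i) \<bullet> b k) / (\<phi> \<circ> crd_inv TM i) (crd TM i (c t)) = f k t"
        unfolding eventually_at_topological using eq A3 t0A3 by blast
      show "(snd (\<sigma> t0 i) \<bullet> b k) / (\<phi> \<circ> crd_inv TM i) (crd TM i (c t0)) = f k t0" using eq t t0A3 by blast
    qed (rule t)
    then have "f k differentiable (at t0 within J)" unfolding differentiable_def by blast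
    then show ?thesis
      unfolding f'_def has_real_derivative_iff_has_vector_derivative by (simp add: vector_derivative_works)
  qed
  have "\<sigma> t = (\<Sum>k<DIM('e). f k t *\<^sub>R E k (c t))" if tJ: "t \<in> J \<inter> A3" for t
  proof (rule vertical_eqI[OF i(1)])
    show ci: "c t \<in> dom TM i" using pos[OF tJ] by blast
    have pt: "c t \<in> pts TM" using slit.dom_pts[OF i' ci] .
    show "\<sigma> t \<in> vertical_space M (c t)" using \<sigma> tJ by blast
    have Ev: "E k (c t) \<in> vertical_space M (c t)" for k
      using vertical_cutoff_field[OF i(1) \<phi>(1), of "b k"] pt unfolding E_def vertical_fields_def by blast
    show "(\<Sum>k<DIM('e). f k t *\<^sub>R E k (c t)) \<in> vertical_space M (c t)"
      by (intro vertical_sum vertical_scaleR pt Ev)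
    have "snd ((\<Sum>k<DIM('e). f k t *\<^sub>R E k (c t)) i) = (\<Sum>k<DIM('e). f k t *\<^sub>R snd (E k (c t) i))"
      by (simp add: sum_fun_apply snd_sum scaleR_fun_def)
    also have "\<dots> = (\<Sum>k<DIM('e). (snd (\<sigma> t i) \<bullet> b k) *\<^sub>R b k)"
      using pos[OF tJ] unfolding E_def f_def slit.cutoff_field_chart[OF i' ci] by simp
    also have "\<dots> = (\<Sum>k\<in>Basis. (snd (\<sigma> t i) \<bullet> k) *\<^sub>R k)"
      using sum.reindex_bij_betw[OF b, of "\<lambda>k. (snd (\<sigma> t i) \<bullet> k) *\<^sub>R k"] by (simp add: lessThan_atLeast0)
    finally show "snd (\<sigma> t i) = snd ((\<Sum>k<DIM('e). f k t *\<^sub>R E k (c t)) i)"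
      by (simp only: euclidean_representation)
  qed
  moreover have "E k \<in> vertical_fields M" for k unfolding E_def by (rule vertical_cutoff_field[OF i(1) \<phi>(1)])
  ultimately have "Leibniz_value (\<Sum>k<DIM('e). f' k *\<^sub>R E k (c t0) + f k t0 *\<^sub>R tensor_at TM (\<lambda>X. nabla X (E k)) (c t0) (velocity TM J c t0))"
    unfolding Leibniz_value_def using fd A3(1) t0A3
    by (intro exI[of _ "DIM('e)"] exI[of _ f] exI[of _ f'] exI[of _ E] exI[of _ A3]) blast
  then show ?thesis by (rule exI[where P = Leibniz_value])
qed

lemma cov_deriv_vertical_chart:
  shows "cov_deriv_vertical M nabla J c \<sigma> t0 \<in> vertical_space M (c t0)"
    and "snd (cov_deriv_vertical M nabla J c \<sigma> t0 i) = v' + christoffel i (c t0) (velocity TM J c t0 i) (snd (\<sigma> t0 i))"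
proof -
  obtain \<eta> where \<eta>: "Leibniz_value \<eta>" using Leibniz_value_exists by blast
  have "cov_deriv_vertical M nabla J c \<sigma> t0 = (THE \<eta>. Leibniz_value \<eta>)"
    unfolding cov_deriv_vertical_def Leibniz_value_def ..
  also have "\<dots> = \<eta>"
    by (rule the_equality[where P = Leibniz_value, OF \<eta>], rule vertical_eqI[OF i])
      (use Leibniz_value_chart \<eta> in \<open>simp_all only:\<close>)
  finally show "cov_deriv_vertical M nabla J c \<sigma> t0 \<in> vertical_space M (c t0)"
    "snd (cov_deriv_vertical M nabla J c \<sigma> t0 i) = v' + christoffel i (c t0) (velocity TM J c t0 i) (snd (\<sigma> t0 i))"
    using Leibniz_value_chart[OF \<eta>] by simp_all
qed

end

end

context spray_atlas
begin

text \<open>The base part is the velocity of \<gamma> because the curve projects to \<gamma>;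
  horizontality then determines the fibre part. So all lifts through a given point have the same
  velocity there.\<close>

lemma horizontal_lift_curve_velocity:
  assumes h: "horizontal_lift_curve M S J \<gamma> c" and t: "t \<in> J" "at t within J \<noteq> bot"
    and i: "i \<in> idx M" "\<gamma> t \<in> dom M i"
  shows "c t \<in> dom TM i"
    and "velocity TM J c t i
      = (velocity M J \<gamma> t i, - conn_coeff i (crd TM i (c t)) (velocity M J \<gamma> t i))"
proof -
  have c: "smooth_into TM J c" and fst: "\<And>t. t \<in> J \<Longrightarrow> fst (c t) = \<gamma> t"
    and hor: "velocity TM J c t \<in> horizontal_space M S (c t)"
    using h t unfolding horizontal_lift_curve_def by auto
  have "c t \<in> pts TM" using c t(1) unfolding smooth_into_def by blast
  then show ci: "c t \<in> dom TM i" using i fst[OF t(1)] by simp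
  have i': "i \<in> idx TM" using i by simp
  have "((\<lambda>t. fst (crd TM i (c t))) has_vector_derivative fst (velocity TM J c t i)) (at t within J)"
    using has_derivative_fst[OF slit.velocity_chart[OF c t i' ci, unfolded has_vector_derivative_def]]
    unfolding has_vector_derivative_def by simp
  then have "((\<lambda>t. crd M i (\<gamma> t)) has_vector_derivative fst (velocity TM J c t i)) (at t within J)"
    unfolding has_vector_derivative_def
    by (rule has_derivative_transform[OF t(1), rotated]) (simp add: fst)
  then have "velocity M J \<gamma> t i = fst (velocity TM J c t i)" by (rule velocity_eqI[where c = \<gamma> and t = t, OF _ t(2) i])
  then show "velocity TM J c t i
      = (velocity M J \<gamma> t i, - conn_coeff i (crd TM i (c t)) (velocity M J \<gamma> t i))"
    using hor unfolding horizontal_space_iff[OF i(1) ci] by (simp add: prod_eq_iff)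
qed

text \<open>In a chart the lift (x, y) solves y' = - N(x, y) x'. N may depend nonlinearly on y, so
  the solution is taken near \<open>t0\<close> only. The domain of the equation excludes y = 0,
  which keeps the solution in the slit bundle.\<close>

lemma horizontal_lift_curve_exists:
  assumes \<gamma>: "smooth_into M J \<gamma>" and t0: "t0 \<in> J" and nb: "\<And>t. t \<in> J \<Longrightarrow> at t within J \<noteq> bot"
    and w: "w \<in> pts TM" "fst w = \<gamma> t0"
  obtains \<delta> c where "\<delta> > 0" "horizontal_lift_curve M S (J \<inter> ball t0 \<delta>) \<gamma> c" "c t0 = w"
proof -
  obtain i where i: "i \<in> idx M" "w \<in> dom TM i" using slitE[OF w(1)] .
  have i': "i \<in> idx TM" and \<gamma>i: "\<gamma> t0 \<in> dom M i" using i w by auto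
  obtain A g where A: "open A" "t0 \<in> A" "C_inf_on g A" "\<And>t. t \<in> J \<inter> A \<Longrightarrow> \<gamma> t \<in> dom M i \<and> crd M i (\<gamma> t) = g t"
    by (rule smooth_intoD[OF \<gamma> t0 i(1) \<gamma>i], rule that)
  define A' where "A' = A \<inter> g -` img i"
  have A': "open A'" "A' \<subseteq> A" "g ` A' \<subseteq> img i"
    using C_inf_on_continuous_on[OF A(3)] A(1) open_img[OF i(1)]
    by (auto simp: A'_def Int_commute continuous_on_open_vimage)
  have t0A': "t0 \<in> A'" using A(2) A(4)[of t0] t0 by (force simp: A'_def)
  have gA': "C_inf_on g A'" by (rule C_inf_on_subset[OF A(3) A'(2)])
  \<comment> \<open>\<open>g\<close> extends the chart expression of \<gamma> beyond a possible end
    point of \<open>J\<close>, so the equation is posed on an open set; the solution is restricted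
    to \<open>J\<close> afterwards.\<close>
  define F where "F = (\<lambda>p. - conn_coeff i (g (fst p), snd p) (fder g (fst p) 1))"
  have o: "open (A' \<times> (- {0::'e}))" using A' by (intro open_Times) auto
  have gf: "C_inf_on (\<lambda>p. g (fst p)) (A' \<times> (- {0::'e}))"
    by (rule C_inf_on_compose[OF gA' C_inf_on_fst' o A'(1)]) auto
  have gf': "C_inf_on (\<lambda>p. fder g (fst p) 1) (A' \<times> (- {0::'e}))"
    by (rule C_inf_on_compose[OF C_inf_on_fder[OF gA'] C_inf_on_fst' o A'(1)]) auto
  have F: "C_inf_on F (A' \<times> (- {0}))"
    unfolding F_def
    by (intro C_inf_on_uminus conn_coeff_C_inf[OF i(1)] C_inf_on_Pair gf gf' C_inf_on_snd' o)
      (use A'(3) in auto)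
  have y0: "snd w i \<noteq> 0" using tangent_nonzero_iff[of "snd w" "fst w" i] i by auto
  obtain \<delta> y where \<delta>: "\<delta> > 0" "y t0 = snd w i" "C_inf_on y (ball t0 \<delta>)"
    "\<And>t. t \<in> ball t0 \<delta> \<Longrightarrow> (t, y t) \<in> A' \<times> (- {0})"
    "\<And>t. t \<in> ball t0 \<delta> \<Longrightarrow> (y has_vector_derivative F (t, y t)) (at t)"
    using ode_local_solution[OF F o, of t0 "snd w i"] t0A' y0 by auto
  define J' where "J' = J \<inter> ball t0 \<delta>"
  define c where "c = (\<lambda>t. (\<gamma> t, tvec i (\<gamma> t) (y t)))"
  have c: "c t \<in> dom TM i \<and> crd TM i (c t) = (g t, y t)" if "t \<in> J'" for t
  proof -
    have "t \<in> A'" "y t \<noteq> 0" using \<delta>(4)[of t] that by (auto simp: J'_def)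
    moreover from this have "\<gamma> t \<in> dom M i" "crd M i (\<gamma> t) = g t" using A(4)[of t] A'(2) that by (auto simp: J'_def)
    moreover from this have "tvec i (\<gamma> t) (y t) \<noteq> 0"
      using tangent_nonzero_iff[OF tvec_tangent i(1)] \<open>y t \<noteq> 0\<close> i by simp
    ultimately show ?thesis using i by (simp add: c_def)
  qed
  have gy: "C_inf_on (\<lambda>t. (g t, y t)) (ball t0 \<delta>)"
    using \<delta>(4) by (intro C_inf_on_Pair \<delta>(3) open_ball C_inf_on_subset[OF gA']) blast
  have sc: "smooth_into TM J' c"
  proof (rule slit.smooth_intoI)
    fix t assume "t \<in> J'"
    then show "\<exists>i\<in>idx TM. \<exists>A g. open A \<and> t \<in> A \<and> C_inf_on g A \<and> (\<forall>y\<in>J' \<inter> A. c y \<in> dom TM i \<and> crd TM i (c y) = g y)"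
      using gy c i' by (intro bexI[OF _ i'] exI[of _ "ball t0 \<delta>"] exI[of _ "\<lambda>t. (g t, y t)"]) (auto simp: J'_def)
  qed
  have "velocity TM J' c t \<in> horizontal_space M S (c t)" if t: "t \<in> J'" for t
  proof -
    have tb: "t \<in> ball t0 \<delta>" using t by (simp add: J'_def)
    have nb': "at t within J' \<noteq> bot" using nb[of t] t at_within_Int_ball[OF tb] by (simp add: J'_def)
    have tA: "t \<in> A'" using \<delta>(4)[OF tb] by simp
    have "(g has_vector_derivative fder g t 1) (at t within J')"
      using C_inf_on_vector_derivative[OF gA', of 0 t 1] tA by simp
    then have "((\<lambda>t. (g t, y t)) has_vector_derivative (fder g t 1, F (t, y t))) (at t within J')"
      by (rule has_vector_derivative_Pair[OF _ has_vector_derivative_at_within[OF \<delta>(5)[OF tb]]])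
    then have "((\<lambda>t. crd TM i (c t)) has_vector_derivative (fder g t 1, F (t, y t))) (at t within J')"
      unfolding has_vector_derivative_def
      by (rule has_derivative_transform[OF t, rotated]) (use c in blast)
    then have v: "velocity TM J' c t i = (fder g t 1, F (t, y t))"
      by (rule slit.velocity_eqI[where c = c and t = t, OF _ nb' i']) (use c[OF t] in blast)
    have ct: "crd TM i (c t) = (g t, y t)" "c t \<in> dom TM i" using c[OF t] by blast+
    show ?thesis
      unfolding horizontal_space_iff[OF i(1) ct(2)] v ct(1) using slit.velocity_tangent[OF sc t nb']
      by (simp add: F_def)
  qed
  then have "horizontal_lift_curve M S J' \<gamma> c"
    unfolding horizontal_lift_curve_def using sc by (simp add: c_def)
  moreover have "c t0 = w"
    using tvec_eq[of "snd w" "fst w" i] i w(2) \<delta>(2) by (simp add: c_def prod_eq_iff)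
  ultimately show thesis using that \<delta>(1) unfolding J'_def by blast
qed

end

locale spray_connection_atlas = spray_atlas M S + connection_atlas M nabla
  for M :: "('a, 'i, 'e::euclidean_space) mfd" and S :: "('a, 'i, 'e) slit_field"
    and nabla :: "('a, 'i, 'e) connection"
begin

text \<open>The definition ranges over all \<delta> and all lifts \<open>c\<close>. The chart
  formula sees \<open>c\<close> only through its value and velocity at \<open>t0\<close>, and both
  are the same for every admissible choice.\<close>

lemma cov_deriv_chart:
  assumes \<gamma>: "smooth_into M J \<gamma>" and t0: "t0 \<in> J" and nb: "\<And>t. t \<in> J \<Longrightarrow> at t within J \<noteq> bot"
    and i: "i \<in> idx M" "\<gamma> t0 \<in> dom M i" and W: "(\<gamma> t0, W t0) \<in> pts TM"
    and V: "\<And>t. t \<in> J \<Longrightarrow> V t \<in> tangent_space M (\<gamma> t)"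
    and d: "((\<lambda>t. V t i) has_vector_derivative v') (at t0 within J)"
  shows "cov_deriv M S nabla J \<gamma> W V t0 \<in> tangent_space M (\<gamma> t0)"
    and "cov_deriv M S nabla J \<gamma> W V t0 i = v' + christoffel i (\<gamma> t0, W t0)
      (velocity M J \<gamma> t0 i, - conn_coeff i (crd M i (\<gamma> t0), W t0 i) (velocity M J \<gamma> t0 i)) (V t0 i)"
proof -
  define w where "w = (\<gamma> t0, W t0)"
  let ?\<xi> = "(velocity M J \<gamma> t0 i, - conn_coeff i (crd M i (\<gamma> t0), W t0 i) (velocity M J \<gamma> t0 i))"
  define P where "P = (\<lambda>\<eta>. \<exists>\<delta>>0. \<exists>c. horizontal_lift_curve M S (J \<inter> ball t0 \<delta>) \<gamma> c \<and> c t0 = w \<and>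
        \<eta> = cov_deriv_vertical M nabla (J \<inter> ball t0 \<delta>) c (\<lambda>t. vert M (c t) (V t)) t0)"
  have pw: "w \<in> pts TM" and wi: "w \<in> dom TM i" using W i by (auto simp: w_def)
  obtain A g where A: "open A" "t0 \<in> A" "\<And>t. t \<in> J \<inter> A \<Longrightarrow> \<gamma> t \<in> dom M i \<and> crd M i (\<gamma> t) = g t"
    using smooth_intoD[OF \<gamma> t0 i] by metis
  have char: "\<eta> \<in> vertical_space M w \<and> snd (\<eta> i) = v' + christoffel i w ?\<xi> (V t0 i)" if P: "P \<eta>" for \<eta>
  proof -
    obtain \<delta> c where \<delta>: "\<delta> > 0" and h: "horizontal_lift_curve M S (J \<inter> ball t0 \<delta>) \<gamma> c" and ct0: "c t0 = w"
      and \<eta>: "\<eta> = cov_deriv_vertical M nabla (J \<inter> ball t0 \<delta>) c (\<lambda>t. vert M (c t) (V t)) t0"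
      using P unfolding P_def by blast
    let ?J = "J \<inter> ball t0 \<delta>"
    \<comment> \<open>Shrinking \<open>J\<close> to the ball changes neither the derivatives at
      \<open>t0\<close> nor the velocities there.\<close>
    have aw: "at t0 within ?J = at t0 within J" by (rule at_within_Int_ball) (use \<delta> in simp)
    have t0': "t0 \<in> ?J" "at t0 within ?J \<noteq> bot" using t0 \<delta> nb aw by simp_all
    have c: "smooth_into TM ?J c" and cf: "\<And>t. t \<in> ?J \<Longrightarrow> fst (c t) = \<gamma> t"
      using h unfolding horizontal_lift_curve_def by auto
    have cp: "c t \<in> pts TM" if "t \<in> ?J" for t using c that unfolding smooth_into_def by blast
    have vv: "vert M (c t) (V t) \<in> vertical_space M (c t)" if "t \<in> ?J" for t
      by (rule vert_vertical[OF _ cp[OF that]]) (use V cf[OF that] that in simp)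
    have dv: "((\<lambda>t. snd (vert M (c t) (V t) i)) has_vector_derivative v') (at t0 within ?J)"
      unfolding aw using d unfolding has_vector_derivative_def
    proof (rule has_derivative_transform_eventually)
      have eq: "V t i = snd (vert M (c t) (V t) i)" if t: "t \<in> J" "t \<in> A \<inter> ball t0 \<delta>" for t
      proof -
        have "c t \<in> dom TM i" using A(3)[of t] cp[of t] cf[of t] t by auto
        then show ?thesis using vert_chart[OF i(1)] by simp
      qed
      show "\<forall>\<^sub>F t in at t0 within J. V t i = snd (vert M (c t) (V t) i)"
        unfolding eventually_at_topological using eq A(1,2) \<delta>
        by (intro exI[of _ "A \<inter> ball t0 \<delta>"] conjI open_Int open_ball) auto
      show "V t0 i = snd (vert M (c t0) (V t0) i)" using eq[OF t0] A \<delta> by simp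
    qed (rule t0)
    have ci: "c t0 \<in> dom TM i" using wi ct0 by simp
    have vel: "velocity TM ?J c t0 i = ?\<xi>"
      using horizontal_lift_curve_velocity(2)[OF h t0' i] aw unfolding ct0 by (simp add: velocity_def w_def)
    show ?thesis
      using cov_deriv_vertical_chart[OF c t0' i(1) ci vv dv] vert_chart[OF i(1) wi]
      unfolding \<eta>[symmetric] vel ct0 by simp
  qed
  obtain \<delta> c where "\<delta> > 0" "horizontal_lift_curve M S (J \<inter> ball t0 \<delta>) \<gamma> c" "c t0 = w"
    using horizontal_lift_curve_exists[OF \<gamma> t0 nb pw] by (auto simp: w_def)
  then have P: "P (cov_deriv_vertical M nabla (J \<inter> ball t0 \<delta>) c (\<lambda>t. vert M (c t) (V t)) t0)" (is "P ?\<eta>")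
    unfolding P_def by blast
  have "(THE \<eta>. P \<eta>) = ?\<eta>"
    by (rule the_equality[where P = P, OF P], rule vertical_eqI[OF i(1) wi]) (use char P in \<open>simp_all only:\<close>)
  then have eq: "cov_deriv M S nabla J \<gamma> W V t0 = vert_inv M w ?\<eta>"
    unfolding cov_deriv_def w_def[symmetric] P_def[symmetric] by simp
  have \<eta>: "?\<eta> \<in> vertical_space M w" "snd (?\<eta> i) = v' + christoffel i w ?\<xi> (V t0 i)" using char[OF P] by blast+
  show "cov_deriv M S nabla J \<gamma> W V t0 \<in> tangent_space M (\<gamma> t0)"
    using vertical_vert_inv(1)[OF \<eta>(1) pw] unfolding eq by (simp add: w_def)
  show "cov_deriv M S nabla J \<gamma> W V t0 i = v' + christoffel i (\<gamma> t0, W t0) ?\<xi> (V t0 i)"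
    using vertical_vert_inv(3)[OF \<eta>(1) pw i(1) wi] \<eta>(2) unfolding eq by (simp add: w_def)
qed

end

section \<open>Curvature in coordinates\<close>

locale lift_atlas = spray_connection_atlas M S nabla
  for M :: "('a, 'i, 'e::euclidean_space) mfd" and S :: "('a, 'i, 'e) slit_field"
    and nabla :: "('a, 'i, 'e) connection" +
  assumes lift: "lift_of_spray_connection M S nabla"
    and torsion: "\<forall>Y\<in>vector_fields (slit_tangent M). torsion M nabla S Y = 0"
begin

lemma nabla_canonical: "X \<in> vector_fields TM \<Longrightarrow> w \<in> pts TM \<Longrightarrow>
    nabla X (canonical_field M) w = vertical_part M S w (X w)"
  using lift unfolding lift_of_spray_connection_def by blast

lemma nabla_canonical_chart:
  assumes X: "X \<in> vector_fields TM" and i: "i \<in> idx M" "w \<in> dom TM i"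
  shows "nabla X (canonical_field M) w i = (0, snd (X w i) + conn_coeff i (crd TM i w) (fst (X w i)))"
proof -
  have w: "w \<in> pts TM" using slit.dom_pts[of i w] i by simp
  show ?thesis
    unfolding nabla_canonical[OF X w] by (rule vertical_part_chart[OF i slit.field_tangent[OF X]])
qed

text \<open>The lift condition and the vanishing of \<open>T(S, \<cdot>)\<close> determine all the Christoffel symbols
  that occur in the second covariant derivatives below.\<close>

lemma christoffel_radial:
  assumes i: "i \<in> idx M" "w \<in> dom TM i"
  shows "christoffel i w \<xi> (snd w i) = conn_coeff i (crd TM i w) (fst \<xi>)"
proof -
  have i': "i \<in> idx TM" and w: "w \<in> pts TM" using slit.dom_pts[of i w] i by simp_all
  obtain X where X: "X \<in> vector_fields TM" "X w = slit.tvec i w \<xi>"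
    using slit_extension[OF w slit.tvec_tangent[OF i' i(2)]] .
  have Xi: "X w i = \<xi>" unfolding X(2) by (rule slit.tvec_self[OF i' i(2)])
  show ?thesis
    using nabla_chart[OF i X(1) canonical_vertical]
    unfolding nabla_canonical_chart[OF X(1) i] fder_canonical_rep[OF i(1) simg_crd[OF i]] canonical_chart[OF i] Xi
    by simp
qed

lemma christoffel_spray:
  assumes i: "i \<in> idx M" "w \<in> dom TM i"
  shows "christoffel i w (S w i) a = conn_coeff i (crd TM i w) a"
proof -
  have i': "i \<in> idx TM" and w: "w \<in> pts TM" using slit.dom_pts[of i w] i by simp_all
  have z: "crd TM i w \<in> simg i" by (rule simg_crd[OF i])
  obtain Y where Y: "Y \<in> vector_fields TM" "Y w = slit.tvec i w (a, 0)"
    using slit_extension[OF w slit.tvec_tangent[OF i' i(2)]] .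
  have Yi: "Y w i = (a, 0)" unfolding Y(2) by (rule slit.tvec_self[OF i' i(2)])
  have JS: "tangent_structure M S = canonical_field M" using spray by (simp add: spray_def)
  let ?F = "fder (field_rep TM i Y) (crd TM i w) (S w i)"
  have "torsion M nabla S Y w i = 0" using bspec[OF torsion Y(1)] by simp
  then have "snd (nabla S (tangent_structure M Y) w i) - snd (nabla Y (canonical_field M) w i)
      - snd (tangent_structure M (lie_bracket TM S Y) w i) = 0"
    unfolding torsion_def JS by simp (metis snd_diff snd_zero)
  moreover have "tangent_structure M Y w i = (0, a)"
    using tangent_structure_chart[where X = Y and w = w, OF slit.field_tangent[OF Y(1)] i] Yi by simp
  then have "snd (nabla S (tangent_structure M Y) w i) = fst ?F + christoffel i w (S w i) a"
    using nabla_chart[OF i S_field tangent_structure_vertical[OF Y(1)]]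
    unfolding tangent_structure_rep(2)[OF Y(1) i(1) z] by simp
  moreover have "snd (nabla Y (canonical_field M) w i) = conn_coeff i (crd TM i w) a"
    unfolding nabla_canonical_chart[OF Y(1) i] Yi by simp
  moreover have "snd (tangent_structure M (lie_bracket TM S Y) w i) = fst ?F"
    using tangent_structure_chart[where X = "lie_bracket TM S Y" and w = w,
        OF slit.lie_bracket_tangent[OF S_field Y(1)] i]
    unfolding slit.lie_bracket_chart[OF i' i(2)] Yi fder_spray_rep[OF i(1) z] by simp
  ultimately show ?thesis by simp
qed

text \<open>By the lift condition this is the vertical part of \<open>S\<close>, and
  \<open>S\<close> is horizontal.\<close>

lemma nabla_spray_canonical: "nabla S (canonical_field M) = 0"
proof
  fix w
  have f: "nabla S (canonical_field M) \<in> vector_fields TM"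
    by (rule vertical_fields_field[OF nabla_vertical[OF S_field canonical_vertical]])
  show "nabla S (canonical_field M) w = 0 w"
  proof (cases "w \<in> pts TM")
    case True
    then obtain i where i: "i \<in> idx M" "w \<in> dom TM i" by (rule slitE)
    then have i': "i \<in> idx TM" by simp
    have "nabla S (canonical_field M) w i = 0"
      unfolding nabla_canonical_chart[OF S_field i] spray_chart[OF i] using conn_coeff_self[OF i]
      by (simp add: zero_prod_def del: slit_tangent_sel(4))
    then have "nabla S (canonical_field M) w = 0"
      by (intro slit.tangent_eqI[OF slit.field_tangent[OF f] slit.tangent_0 i' i(2)]) simp
    then show ?thesis by simp
  qed (use slit.field_outside[OF f] in simp)
qed

text \<open>As the covariant derivative of C along S vanishes, two terms remain: that of C along
  [S, Y], and that of \<beta> along S, where \<beta> is the vertical part of Y. The derivatives of Y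
  along S cancel between them. Horizontality of Y is assumed at \<open>w\<close> only, so \<beta>
  may be nonzero nearby and its derivative contributes.\<close>

lemma curvature_canonical_chart:
  assumes Y: "Y \<in> vector_fields TM" and i: "i \<in> idx M" "w \<in> dom TM i"
    and hor: "snd (Y w i) = - conn_coeff i (crd TM i w) (fst (Y w i))"
  shows "curvature M nabla S Y (canonical_field M) w \<in> vertical_space M w"
    and "snd (curvature M nabla S Y (canonical_field M) w i) =
      - fder (spray_coeff i) (crd TM i w) (Y w i) - conn_coeff i (crd TM i w) (snd (Y w i))
      - fder (\<lambda>z. conn_coeff i z (fst (Y w i))) (crd TM i w) (S w i)"
proof -
  let ?C = "canonical_field M"
  let ?z = "crd TM i w"
  have i': "i \<in> idx TM" and w: "w \<in> pts TM" using slit.dom_pts[of i w] i by simp_all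
  have z: "?z \<in> simg i" by (rule simg_crd[OF i])
  define \<beta> where "\<beta> = nabla Y ?C"
  have \<beta>: "\<beta> \<in> vertical_fields M" unfolding \<beta>_def by (rule nabla_vertical[OF Y canonical_vertical])
  have br: "lie_bracket TM S Y \<in> vector_fields TM" by (rule slit.lie_bracket_field[OF S_field Y])
  have eq: "curvature M nabla S Y ?C = nabla (lie_bracket TM S Y) ?C - nabla S \<beta>"
    unfolding curvature_def nabla_spray_canonical nabla_0_right[OF Y] \<beta>_def by simp
  have eqw: "curvature M nabla S Y ?C w = nabla (lie_bracket TM S Y) ?C w + (-1) *\<^sub>R nabla S \<beta> w"
    unfolding eq by (simp add: fun_eq_iff scaleR_fun_def)
  have v: "nabla X \<sigma> w \<in> vertical_space M w" if "X \<in> vector_fields TM" "\<sigma> \<in> vertical_fields M" for X \<sigma>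
    using nabla_vertical[OF that] w unfolding vertical_fields_def by blast
  show "curvature M nabla S Y ?C w \<in> vertical_space M w"
    unfolding eqw by (intro vertical_add vertical_scaleR w v br canonical_vertical S_field \<beta>)
  let ?F = "fder (field_rep TM i Y) ?z (S w i)"
  \<comment> \<open>Horizontality at \<open>w\<close> makes \<beta> vanish there, which removes the
    Christoffel term from its derivative along S.\<close>
  have \<beta>w: "snd (\<beta> w i) = 0" unfolding \<beta>_def nabla_canonical_chart[OF Y i] hor by simp
  have rep: "field_rep TM i \<beta> y = (0, snd (field_rep TM i Y y) + conn_coeff i y (fst (field_rep TM i Y y)))"
    if y: "y \<in> simg i" for y
  proof -
    obtain v where v: "v \<in> dom TM i" "y = crd TM i v" "crd_inv TM i y = v" using slit_crd_inv[OF i(1) y] .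
    show ?thesis
      unfolding field_rep_def v(3) unfolding \<beta>_def nabla_canonical_chart[OF Y i(1) v(1)] v(2) ..
  qed
  have dY: "(field_rep TM i Y has_derivative fder (field_rep TM i Y) ?z) (at ?z)"
    by (rule C_inf_on_has_derivative[OF slit_rep_C_inf[OF Y i(1)] z])
  have Yi: "field_rep TM i Y ?z = Y w i" by (rule slit.field_rep_crd[OF i' i(2)])
  have "((\<lambda>y. (0::'e, snd (field_rep TM i Y y) + conn_coeff i y (fst (field_rep TM i Y y)))) has_derivative
      (\<lambda>h. (0, snd (fder (field_rep TM i Y) ?z h) +
        (fder (\<lambda>y. conn_coeff i y (fst (field_rep TM i Y ?z))) ?z h
        + conn_coeff i ?z (fst (fder (field_rep TM i Y) ?z h)))))) (at ?z)"
    by (intro has_derivative_Pair has_derivative_const has_derivative_add has_derivative_snd dY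
        conn_coeff_has_derivative[OF i(1) has_derivative_ident z UNIV_I] has_derivative_fst)
  then have "(field_rep TM i \<beta> has_derivative
      (\<lambda>h. (0, snd (fder (field_rep TM i Y) ?z h) +
        (fder (\<lambda>y. conn_coeff i y (fst (field_rep TM i Y ?z))) ?z h
        + conn_coeff i ?z (fst (fder (field_rep TM i Y) ?z h)))))) (at ?z)"
    by (rule has_derivative_transform_within_open[OF _ open_simg[OF i(1)] z]) (simp only: rep)
  note d\<beta> = fder_eqI[OF this]
  have "snd (nabla S \<beta> w i) = snd ?F + (fder (\<lambda>y. conn_coeff i y (fst (Y w i))) ?z (S w i) + conn_coeff i ?z (fst ?F))"
    unfolding nabla_chart[OF i S_field \<beta>] d\<beta> \<beta>w Yi linear_0[OF linear_christoffel[OF i]] by simp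
  moreover have "snd (nabla (lie_bracket TM S Y) ?C w i)
      = snd ?F - fder (spray_coeff i) ?z (Y w i) + conn_coeff i ?z (fst ?F - snd (Y w i))"
    unfolding nabla_canonical_chart[OF br i] slit.lie_bracket_chart[OF i' i(2)] fder_spray_rep[OF i(1) z] by simp
  moreover have "snd (curvature M nabla S Y ?C w i) = snd (nabla (lie_bracket TM S Y) ?C w i) - snd (nabla S \<beta> w i)"
    unfolding eq by simp
  ultimately show "snd (curvature M nabla S Y ?C w i) =
      - fder (spray_coeff i) ?z (Y w i) - conn_coeff i ?z (snd (Y w i))
      - fder (\<lambda>z. conn_coeff i z (fst (Y w i))) ?z (S w i)"
    by (simp add: linear_diff[OF linear_conn_coeff[OF i(1) z]] del: slit_tangent_sel(4))
qed

text \<open>The preceding formula depends on the extension of the horizontal lift only through its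
  value at \<open>w\<close>, so \<open>tensor_at\<close> may be evaluated on any extension.\<close>

lemma curvature_endo_chart:
  assumes i: "i \<in> idx M" "w \<in> dom TM i" and u: "u \<in> tangent_space M (fst w)"
  shows "curvature_endo M S nabla w u \<in> tangent_space M (fst w)"
    and "curvature_endo M S nabla w u i =
      - fder (spray_coeff i) (crd TM i w) (u i, - conn_coeff i (crd TM i w) (u i))
      - conn_coeff i (crd TM i w) (- conn_coeff i (crd TM i w) (u i))
      - fder (\<lambda>z. conn_coeff i z (u i)) (crd TM i w) (S w i)"
proof -
  let ?C = "canonical_field M"
  have w: "w \<in> pts TM" using slit.dom_pts[of i w] i by simp
  note h = horizontal_lift_chart[OF i u]
  obtain Y where Y: "Y \<in> vector_fields TM" "Y w = horizontal_lift M S w u" using slit_extension[OF w h(1)] .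
  have c: "curvature M nabla S X ?C w \<in> vertical_space M w"
      "snd (curvature M nabla S X ?C w i) =
      - fder (spray_coeff i) (crd TM i w) (u i, - conn_coeff i (crd TM i w) (u i))
      - conn_coeff i (crd TM i w) (- conn_coeff i (crd TM i w) (u i))
      - fder (\<lambda>z. conn_coeff i z (u i)) (crd TM i w) (S w i)"
    if X: "X \<in> vector_fields TM" "X w = horizontal_lift M S w u" for X
    using curvature_canonical_chart[OF X(1) i] unfolding X(2) h(2) by (simp_all del: slit_tangent_sel(4))
  have t: "tensor_at TM (\<lambda>Y. curvature M nabla S Y ?C) w (horizontal_lift M S w u) = curvature M nabla S Y ?C w"
    by (rule slit.tensor_at_eqI[OF Y], rule vertical_eqI[OF i]) (simp_all only: c Y)
  show "curvature_endo M S nabla w u \<in> tangent_space M (fst w)"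
    unfolding curvature_endo_def t by (rule vertical_vert_inv(1)[OF c(1)[OF Y] w])
  show "curvature_endo M S nabla w u i =
      - fder (spray_coeff i) (crd TM i w) (u i, - conn_coeff i (crd TM i w) (u i))
      - conn_coeff i (crd TM i w) (- conn_coeff i (crd TM i w) (u i))
      - fder (\<lambda>z. conn_coeff i z (u i)) (crd TM i w) (S w i)"
    unfolding curvature_endo_def t vertical_vert_inv(3)[OF c(1)[OF Y] w i] by (rule c(2)[OF Y])
qed

end

section \<open>Variations of geodesics\<close>

locale variation = lift_atlas M S nabla
  for M :: "('a, 'i, 'e::euclidean_space) mfd" and S :: "('a, 'i, 'e) slit_field"
    and nabla :: "('a, 'i, 'e) connection" +
  fixes \<epsilon> :: real and I :: "real set" and H :: "real \<times> real \<Rightarrow> 'a"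
  assumes \<epsilon>: "\<epsilon> > 0" and I: "is_interval I" "interior I \<noteq> {}"
    and H: "smooth_into M ({-\<epsilon><..<\<epsilon>} \<times> I) H"
    and regular: "\<forall>s\<in>{-\<epsilon><..<\<epsilon>}. \<forall>t\<in>I. velocity M I (\<lambda>\<tau>. H (s, \<tau>)) t \<noteq> 0"
begin

abbreviation "E \<equiv> {-\<epsilon><..<\<epsilon>}"

definition "T s t = velocity M I (\<lambda>\<tau>. H (s, \<tau>)) t"
definition "U s t = velocity M E (\<lambda>\<sigma>. H (\<sigma>, t)) s"

abbreviation "Dt V s t \<equiv> cov_deriv M S nabla I (\<lambda>\<tau>. H (s, \<tau>)) (\<lambda>\<tau>. T s \<tau>) (\<lambda>\<tau>. V s \<tau>) t"
abbreviation "Ds V s t \<equiv> cov_deriv M S nabla E (\<lambda>\<sigma>. H (\<sigma>, t)) (\<lambda>\<sigma>. T \<sigma> t) (\<lambda>\<sigma>. V \<sigma> t) s"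

text \<open>A nondegenerate interval has no isolated points. This makes one-sided derivatives
  unique, also at the end points of \<open>I\<close>.\<close>

lemma within_I: "t \<in> I \<Longrightarrow> at t within I \<noteq> bot"
proof -
  assume t: "t \<in> I"
  have "I \<noteq> {t}" using I(2) by auto
  then have "t islimpt I" using connected_imp_perfect[of I t] I(1) t is_interval_connected by blast
  then show ?thesis using trivial_limit_within by blast
qed

lemma within_E: "s \<in> E \<Longrightarrow> at s within E \<noteq> bot"
  by (simp add: at_within_open[OF _ open_greaterThanLessThan])

lemma H_pts: "s \<in> E \<Longrightarrow> t \<in> I \<Longrightarrow> H (s, t) \<in> pts M"
  using conjunct1[OF H[unfolded smooth_into_def]] by (simp add: image_subset_iff)

lemma smooth_into_slice:
  assumes h: "C_inf_on h UNIV" "\<And>x. x \<in> J \<Longrightarrow> h x \<in> E \<times> I"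
  shows "smooth_into M J (\<lambda>x. H (h x))"
proof (rule smooth_intoI)
  fix x assume x: "x \<in> J"
  have "H (h x) \<in> pts M"
    by (rule subsetD[OF conjunct1[OF H[unfolded smooth_into_def]] imageI[OF h(2)[OF x]]])
  then obtain i where i: "i \<in> idx M" "H (h x) \<in> dom M i" by (rule ptsE)
  obtain A g where A: "open A" "h x \<in> A" "C_inf_on g A" "\<And>y. y \<in> (E \<times> I) \<inter> A \<Longrightarrow> H y \<in> dom M i \<and> crd M i (H y) = g y"
    by (rule smooth_intoD[OF H h(2)[OF x] i], rule that)
  have o: "open (h -` A)" using C_inf_on_continuous_on[OF h(1)] A(1) by (simp add: open_vimage)
  have "C_inf_on (\<lambda>x. g (h x)) (h -` A)"
    by (rule C_inf_on_compose[OF A(3) C_inf_on_subset[OF h(1)] o A(1)]) auto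
  moreover have "\<forall>y\<in>J \<inter> h -` A. H (h y) \<in> dom M i \<and> crd M i (H (h y)) = g (h y)" using A(4) h(2) by blast
  ultimately show "\<exists>i\<in>idx M. \<exists>A g. open A \<and> x \<in> A \<and> C_inf_on g A \<and>
      (\<forall>y\<in>J \<inter> A. H (h y) \<in> dom M i \<and> crd M i (H (h y)) = g y)"
    using i(1) o A(2) by (intro bexI[OF _ i(1)] exI[of _ "h -` A"] exI[of _ "\<lambda>x. g (h x)"]) simp
qed

lemma smooth_t: "s \<in> E \<Longrightarrow> smooth_into M I (\<lambda>\<tau>. H (s, \<tau>))"
  by (rule smooth_into_slice) (auto intro: C_inf_on_Pair)

lemma smooth_s: "t \<in> I \<Longrightarrow> smooth_into M E (\<lambda>\<sigma>. H (\<sigma>, t))"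
  by (rule smooth_into_slice[where h = "\<lambda>\<sigma>. (\<sigma>, t)"]) (auto intro: C_inf_on_Pair)

lemma T_tangent: "s \<in> E \<Longrightarrow> t \<in> I \<Longrightarrow> T s t \<in> tangent_space M (H (s, t))"
  unfolding T_def by (rule velocity_tangent[OF smooth_t _ within_I])

lemma U_tangent: "s \<in> E \<Longrightarrow> t \<in> I \<Longrightarrow> U s t \<in> tangent_space M (H (s, t))"
  unfolding U_def by (rule velocity_tangent[OF smooth_s _ within_E])

lemma HT_pts: "s \<in> E \<Longrightarrow> t \<in> I \<Longrightarrow> (H (s, t), T s t) \<in> pts TM"
  using H_pts T_tangent regular by (simp add: T_def)

lemma velocity_T: "velocity M I (\<lambda>\<tau>. H (s, \<tau>)) t = T s t" by (simp add: T_def)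
lemma velocity_U: "velocity M E (\<lambda>\<sigma>. H (\<sigma>, t)) s = U s t" by (simp add: U_def)

text \<open>By Euler's relation S(T) = (T, - N T), which is the velocity of the horizontal lift
  through T of the curve in t, geodesic or not. Hence the torsion condition controls covariant
  derivatives in t for every s.\<close>

lemma spray_at_T:
  assumes "s \<in> E" "t \<in> I" "i \<in> idx M" "H (s, t) \<in> dom M i"
  shows "(H (s, t), T s t) \<in> dom TM i"
    and "S (H (s, t), T s t) i = (T s t i, - conn_coeff i (crd M i (H (s, t)), T s t i) (T s t i))"
proof -
  show d: "(H (s, t), T s t) \<in> dom TM i" using HT_pts[OF assms(1,2)] assms by simp
  show "S (H (s, t), T s t) i = (T s t i, - conn_coeff i (crd M i (H (s, t)), T s t i) (T s t i))"
    using spray_chart[OF assms(3) d] conn_coeff_self[OF assms(3) d] by simp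
qed

text \<open>The relevant Christoffel map is in direction S(T), so it is known on every vector and
  \<open>V\<close> may be arbitrary.\<close>

lemma Dt_chart:
  assumes st: "s \<in> E" "t \<in> I" and i: "i \<in> idx M" "H (s, t) \<in> dom M i"
    and V: "\<And>\<tau>. \<tau> \<in> I \<Longrightarrow> V s \<tau> \<in> tangent_space M (H (s, \<tau>))"
    and d: "((\<lambda>\<tau>. V s \<tau> i) has_vector_derivative v') (at t within I)"
  shows "Dt V s t \<in> tangent_space M (H (s, t))"
    and "Dt V s t i = v' + conn_coeff i (crd M i (H (s, t)), T s t i) (V s t i)"
proof -
  note c = cov_deriv_chart[where W = "\<lambda>\<tau>. T s \<tau>" and V = "\<lambda>\<tau>. V s \<tau>" and ?t0.0 = t and J = I and \<gamma> = "\<lambda>\<tau>. H (s, \<tau>)",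
      OF smooth_t[OF st(1)] st(2) within_I i HT_pts[OF st] V d]
  show "Dt V s t \<in> tangent_space M (H (s, t))" by (rule c(1))
  show "Dt V s t i = v' + conn_coeff i (crd M i (H (s, t)), T s t i) (V s t i)"
    using c(2) christoffel_spray[OF i(1) spray_at_T(1)[OF st i], of "V s t i"]
    unfolding velocity_T spray_at_T(2)[OF st i] by simp
qed

text \<open>The lift has velocity (U, - N U), in general different from S(T). The Christoffel map in
  this direction is controlled on two values of \<open>V\<close> only: on T by the lift condition,
  and on 0 by linearity.\<close>

lemma Ds_chart:
  assumes st: "s \<in> E" "t \<in> I" and i: "i \<in> idx M" "H (s, t) \<in> dom M i"
    and V: "\<And>\<sigma>. \<sigma> \<in> E \<Longrightarrow> V \<sigma> t \<in> tangent_space M (H (\<sigma>, t))"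
    and d: "((\<lambda>\<sigma>. V \<sigma> t i) has_vector_derivative v') (at s within E)"
  shows "Ds V s t \<in> tangent_space M (H (s, t))"
    and "V s t = T s t \<Longrightarrow> Ds V s t i = v' + conn_coeff i (crd M i (H (s, t)), T s t i) (U s t i)"
    and "V s t = 0 \<Longrightarrow> Ds V s t i = v'"
proof -
  note c = cov_deriv_chart[where W = "\<lambda>\<sigma>. T \<sigma> t" and V = "\<lambda>\<sigma>. V \<sigma> t" and ?t0.0 = s and J = E and \<gamma> = "\<lambda>\<sigma>. H (\<sigma>, t)",
      OF smooth_s[OF st(2)] st(1) within_E i HT_pts[OF st] V d]
  show "Ds V s t \<in> tangent_space M (H (s, t))" by (rule c(1))
  show "Ds V s t i = v' + conn_coeff i (crd M i (H (s, t)), T s t i) (U s t i)" if "V s t = T s t"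
    using c(2) christoffel_radial[OF i(1) spray_at_T(1)[OF st i]] unfolding velocity_U that by simp
  show "Ds V s t i = v'" if "V s t = 0"
    using c(2) linear_0[OF linear_christoffel[OF i(1) spray_at_T(1)[OF st i]]] unfolding that by simp
qed

text \<open>\<open>f\<close> agrees with the smooth function \<open>k\<close> on \<open>I\<close>
  only, and this is all that the filter within \<open>I\<close> sees; at an end point the partial
  derivative of \<open>k\<close> is the one-sided derivative of \<open>f\<close>.\<close>

lemma slice_deriv_t:
  assumes k: "C_inf_on k A" "open A" and st: "t \<in> I" "(s, t) \<in> A"
    and eq: "\<And>\<tau>. \<tau> \<in> I \<Longrightarrow> (s, \<tau>) \<in> A \<Longrightarrow> f \<tau> = k (s, \<tau>)"
  shows "(f has_vector_derivative fder k (s, t) (0, 1)) (at t within I)"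
proof -
  have "((\<lambda>\<tau>. k (s, \<tau>)) has_vector_derivative fder k (s, t) (0, 1)) (at t within I)"
    using C_inf_on_vector_derivative[OF k(1), of "(s, 0)" t "(0, 1)"] st by simp
  then show ?thesis unfolding has_vector_derivative_def
  proof (rule has_derivative_transform_eventually)
    have "open (Pair s -` A)" using k(2) by (intro open_vimage continuous_intros)
    then show "\<forall>\<^sub>F \<tau> in at t within I. k (s, \<tau>) = f \<tau>"
      unfolding eventually_at_topological using eq st by (intro exI[of _ "Pair s -` A"]) auto
  qed (use eq st in auto)
qed

lemma slice_deriv_s:
  assumes k: "C_inf_on k A" "open A" and st: "s \<in> E" "(s, t) \<in> A"
    and eq: "\<And>\<sigma>. \<sigma> \<in> E \<Longrightarrow> (\<sigma>, t) \<in> A \<Longrightarrow> f \<sigma> = k (\<sigma>, t)"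
  shows "(f has_vector_derivative fder k (s, t) (1, 0)) (at s within E)"
proof -
  have "((\<lambda>\<sigma>. k (\<sigma>, t)) has_vector_derivative fder k (s, t) (1, 0)) (at s within E)"
    using C_inf_on_vector_derivative[OF k(1), of "(0, t)" s "(1, 0)"] st by simp
  then show ?thesis unfolding has_vector_derivative_def
  proof (rule has_derivative_transform_eventually)
    have "open ((\<lambda>\<sigma>. (\<sigma>, t)) -` A)" using k(2) by (intro open_vimage continuous_intros)
    then show "\<forall>\<^sub>F \<sigma> in at s within E. k (\<sigma>, t) = f \<sigma>"
      unfolding eventually_at_topological using eq st by (intro exI[of _ "(\<lambda>\<sigma>. (\<sigma>, t)) -` A"]) auto
  qed (use eq st in auto)
qed

text \<open>\<open>g\<close> extends the chart expression of \<open>H\<close> to an open subset of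
  the plane. Its derivative in t is required to be nonzero on all of \<open>A\<close>, so that the
  connection coefficients along \<open>g\<close> are smooth beyond the domain of \<open>H\<close>
  too.\<close>

definition local_rep :: "'i \<Rightarrow> (real \<times> real) set \<Rightarrow> (real \<times> real \<Rightarrow> 'e) \<Rightarrow> bool"
  where "local_rep i A g \<longleftrightarrow> open A \<and> C_inf_on g A \<and> (\<forall>z\<in>A. (g z, fder g z (0, 1)) \<in> simg i) \<and>
    (\<forall>s\<in>E. \<forall>t\<in>I. (s, t) \<in> A \<longrightarrow> H (s, t) \<in> dom M i \<and> crd M i (H (s, t)) = g (s, t) \<and>
      T s t i = fder g (s, t) (0, 1) \<and> U s t i = fder g (s, t) (1, 0))"

lemma local_rep_exists:
  assumes st: "s \<in> E" "t \<in> I" and i: "i \<in> idx M" "H (s, t) \<in> dom M i"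
  obtains A g where "(s, t) \<in> A" "local_rep i A g"
proof -
  have x: "(s, t) \<in> E \<times> I" using st by simp
  obtain A g where A: "open A" "(s, t) \<in> A" "C_inf_on g A"
    and Hg: "\<And>y. y \<in> (E \<times> I) \<inter> A \<Longrightarrow> H y \<in> dom M i \<and> crd M i (H y) = g y"
    by (rule smooth_intoD[OF H x i], rule that)
  have TU: "T s t i = fder g (s, t) (0, 1) \<and> U s t i = fder g (s, t) (1, 0)"
    if st: "s \<in> E" "t \<in> I" "(s, t) \<in> A" for s t
  proof
    have Hst: "H (s, t) \<in> dom M i" using Hg[of "(s, t)"] st by blast
    have "((\<lambda>\<tau>. crd M i (H (s, \<tau>))) has_vector_derivative fder g (s, t) (0, 1)) (at t within I)"
      by (rule slice_deriv_t[OF A(3,1) st(2,3)]) (use Hg st in blast)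
    then show "T s t i = fder g (s, t) (0, 1)"
      unfolding T_def
      by (rule velocity_eqI[where c = "\<lambda>\<tau>. H (s, \<tau>)" and t = t, OF _ within_I[OF st(2)] i(1) Hst])
    have "((\<lambda>\<sigma>. crd M i (H (\<sigma>, t))) has_vector_derivative fder g (s, t) (1, 0)) (at s within E)"
      by (rule slice_deriv_s[OF A(3,1) st(1,3)]) (use Hg st in blast)
    then show "U s t i = fder g (s, t) (1, 0)"
      unfolding U_def
      by (rule velocity_eqI[where c = "\<lambda>\<sigma>. H (\<sigma>, t)" and t = s, OF _ within_E[OF st(1)] i(1) Hst])
  qed
  \<comment> \<open>T is nonzero at points of the domain of \<open>H\<close>; by continuity the
    extension keeps this property after shrinking.\<close>
  define A' where "A' = A \<inter> (\<lambda>z. (g z, fder g z (0, 1))) -` simg i"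
  have "C_inf_on (\<lambda>z. (g z, fder g z (0, 1))) A"
    by (intro C_inf_on_Pair C_inf_on_fder A)
  then have "open A'"
    unfolding A'_def by (rule continuous_open_preimage[OF C_inf_on_continuous_on A(1) open_simg[OF i(1)]])
  moreover have "(s, t) \<in> A'"
  proof -
    have "H (s, t) \<in> dom M i" "crd M i (H (s, t)) = g (s, t)" using Hg[of "(s, t)"] st A by blast+
    then have "crd TM i (H (s, t), T s t) = (g (s, t), fder g (s, t) (0, 1))" using TU[OF st A(2)] by simp
    then show ?thesis using simg_crd[OF i(1) spray_at_T(1)[OF st i]] A(2) by (simp add: A'_def)
  qed
  moreover have "C_inf_on g A'" by (rule C_inf_on_subset[OF A(3)]) (simp add: A'_def)
  moreover have "H (s, t) \<in> dom M i \<and> crd M i (H (s, t)) = g (s, t) \<and>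
      T s t i = fder g (s, t) (0, 1) \<and> U s t i = fder g (s, t) (1, 0)"
    if "s \<in> E" "t \<in> I" "(s, t) \<in> A'" for s t
    using Hg[of "(s, t)"] TU[of s t] that by (simp add: A'_def)
  ultimately have "local_rep i A' g" unfolding local_rep_def by (simp add: A'_def)
  then show thesis using that \<open>(s, t) \<in> A'\<close> by blast
qed

context
  fixes i A g
  assumes i: "i \<in> idx M" and rep: "local_rep i A g"
begin

abbreviation "gt z \<equiv> fder g z (0, 1)"
abbreviation "gs z \<equiv> fder g z (1, 0)"

lemma rep_basic:
  shows "open A" "C_inf_on g A" "z \<in> A \<Longrightarrow> (g z, gt z) \<in> simg i" "C_inf_on gt A" "C_inf_on gs A"
  using rep C_inf_on_fder[of g A] unfolding local_rep_def by blast+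

lemma rep_at:
  assumes "s \<in> E" "t \<in> I" "(s, t) \<in> A"
  shows "H (s, t) \<in> dom M i" "crd M i (H (s, t)) = g (s, t)" "T s t i = gt (s, t)" "U s t i = gs (s, t)"
    "(H (s, t), T s t) \<in> dom TM i" "crd TM i (H (s, t), T s t) = (g (s, t), gt (s, t))"
    "S (H (s, t), T s t) i = (gt (s, t), - conn_coeff i (g (s, t), gt (s, t)) (gt (s, t)))"
proof -
  show *: "H (s, t) \<in> dom M i" "crd M i (H (s, t)) = g (s, t)" "T s t i = gt (s, t)" "U s t i = gs (s, t)"
    using rep assms unfolding local_rep_def by blast+
  show "(H (s, t), T s t) \<in> dom TM i" by (rule spray_at_T(1)[OF assms(1,2) i *(1)])
  show "crd TM i (H (s, t), T s t) = (g (s, t), gt (s, t))" using * by simp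
  show "S (H (s, t), T s t) i = (gt (s, t), - conn_coeff i (g (s, t), gt (s, t)) (gt (s, t)))"
    using spray_at_T(2)[OF assms(1,2) i *(1)] unfolding *(2,3) .
qed

lemma mixed_partials: "z \<in> A \<Longrightarrow> fder gs z (0, 1) = fder gt z (1, 0)"
  by (rule second_derivative_symmetric[OF rep_basic(2,1)])

lemma
  assumes st: "s \<in> E" "t \<in> I" "(s, t) \<in> A"
  shows T_t: "((\<lambda>\<tau>. T s \<tau> i) has_vector_derivative fder gt (s, t) (0, 1)) (at t within I)"
    and U_t: "((\<lambda>\<tau>. U s \<tau> i) has_vector_derivative fder gs (s, t) (0, 1)) (at t within I)"
    and T_s: "((\<lambda>\<sigma>. T \<sigma> t i) has_vector_derivative fder gt (s, t) (1, 0)) (at s within E)"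
  using rep_at(3,4)[OF st(1)] rep_at(3)[OF _ st(2)] st
  by (blast intro: slice_deriv_t[OF rep_basic(4,1)] slice_deriv_t[OF rep_basic(5,1)]
      slice_deriv_s[OF rep_basic(4,1)])+

lemma
  assumes st: "s \<in> E" "t \<in> I" "(s, t) \<in> A"
  shows Dt_T_rep: "Dt T s t i = fder gt (s, t) (0, 1) + conn_coeff i (g (s, t), gt (s, t)) (gt (s, t))"
      "Dt T s t \<in> tangent_space M (H (s, t))"
    and Dt_U_rep: "Dt U s t i = fder gs (s, t) (0, 1) + conn_coeff i (g (s, t), gt (s, t)) (gs (s, t))"
      "Dt U s t \<in> tangent_space M (H (s, t))"
    and Ds_T_rep: "Ds T s t i = fder gt (s, t) (1, 0) + conn_coeff i (g (s, t), gt (s, t)) (gs (s, t))"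
      "Ds T s t \<in> tangent_space M (H (s, t))"
  using Dt_chart[where V = T and s = s and t = t, OF st(1,2) i rep_at(1)[OF st] T_tangent[OF st(1)] T_t[OF st]]
    Dt_chart[where V = U and s = s and t = t, OF st(1,2) i rep_at(1)[OF st] U_tangent[OF st(1)] U_t[OF st]]
    Ds_chart(1,2)[where V = T and s = s and t = t, OF st(1,2) i rep_at(1)[OF st] T_tangent[OF _ st(2)] T_s[OF st]]
  unfolding rep_at(2,3,4)[OF st] by simp_all

end

end

context variation
begin

text \<open>The identity \<open>Ds T s t = Dt U s t\<close> combines equality of mixed partials with
  the fact that both connection terms are N U: one by the lift condition, the other by the torsion
  condition.\<close>

lemma derivs_tangent:
  assumes st: "s \<in> E" "t \<in> I"
  shows "Dt T s t \<in> tangent_space M (H (s, t))" "Ds T s t \<in> tangent_space M (H (s, t))"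
    "Dt U s t \<in> tangent_space M (H (s, t))" "Ds T s t = Dt U s t"
proof -
  obtain i where i: "i \<in> idx M" "H (s, t) \<in> dom M i" using ptsE[OF H_pts[OF st]] .
  obtain A g where A: "(s, t) \<in> A" and rep: "local_rep i A g" using local_rep_exists[OF st i] .
  note reps = Dt_T_rep[OF i(1) rep st A] Dt_U_rep[OF i(1) rep st A] Ds_T_rep[OF i(1) rep st A]
  show "Dt T s t \<in> tangent_space M (H (s, t))" "Ds T s t \<in> tangent_space M (H (s, t))"
    "Dt U s t \<in> tangent_space M (H (s, t))" by (fact reps)+
  show "Ds T s t = Dt U s t"
    by (rule tangent_eqI[OF reps(6,4) i]) (simp only: reps mixed_partials[OF i(1) rep A])
qed

text \<open>In a chart a geodesic satisfies x'' = \<sigma> = - N x', that is x'' + N x' = 0. The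
  second claim says that S(T) is then also the derivative in t of the pair (x, x').\<close>

lemma geodesic_Dt_T:
  assumes geo: "geodesic M S I (\<lambda>t. H (s, t))" and st: "s \<in> E" "t \<in> I"
  shows "Dt T s t = 0"
    and "i \<in> idx M \<Longrightarrow> local_rep i A g \<Longrightarrow> (s, t) \<in> A \<Longrightarrow>
      S (H (s, t), T s t) i = (gt g (s, t), fder (gt g) (s, t) (0, 1))"
proof -
  have vel: "velocity TM I (\<lambda>\<tau>. (H (s, \<tau>), T s \<tau>)) t = S (H (s, t), T s t)"
    using geo st(2) unfolding geodesic_def T_def by blast
  show *: "S (H (s, t), T s t) i = (gt g (s, t), fder (gt g) (s, t) (0, 1))"
    if i: "i \<in> idx M" and rep: "local_rep i A g" and A: "(s, t) \<in> A" for i A g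
  proof -
    note basic = rep_basic[OF i rep]
    have i': "i \<in> idx TM" using i by simp
    have "((\<lambda>\<tau>. crd M i (H (s, \<tau>))) has_vector_derivative gt g (s, t)) (at t within I)"
      by (rule slice_deriv_t[OF basic(2,1) st(2) A]) (rule rep_at(2)[OF i rep st(1)])
    from has_vector_derivative_Pair[OF this T_t[OF i rep st A]] have "((\<lambda>\<tau>. crd TM i (H (s, \<tau>), T s \<tau>)) has_vector_derivative
        (gt g (s, t), fder (gt g) (s, t) (0, 1))) (at t within I)"
      by simp
    from slit.velocity_eqI[where c = "\<lambda>\<tau>. (H (s, \<tau>), T s \<tau>)" and t = t, OF this within_I[OF st(2)] i' rep_at(5)[OF i rep st A]]
    show ?thesis unfolding vel .
  qed
  obtain i where i: "i \<in> idx M" "H (s, t) \<in> dom M i" using ptsE[OF H_pts[OF st]] .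
  obtain A g where A: "(s, t) \<in> A" and rep: "local_rep i A g" using local_rep_exists[OF st i] .
  have "fder (gt g) (s, t) (0, 1) = - conn_coeff i (g (s, t), gt g (s, t)) (gt g (s, t))"
    using *[OF i(1) rep A] unfolding rep_at(7)[OF i(1) rep st A] by simp
  then have "Dt T s t i = 0" unfolding Dt_T_rep(1)[OF i(1) rep st A] by simp
  then show "Dt T s t = 0"
    by (intro tangent_eqI[OF derivs_tangent(1)[OF st] tangent_0 i]) simp
qed

text \<open>The geodesic hypothesis is used twice, for the given \<open>s\<close>: the vanishing of
  \<open>Dt T\<close> at the point permits \<open>Ds_chart\<close> with value 0, and S(T) = (x',
  x'') lets the t-derivative of N along the lift be read as its derivative along
  \<open>S\<close>.\<close>

lemma geodesic_variation:
  assumes geo: "geodesic M S I (\<lambda>t. H (s, t))" and st: "s \<in> E" "t \<in> I"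
  shows "Ds (\<lambda>s t. Dt T s t) s t - Dt (\<lambda>s t. Ds T s t) s t
    = curvature_endo M S nabla (H (s, t), T s t) (U s t)"
proof -
  obtain i where i: "i \<in> idx M" "H (s, t) \<in> dom M i" using ptsE[OF H_pts[OF st]] .
  obtain A g where A: "(s, t) \<in> A" and rep: "local_rep i A g" using local_rep_exists[OF st i] .
  note basic = rep_basic[OF i(1) rep] and at = rep_at[OF i(1) rep]
  let ?w = "(H (s, t), T s t)"
  let ?q = "\<lambda>z. (g z, gt g z)"
  let ?z = "(s, t)"
  let ?N = "conn_coeff i (?q ?z)"
  \<comment> \<open>In coordinates \<open>a\<close> is U, \<open>b\<close> its t-derivative (equally
    the s-derivative of T), \<open>c\<close> the mixed second derivative of T, and \<open>dN\<close>
    the derivative of N along S with the vector \<open>a\<close> frozen.\<close>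
  define a where "a = gs g ?z"
  define b where "b = fder (gt g) ?z (1, 0)"
  define c where "c = fder (\<lambda>z. fder (gt g) z (0, 1)) ?z (1, 0)"
  define dN where "dN = fder (\<lambda>y. conn_coeff i y a) (?q ?z) (S ?w i)"
  have q: "?q ?z \<in> simg i" by (rule basic(3)[OF A])
  have C: "C_inf_on (\<lambda>z. fder (gt g) z v) A" for v by (rule C_inf_on_fder[OF basic(4)])
  have qC: "C_inf_on ?q A" by (intro C_inf_on_Pair basic)
  have qA: "?q ` A \<subseteq> simg i" using basic(3) by blast
  have dq: "(?q has_derivative (\<lambda>h. (fder g ?z h, fder (gt g) ?z h))) (at ?z)"
    by (intro has_derivative_Pair C_inf_on_has_derivative[OF basic(2) A] C_inf_on_has_derivative[OF basic(4) A])
  have cw: "crd TM i ?w = ?q ?z" by (rule at(6)[OF st A])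
  have Sw: "S ?w i = (gt g ?z, fder (gt g) ?z (0, 1))" by (rule geodesic_Dt_T(2)[OF geo st i(1) rep A])

  have Ds: "Ds (\<lambda>s t. Dt T s t) s t \<in> tangent_space M (H (s, t))"
    "Ds (\<lambda>s t. Dt T s t) s t i = c - fder (spray_coeff i) (?q ?z) (a, b)"
  proof -
    \<comment> \<open>By N y = - \<sigma> the derivative of T in t is x'' - \<sigma> on every curve,
      geodesic or not. In this form differentiation in s brings in only a first derivative of
      \<sigma>.\<close>
    let ?K = "\<lambda>z. fder (gt g) z (0, 1) - spray_coeff i (?q z)"
    have K: "C_inf_on ?K A"
      by (intro C_inf_on_diff C basic C_inf_on_compose[OF spray_coeff_C_inf[OF i(1)] qC] open_simg i qA)
    have "(?K has_derivative (\<lambda>h. fder (\<lambda>z. fder (gt g) z (0, 1)) ?z h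
        - fder (spray_coeff i) (?q ?z) (fder g ?z h, fder (gt g) ?z h))) (at ?z)"
      by (intro has_derivative_diff C_inf_on_has_derivative[OF C A]
          has_derivative_compose[OF dq C_inf_on_has_derivative[OF spray_coeff_C_inf[OF i(1)] q]])
    note dK = fder_eqI[OF this]
    have "((\<lambda>\<sigma>. Dt T \<sigma> t i) has_vector_derivative fder ?K ?z (1, 0)) (at s within E)"
    proof (rule slice_deriv_s[OF K basic(1) st(1) A])
      fix \<sigma> assume \<sigma>: "\<sigma> \<in> E" "(\<sigma>, t) \<in> A"
      show "Dt T \<sigma> t i = ?K (\<sigma>, t)"
        using conn_coeff_self[OF i(1) at(5)[OF \<sigma>(1) st(2) \<sigma>(2)]]
        unfolding Dt_T_rep(1)[OF i(1) rep \<sigma>(1) st(2) \<sigma>(2)] at(6)[OF \<sigma>(1) st(2) \<sigma>(2)]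
        using at(3)[OF \<sigma>(1) st(2) \<sigma>(2)] by simp
    qed
    note chart = Ds_chart(1,3)[where V = "\<lambda>s t. Dt T s t" and s = s and t = t, OF st i _ this]
    have tan: "Dt T \<sigma> t \<in> tangent_space M (H (\<sigma>, t))" if "\<sigma> \<in> E" for \<sigma>
      by (rule derivs_tangent(1)[OF that st(2)])
    show "Ds (\<lambda>s t. Dt T s t) s t \<in> tangent_space M (H (s, t))" by (rule chart(1)[OF tan])
    show "Ds (\<lambda>s t. Dt T s t) s t i = c - fder (spray_coeff i) (?q ?z) (a, b)"
      using chart(2)[OF tan geodesic_Dt_T(1)[OF geo st]] unfolding dK a_def b_def c_def .
  qed

  have Dt: "Dt (\<lambda>s t. Ds T s t) s t \<in> tangent_space M (H (s, t))"
    "Dt (\<lambda>s t. Ds T s t) s t i = c + (dN + ?N b) + ?N (b + ?N a)"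
  proof -
    let ?L = "\<lambda>z. fder (gt g) z (1, 0) + conn_coeff i (?q z) (gs g z)"
    have L: "C_inf_on ?L A"
      by (intro C_inf_on_add C basic conn_coeff_C_inf[OF i(1) qC _ _ qA])
    have "(?L has_derivative (\<lambda>h. fder (\<lambda>z. fder (gt g) z (1, 0)) ?z h
        + (fder (\<lambda>y. conn_coeff i y (gs g ?z)) (?q ?z) (fder g ?z h, fder (gt g) ?z h)
          + ?N (fder (gs g) ?z h)))) (at ?z)"
      by (intro has_derivative_add C_inf_on_has_derivative[OF C A]
          conn_coeff_has_derivative[OF i(1) dq q UNIV_I] C_inf_on_has_derivative[OF basic(5) A])
    note dL = fder_eqI[OF this]
    have L_rep: "Ds T s \<tau> i = ?L (s, \<tau>)" if "\<tau> \<in> I" "(s, \<tau>) \<in> A" for \<tau>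
      by (rule Ds_T_rep(1)[OF i(1) rep st(1) that])
    have "((\<lambda>\<tau>. Ds T s \<tau> i) has_vector_derivative fder ?L ?z (0, 1)) (at t within I)"
      by (rule slice_deriv_t[OF L basic(1) st(2) A L_rep])
    note chart = Dt_chart[where V = "\<lambda>s t. Ds T s t" and s = s and t = t,
        OF st i derivs_tangent(2)[OF st(1)] this]
    show "Dt (\<lambda>s t. Ds T s t) s t \<in> tangent_space M (H (s, t))" by (rule chart(1))
    have "Dt (\<lambda>s t. Ds T s t) s t i = fder ?L ?z (0, 1) + ?N (?L ?z)"
      using chart(2) unfolding L_rep[OF st(2) A] at(2,3)[OF st A] .
    moreover have "fder (\<lambda>z. fder (gt g) z (1, 0)) ?z (0, 1) = c"
      unfolding c_def by (rule second_derivative_symmetric[OF basic(4,1) A])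
    ultimately show "Dt (\<lambda>s t. Ds T s t) s t i = c + (dN + ?N b) + ?N (b + ?N a)"
      unfolding dL mixed_partials[OF i(1) rep A] dN_def Sw a_def b_def by simp
  qed

  have R: "curvature_endo M S nabla ?w (U s t) i
      = - fder (spray_coeff i) (?q ?z) (a, - ?N a) - ?N (- ?N a) - dN"
    using curvature_endo_chart(2)[OF i(1) at(5)[OF st A], of "U s t"] U_tangent[OF st]
    unfolding cw at(4)[OF st A] a_def[symmetric] dN_def[symmetric] by simp
  have lin: "linear ?N" by (rule linear_conn_coeff[OF i(1) q])
  \<comment> \<open>On the left, splitting D\<sigma>(a, b) gives c - D\<sigma>(a, 0) + 2 N b; from
    it c + dN + 2 N b + N N a is subtracted, so c and 2 N b disappear. On the right, splitting
    D\<sigma>(a, - N a) gives - 2 N N a, of which the second term takes back one half.\<close>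
  have "(Ds (\<lambda>s t. Dt T s t) s t - Dt (\<lambda>s t. Ds T s t) s t) i
      = curvature_endo M S nabla ?w (U s t) i"
    unfolding minus_apply Ds(2) Dt(2) R fder_spray_coeff_split[OF i(1) q, of a b]
      fder_spray_coeff_split[OF i(1) q, of a "- ?N a"]
    by (simp add: linear_neg[OF lin] linear_add[OF lin] scaleR_2)
  moreover have "curvature_endo M S nabla ?w (U s t) \<in> tangent_space M (H (s, t))"
    using curvature_endo_chart(1)[OF i(1) at(5)[OF st A], of "U s t"] U_tangent[OF st] by simp
  ultimately show ?thesis using tangent_eqI[OF tangent_diff[OF Ds(1) Dt(1)] _ i] by blast
qed

text \<open>All curves being geodesics, \<open>Dt T\<close> vanishes for every \<open>s\<close>, so
  its derivative in s is zero and the commutator reduces to minus the second derivative in t. There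
  \<open>Ds T\<close> is replaced by \<open>Dt U\<close> along the whole curve.\<close>

lemma Jacobi_equation:
  assumes geo: "\<And>s. s \<in> E \<Longrightarrow> geodesic M S I (\<lambda>t. H (s, t))" and st: "s \<in> E" "t \<in> I"
  shows "Dt (\<lambda>s t. Dt U s t) s t + curvature_endo M S nabla (H (s, t), T s t) (U s t) = 0"
proof -
  obtain i where i: "i \<in> idx M" "H (s, t) \<in> dom M i" using ptsE[OF H_pts[OF st]] .
  have "Ds (\<lambda>s t. Dt T s t) s t = Ds (\<lambda>s t. 0) s t"
    by (rule cov_deriv_cong) (rule geodesic_Dt_T(1)[OF geo _ st(2)])
  also have "\<dots> = 0"
  proof -
    have d: "((\<lambda>\<sigma>. (0 :: 'i \<Rightarrow> 'e) i) has_vector_derivative 0) (at s within E)"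
      by (rule has_vector_derivative_const)
    note chart = Ds_chart(1,3)[where V = "\<lambda>s t. 0" and s = s and t = t, OF st i tangent_0 d]
    show ?thesis
      by (rule tangent_eqI[OF chart(1) tangent_0 i]) (simp only: chart(2)[OF refl] zero_fun_apply)
  qed
  finally have "Ds (\<lambda>s t. Dt T s t) s t = 0" .
  moreover have "Dt (\<lambda>s t. Dt U s t) s t = Dt (\<lambda>s t. Ds T s t) s t"
    by (rule cov_deriv_cong) (rule derivs_tangent(4)[OF st(1), symmetric])
  ultimately show ?thesis
    unfolding geodesic_variation[OF geo[OF st(1)] st, symmetric] by (simp only: diff_0 right_minus)
qed

end

theorem theorem2p20:
  fixes M :: "('a, 'i, 'e::euclidean_space) mfd"
    and S :: "('a, 'i, 'e) slit_field"
    and nabla :: "('a, 'i, 'e) connection"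
    and \<epsilon> :: real
    and I :: "real set"
    and H :: "real \<times> real \<Rightarrow> 'a"
    and T U :: "real \<Rightarrow> real \<Rightarrow> 'i \<Rightarrow> 'e"
    and Dt Ds :: "(real \<Rightarrow> real \<Rightarrow> 'i \<Rightarrow> 'e) \<Rightarrow> real \<Rightarrow> real \<Rightarrow> 'i \<Rightarrow> 'e"
  assumes "smooth_manifold M"
    and "spray M S"
    and "lift_of_spray_connection M S nabla"
    and "\<forall>Y\<in>vector_fields (slit_tangent M). torsion M nabla S Y = 0"
    and "\<epsilon> > 0"
    and "is_interval I" and "interior I \<noteq> {}"
    and "smooth_into M ({-\<epsilon><..<\<epsilon>} \<times> I) H"
    and T: "\<And>s t. T s t = velocity M I (\<lambda>\<tau>. H (s, \<tau>)) t"
    and U: "\<And>s t. U s t = velocity M {-\<epsilon><..<\<epsilon>} (\<lambda>\<sigma>. H (\<sigma>, t)) s"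
    and "\<forall>s\<in>{-\<epsilon><..<\<epsilon>}. \<forall>t\<in>I. T s t \<noteq> 0"
    and Dt: "\<And>V s t. Dt V s t = cov_deriv M S nabla I (\<lambda>\<tau>. H (s, \<tau>)) (\<lambda>\<tau>. T s \<tau>) (\<lambda>\<tau>. V s \<tau>) t"
    and Ds: "\<And>V s t. Ds V s t =
      cov_deriv M S nabla {-\<epsilon><..<\<epsilon>} (\<lambda>\<sigma>. H (\<sigma>, t)) (\<lambda>\<sigma>. T \<sigma> t) (\<lambda>\<sigma>. V \<sigma> t) s"
  shows "(geodesic M S I (\<lambda>t. H (0, t)) \<longrightarrow>
      (\<forall>t\<in>I. Ds (Dt T) 0 t - Dt (Ds T) 0 t = curvature_endo M S nabla (H (0, t), T 0 t) (U 0 t)))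
    \<and> ((\<forall>s\<in>{-\<epsilon><..<\<epsilon>}. geodesic M S I (\<lambda>t. H (s, t))) \<longrightarrow>
      (\<forall>t\<in>I.
        (let \<gamma> = (\<lambda>\<tau>. H (0, \<tau>)); \<gamma>' = velocity M I \<gamma>; J = (\<lambda>\<tau>. U 0 \<tau>);
             D = cov_deriv M S nabla I \<gamma> \<gamma>'
         in D (D J) t + curvature_endo M S nabla (\<gamma> t, \<gamma>' t) (J t) = 0)))"
proof -
  interpret atlas M using assms(1) by (rule smooth_manifold_atlas)
  interpret v: variation M S nabla \<epsilon> I H
  proof unfold_locales
    show "Hausdorff_space (mfd_topology M)" using assms(1) by (simp add: smooth_manifold_def)
    show "linear_connection M nabla" using assms(3) by (simp add: lift_of_spray_connection_def)
    show "\<forall>s\<in>{-\<epsilon><..<\<epsilon>}. \<forall>t\<in>I. velocity M I (\<lambda>\<tau>. H (s, \<tau>)) t \<noteq> 0" using assms(11) unfolding T .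
  qed (fact assms)+
  have TU: "T = v.T" "U = v.U" by (simp_all add: fun_eq_iff T U v.T_def v.U_def)
  have vel: "velocity M I (\<lambda>\<tau>. H (0, \<tau>)) = (\<lambda>\<tau>. v.T 0 \<tau>)" by (simp add: fun_eq_iff v.T_def)
  have 0: "0 \<in> {-\<epsilon><..<\<epsilon>}" using assms(5) by simp
  have "Ds (Dt T) 0 t - Dt (Ds T) 0 t = curvature_endo M S nabla (H (0, t), T 0 t) (U 0 t)"
    if "geodesic M S I (\<lambda>t. H (0, t))" "t \<in> I" for t
    using v.geodesic_variation[OF that(1) 0 that(2)] unfolding Ds Dt TU .
  moreover have "v.Dt (\<lambda>s t. v.Dt v.U s t) 0 t + curvature_endo M S nabla (H (0, t), v.T 0 t) (v.U 0 t) = 0"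
    if "\<forall>s\<in>{-\<epsilon><..<\<epsilon>}. geodesic M S I (\<lambda>t. H (s, t))" "t \<in> I" for t
    by (rule v.Jacobi_equation[OF bspec[OF that(1)] 0 that(2)])
  ultimately show ?thesis unfolding Let_def vel TU by blast
qed

end
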